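(* Let $a,b\in\mathbb{C}$ with $b\neq0$ and $(a^2-4)(b^2-4)(a^2-1)(b^2-a-2)\neq0$, and let $C_{a,b}\subset\mathbb{P}^2(\mathbb{C})$ be the smooth plane quartic $x^4+y^4+z^4+ax^2y^2+b(x^2+y^2)z^2=0$. Let $G_1\cong D_4$ be the group of order $8$ of projective transformations generated by $\sigma_1,\tau_1$ (defined in the context), acting on $C_{a,b}$. Put $$P(a,b)=a^2+b^2-ab^2,\qquad Q(a,b)=36-12a+a^2-10b^2+3ab^2 .$$ Then the $1$-Weierstrass points of $C_{a,b}$, together with their geometry and their decomposition into $G_1$-orbits, are as follows. (1) If $P(a,b)=0$ and $Q(a,b)=0$, then $C_{a,b}$ has exactly $8$ ordinary flexes, forming one $G_1$-orbit of $8$ points, and exactly $8$ hyperflexes, forming two $G_1$-orbits of $4$ points each. (2) If $P(a,b)=0$ and $Q(a,b)\neq0$, then either $C_{a,b}$ has no ordinary flexes and exactly $12$ hyperflexes, forming one $G_1$-orbit of $4$ points and one of $8$ points; or $C_{a,b}$ has exactly $16$ ordinary flexes, forming two $G_1$-orbits of $8$ points each, and exactly $4$ hyperflexes, forming one $G_1$-orbit of $4$ points. (3) If $P(a,b)\neq0$ and $Q(a,b)=0$, then either $C_{a,b}$ has no ordinary flexes and exactly $12$ hyperflexes, forming one $G_1$-orbit of $4$ points and one of $8$ points; or $C_{a,b}$ has exactly $16$ ordinary flexes, forming two $G_1$-orbits of $8$ points each, and exactly $4$ hyperflexes, forming one $G_1$-orbit of $4$ points. (4) If $P(a,b)\neq0$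 and $Q(a,b)\neq0$, then either $C_{a,b}$ has exactly $24$ ordinary flexes, forming three $G_1$-orbits of $8$ points each, and no hyperflexes; or $C_{a,b}$ has exactly $8$ ordinary flexes, forming one $G_1$-orbit of $8$ points, and exactly $8$ hyperflexes, forming one $G_1$-orbit of $8$ points.
   Context: The group $G_1$ is generated by the projective transformations given by the matrices $\sigma_1=\begin{pmatrix}0&1&0\\1&0&0\\0&0&1\end{pmatrix}$ and $\tau_1=\begin{pmatrix}0&1&0\\-1&0&0\\0&0&1\end{pmatrix}$, acting on $[x:y:z]$ (as column vectors). For a smooth projective curve $C$ with canonical divisor $K$ and $p\in C$, a positive integer $n$ is a $1$-gap at $p$ if $l(K-(n-1)p)>l(K-np)$, where $l(D)=\dim_{\mathbb{C}} L(D)$. If $n_1<\dots<n_g$ are the $1$-gaps at $p$ ($g$ the genus), the $1$-weight of $p$ is $\omega^{(1)}(p)=\sum_i (n_i-i)$, and $p$ is a $1$-Weierstrass point if $\omega^{(1)}(p)>0$. On a smooth plane quartic the $1$-Weierstrass points are exactly the flexes, i.e. the points $p$ whose tangent line $L_p$ satisfies $I_p(C,L_p)\ge 3$. A flex is an ordinary flex if $I_p(C,L_p)=3$ (equivalently $\omega^{(1)}(p)=1$, gap sequence $\{1,2,4\}$) and a hyperflex if $I_p(C,L_p)=4$ (equivalently $\omega^{(1)}(p)=2$, gap sequence $\{1,2,5\}$). *)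

theory Defs
  imports
    "HOL-Analysis.Analysis"
    "HOL-Library.Function_Algebras"
    "HOL-Computational_Algebra.Computational_Algebra"
    "HOL-Algebra.Bij"
    "HOL-Algebra.Generated_Groups"
    "HOL-Algebra.Group_Action"
begin

section \<open>The projective plane and plane curves\<close>

text \<open>A point of the projective plane is the set of its homogeneous coordinate vectors.\<close>

type_synonym ppoint = "(complex ^ 3) set"

definition proj_point :: "complex ^ 3 \<Rightarrow> ppoint" where
  "proj_point v = {c *s v | c. c \<noteq> 0}"

definition P2 :: "ppoint set" where
  "P2 = proj_point ` {v. v \<noteq> 0}"

text \<open>
  The ring of polynomials in three variables, as iterated univariate polynomials: the innermost
  variable is \<open>x\<close>, the outermost one is \<open>z\<close>. So the coefficient of
  \<open>x^i y^j z^k\<close> in \<open>G\<close> is \<open>coeff (coeff (coeff G k) j) i\<close>.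
\<close>

type_synonym poly3 = "complex poly poly poly"

definition const3 :: "complex \<Rightarrow> poly3" where "const3 c = [:[:[:c:]:]:]"
definition X3 :: poly3 where "X3 = [:[:[:0, 1:]:]:]"
definition Y3 :: poly3 where "Y3 = [:[:0, 1:]:]"
definition Z3 :: poly3 where "Z3 = [:0, 1:]"

definition homogeneous :: "nat \<Rightarrow> poly3 \<Rightarrow> bool" where
  "homogeneous d G \<longleftrightarrow>
     (\<forall>i j k. coeff (coeff (coeff G k) j) i \<noteq> 0 \<longrightarrow> i + j + k = d)"

text \<open>Evaluation at a triple over a commutative ring into which \<open>\<iota>\<close> embeds the complex numbers.\<close>

definition eval3 ::
  "(complex \<Rightarrow> 'r::comm_ring_1) \<Rightarrow> 'r ^ 3 \<Rightarrow> poly3 \<Rightarrow> 'r" where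
  "eval3 \<iota> v G =
     poly (map_poly (\<lambda>q. poly (map_poly (\<lambda>r. poly (map_poly \<iota> r) (v $ 1)) q) (v $ 2)) G) (v $ 3)"

definition dX :: "poly3 \<Rightarrow> poly3" where "dX = map_poly (map_poly pderiv)"
definition dY :: "poly3 \<Rightarrow> poly3" where "dY = map_poly pderiv"
definition dZ :: "poly3 \<Rightarrow> poly3" where "dZ = pderiv"

definition curve :: "poly3 \<Rightarrow> ppoint set" where
  "curve F = {p \<in> P2. \<forall>v\<in>p. eval3 id v F = 0}"


section \<open>Local parametrizations and intersection multiplicities\<close>

text \<open>
  A local parametrization of the curve \<open>F = 0\<close> at \<open>p\<close> is a formal arc
  \<open>\<gamma>(t)\<close> on it with \<open>\<gamma>(0)\<close> representing \<open>p\<close>,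
  immersed in the projective plane: \<open>\<gamma>'(0)\<close> is not proportional to
  \<open>\<gamma>(0)\<close>. At a smooth point it exists, \<open>t\<close> is a uniformizer of the
  curve at \<open>p\<close>, and \<open>\<gamma>\<close> is unique up to rescaling by a unit and an invertible
  change of the parameter \<open>t\<close>. The notions below do not depend on this choice.
\<close>

definition arc_coeff :: "(complex fps) ^ 3 \<Rightarrow> nat \<Rightarrow> complex ^ 3" where
  "arc_coeff \<gamma> n = (\<chi> i. fps_nth (\<gamma> $ i) n)"

definition is_local_param :: "poly3 \<Rightarrow> ppoint \<Rightarrow> (complex fps) ^ 3 \<Rightarrow> bool" where
  "is_local_param F p \<gamma> \<longleftrightarrow>
     eval3 fps_const \<gamma> F = 0 \<and> arc_coeff \<gamma> 0 \<in> p \<and>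
     (\<forall>c. arc_coeff \<gamma> 1 \<noteq> c *s arc_coeff \<gamma> 0)"

definition local_param :: "poly3 \<Rightarrow> ppoint \<Rightarrow> (complex fps) ^ 3" where
  "local_param F p = (SOME \<gamma>. is_local_param F p \<gamma>)"

definition restrict_form :: "poly3 \<Rightarrow> ppoint \<Rightarrow> poly3 \<Rightarrow> complex fps" where
  "restrict_form F p G = eval3 fps_const (local_param F p) G"

text \<open>
  The intersection multiplicity at a smooth point \<open>p\<close> of the curve \<open>F = 0\<close> with
  the curve \<open>G = 0\<close> is the order of vanishing of \<open>G\<close> along \<open>F = 0\<close>
  at \<open>p\<close>.
\<close>

definition intersection_mult :: "poly3 \<Rightarrow> ppoint \<Rightarrow> poly3 \<Rightarrow> enat" where
  "intersection_mult F p G =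
     (if restrict_form F p G = 0 then \<infinity> else enat (subdegree (restrict_form F p G)))"

text \<open>The linear form defining the tangent line \<open>L\<^sub>p\<close>; the choice of \<open>v\<close> only rescales it.\<close>

definition tangent_form :: "poly3 \<Rightarrow> ppoint \<Rightarrow> poly3" where
  "tangent_form F p = (let v = (SOME v. v \<in> p) in
     const3 (eval3 id v (dX F)) * X3 + const3 (eval3 id v (dY F)) * Y3
       + const3 (eval3 id v (dZ F)) * Z3)"

definition flexes :: "poly3 \<Rightarrow> ppoint set" where
  "flexes F = {p \<in> curve F. intersection_mult F p (tangent_form F p) \<ge> 3}"

definition ordinary_flexes :: "poly3 \<Rightarrow> ppoint set" where
  "ordinary_flexes F = {p \<in> flexes F. intersection_mult F p (tangent_form F p) = 3}"

definition hyperflexes :: "poly3 \<Rightarrow> ppoint set" where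
  "hyperflexes F = {p \<in> flexes F. intersection_mult F p (tangent_form F p) = 4}"


section \<open>Rational functions, divisors and Weierstrass points\<close>

text \<open>
  A rational function on the curve is represented by the family of its Laurent expansions at all
  points, with respect to the chosen local parametrizations (and by \<open>0\<close> off the curve). This
  embeds the function field into the product of the local fields of Laurent series;
  addition, multiplication and scalar multiplication are pointwise.
\<close>

type_synonym germs = "ppoint \<Rightarrow> complex fls"

definition germ_scale :: "complex \<Rightarrow> germs \<Rightarrow> germs" where
  "germ_scale c f = (\<lambda>p. fls_const c * f p)"

lemma vector_space_germs: "vector_space germ_scale"
  by unfold_locales (auto simp: germ_scale_def fun_eq_iff algebra_simps
      fls_plus_const [symmetric] fls_const_mult_const [symmetric] simp del: fls_const_mult_const)

definition quotient_germs :: "poly3 \<Rightarrow> poly3 \<Rightarrow> poly3 \<Rightarrow> germs" where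
  "quotient_germs F G H = (\<lambda>p. if p \<in> curve F
     then fps_to_fls (restrict_form F p G) / fps_to_fls (restrict_form F p H) else 0)"

text \<open>
  The function field: quotients of forms of the same degree whose denominator vanishes on no
  component of the curve (for an irreducible curve: does not vanish identically on it).
\<close>

definition function_field :: "poly3 \<Rightarrow> germs set" where
  "function_field F = {quotient_germs F G H | G H d. homogeneous d G \<and> homogeneous d H \<and>
     (\<forall>p\<in>curve F. restrict_form F p H \<noteq> 0)}"

text \<open>
  A divisor is given by its coefficients. The space \<open>L(D)\<close> consists of \<open>0\<close> and the
  rational functions \<open>f\<close> with \<open>div f + D \<ge> 0\<close>.
\<close>

definition riemann_roch_space :: "poly3 \<Rightarrow> (ppoint \<Rightarrow> int) \<Rightarrow> germs set" where
  "riemann_roch_space F D = {f \<in> function_field F.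
     \<forall>p\<in>curve F. f p = 0 \<or> fls_subdegree (f p) + D p \<ge> 0}"

definition ldim :: "poly3 \<Rightarrow> (ppoint \<Rightarrow> int) \<Rightarrow> nat" where
  "ldim F D = vector_space.dim germ_scale (riemann_roch_space F D)"

text \<open>
  A canonical divisor is the divisor of a nonzero rational differential \<open>f dg\<close>. At \<open>p\<close> the
  expansion of \<open>f dg\<close> is \<open>f(t) g'(t) dt\<close>. Being nonzero again means nonzero on every component.
\<close>

definition canonical_divisor :: "poly3 \<Rightarrow> (ppoint \<Rightarrow> int) \<Rightarrow> bool" where
  "canonical_divisor F K \<longleftrightarrow> (\<exists>f\<in>function_field F. \<exists>g\<in>function_field F.
     (\<forall>p\<in>curve F. f p * fls_deriv (g p) \<noteq> 0) \<and>
     K = (\<lambda>p. if p \<in> curve F then fls_subdegree (f p * fls_deriv (g p)) else 0))"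

definition sub_multiple :: "(ppoint \<Rightarrow> int) \<Rightarrow> nat \<Rightarrow> ppoint \<Rightarrow> ppoint \<Rightarrow> int" where
  "sub_multiple K n p = (\<lambda>q. if q = p then K q - int n else K q)"

definition one_gaps :: "poly3 \<Rightarrow> (ppoint \<Rightarrow> int) \<Rightarrow> ppoint \<Rightarrow> nat set" where
  "one_gaps F K p =
     {n. n \<ge> 1 \<and> ldim F (sub_multiple K (n - 1) p) > ldim F (sub_multiple K n p)}"

text \<open>List positions start at \<open>0\<close>, hence \<open>Suc i\<close>.\<close>

definition one_weight :: "poly3 \<Rightarrow> (ppoint \<Rightarrow> int) \<Rightarrow> ppoint \<Rightarrow> int" where
  "one_weight F K p = (let ns = sorted_list_of_set (one_gaps F K p) in
     \<Sum>i<length ns. int (ns ! i) - int (Suc i))"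

definition one_weierstrass_points :: "poly3 \<Rightarrow> (ppoint \<Rightarrow> int) \<Rightarrow> ppoint set" where
  "one_weierstrass_points F K = {p \<in> curve F. one_weight F K p > 0}"


section \<open>The quartic and the group acting on it\<close>

definition quartic :: "complex \<Rightarrow> complex \<Rightarrow> poly3" where
  "quartic a b = X3 ^ 4 + Y3 ^ 4 + Z3 ^ 4 + const3 a * X3 ^ 2 * Y3 ^ 2
     + const3 b * (X3 ^ 2 + Y3 ^ 2) * Z3 ^ 2"

definition P_ab :: "complex \<Rightarrow> complex \<Rightarrow> complex" where
  "P_ab a b = a ^ 2 + b ^ 2 - a * b ^ 2"

definition Q_ab :: "complex \<Rightarrow> complex \<Rightarrow> complex" where
  "Q_ab a b = 36 - 12 * a + a ^ 2 - 10 * b ^ 2 + 3 * a * b ^ 2"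

definition sigma1 :: "complex ^ 3 ^ 3" where
  "sigma1 = vector [vector [0, 1, 0], vector [1, 0, 0], vector [0, 0, 1]]"

definition tau1 :: "complex ^ 3 ^ 3" where
  "tau1 = vector [vector [0, 1, 0], vector [-1, 0, 0], vector [0, 0, 1]]"

text \<open>
  The elements of \<open>BijGroup P2\<close> are the bijections of \<open>P2\<close> that are extensional,
  that is, \<open>undefined\<close> off \<open>P2\<close>; hence the restriction.
\<close>

definition proj_map :: "complex ^ 3 ^ 3 \<Rightarrow> ppoint \<Rightarrow> ppoint" where
  "proj_map A = restrict (\<lambda>p. (\<lambda>v. A *v v) ` p) P2"

definition G1 :: "(ppoint \<Rightarrow> ppoint) monoid" where
  "G1 = (BijGroup P2) \<lparr>carrier := generate (BijGroup P2) {proj_map sigma1, proj_map tau1}\<rparr>"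

text \<open>
  The finite set \<open>S\<close> of points is a union of \<open>G1\<close>-orbits, whose sizes form the
  multiset \<open>M\<close> (so \<open>size M\<close> is the number of orbits).
\<close>

definition decomposes_into_orbits :: "ppoint set \<Rightarrow> nat multiset \<Rightarrow> bool" where
  "decomposes_into_orbits S M \<longleftrightarrow>
     finite S \<and> \<Union> (orbits G1 S (\<lambda>g. g)) = S \<and>
     image_mset card (mset_set (orbits G1 S (\<lambda>g. g))) = M"

end

theory Submission
  imports Defs
begin

text \<open>
  Two facts carry the proof. First, for a canonical divisor \<open>K = div (N / M)\<close>, with forms
  \<open>N\<close>, \<open>M\<close> of degrees \<open>m + 1\<close>, \<open>m\<close>, the space \<open>L(K)\<close> is \<open>{l M / N | l linear}\<close>. This is
  Max Noether's theorem: a form \<open>R\<close> whose divisor dominates that of a form \<open>S\<close> of degree one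
  less is \<open>l S\<close> on the curve. Multiplying \<open>S\<close> by its conjugates over \<open>\<complex>(x)\<close> reduces to the
  case where \<open>S\<close> is a product of lines through \<open>[0:1:0]\<close>, which are divided out one by one. Hence the
  gaps at \<open>p\<close> are \<open>1\<close>, \<open>2\<close> and \<open>I + 1\<close>, where \<open>I\<close> is the contact order with the tangent line.

  Second, along an affine arc \<open>I - 2\<close> is the order of the Wronskian \<open>x' y'' - x'' y'\<close>, hence of the
  bordered Hessian, which on the curve is \<open>- 8 h(s)\<close> for a cubic \<open>h\<close> in \<open>s = x\<^sup>2 + y\<^sup>2\<close>.
  The fibres of \<open>s\<close> are the \<open>G1\<close>-orbits of affine points: \<open>s\<close> is unramified at orbits of size \<open>8\<close> and ramified of
  order two at those of size \<open>4\<close>. A line meets the curve with multiplicity at most \<open>4\<close>, so a root of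
  \<open>h\<close> has multiplicity at most two on the former and one on the latter orbits. The latter carry flexes
  exactly when \<open>P = 0\<close> (points on the axes) or \<open>Q = 0\<close> (points with \<open>x = \<plusminus> y\<close>), and the
  multiplicities of the roots of \<open>h\<close> add up to \<open>3\<close>.
\<close>

section \<open>Evaluating forms\<close>

text \<open>The curve is accessible only through expansions along parametrizations picked by choice,
  and its function field is a set of families of Laurent series. So identities are stated for all
  pairs of Laurent series that satisfy the equation, and divisibility is tested by orders at each
  point.

  The degree difference between \<open>N\<close> and \<open>M\<close> comes from the differential
  \<open>dx / F\<^sub>y\<close>, which is regular and nonzero at affine points and vanishes to first
  order at the points at infinity. The orders that linear forms attain at \<open>p\<close> are
  \<open>0\<close>, \<open>1\<close> and \<open>I\<close>; each of them raised by one is a gap.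

  The function \<open>s\<close> enters because \<open>x\<^sup>2 + y\<^sup>2\<close> and
  \<open>x\<^sup>2 y\<^sup>2\<close> generate the \<open>G1\<close>-invariant polynomials in
  \<open>x\<close> and \<open>y\<close>, and the equation of the curve reads
  \<open>s\<^sup>2 + b s + 1 + (a - 2) x\<^sup>2 y\<^sup>2 = 0\<close>. Hence \<open>s\<close> alone
  determines the orbit, and the same relation removes \<open>x\<^sup>2 y\<^sup>2\<close> from the
  bordered Hessian. The condition \<open>b \<noteq> 0\<close> keeps flexes away from infinity and,
  with \<open>a + 2 \<noteq> 0\<close>, gives \<open>h\<close> degree three.\<close>

definition is_ring_hom :: "('a::comm_ring_1 \<Rightarrow> 'r::comm_ring_1) \<Rightarrow> bool" where
  "is_ring_hom \<phi> \<longleftrightarrow> \<phi> 1 = 1 \<and> (\<forall>x y. \<phi> (x + y) = \<phi> x + \<phi> y) \<and> (\<forall>x y. \<phi> (x * y) = \<phi> x * \<phi> y)"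

lemma is_ring_homD:
  assumes "is_ring_hom \<phi>"
  shows "\<phi> 1 = 1" "\<phi> (x + y) = \<phi> x + \<phi> y" "\<phi> (x * y) = \<phi> x * \<phi> y"
    "\<phi> 0 = 0" "\<phi> (- x) = - \<phi> x" "\<phi> (x - y) = \<phi> x - \<phi> y" "\<phi> (x ^ n) = \<phi> x ^ n"
    "\<phi> (sum f A) = (\<Sum>i\<in>A. \<phi> (f i))"
proof -
  show 1: "\<phi> 1 = 1" and 2: "\<phi> (x + y) = \<phi> x + \<phi> y" and 3: "\<phi> (x * y) = \<phi> x * \<phi> y" for x y
    using assms by (auto simp: is_ring_hom_def)
  show 0: "\<phi> 0 = 0"
    using 2[of 0 0] by simp
  show 4: "\<phi> (- x) = - \<phi> x" for x
    using 2[of x "- x"] 0 by (simp add: eq_neg_iff_add_eq_0 add.commute)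
  show "\<phi> (x - y) = \<phi> x - \<phi> y"
    using 2[of x "- y"] 4 by simp
  show "\<phi> (x ^ n) = \<phi> x ^ n"
    by (induction n) (simp_all add: 1 3)
  show "\<phi> (sum f A) = (\<Sum>i\<in>A. \<phi> (f i))"
    by (induction A rule: infinite_finite_induct) (simp_all add: 0 2)
qed

lemmas expand_powers = power2_eq_square power3_eq_cube power4_eq_xxxx

lemma is_ring_hom_numeral: "is_ring_hom \<phi> \<Longrightarrow> \<phi> (numeral n) = numeral n"
proof -
  assume *: "is_ring_hom \<phi>"
  have "\<phi> (of_nat k) = of_nat k" for k
    by (induction k) (simp_all add: is_ring_homD[OF *])
  from this[of "numeral n"] show ?thesis by simp
qed

lemma is_ring_hom_id [simp]: "is_ring_hom id"
  by (simp add: is_ring_hom_def)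

lemma is_ring_hom_fps_const [simp]: "is_ring_hom (fps_const :: complex \<Rightarrow> _)"
  by (simp add: is_ring_hom_def)

lemma is_ring_hom_fls_const [simp]: "is_ring_hom (fls_const :: complex \<Rightarrow> _)"
  by (simp add: is_ring_hom_def fls_plus_const)

lemma is_ring_hom_fps_to_fls [simp]: "is_ring_hom (fps_to_fls :: complex fps \<Rightarrow> _)"
  by (simp add: is_ring_hom_def fls_times_fps_to_fls)

text \<open>For a ring homomorphism \<open>\<phi>\<close>, \<open>heval \<phi> x\<close> is again
  one, so the construction can be iterated; \<open>eval3\<close> is a threefold
  \<open>heval\<close>, and each of its properties follows from one about a single variable.\<close>

definition heval :: "('a::comm_ring_1 \<Rightarrow> 'r::comm_ring_1) \<Rightarrow> 'r \<Rightarrow> 'a poly \<Rightarrow> 'r" where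
  "heval \<phi> x p = poly (map_poly \<phi> p) x"

lemma heval_0 [simp]: "heval \<phi> x 0 = 0"
  by (simp add: heval_def)

lemma heval_pCons: "is_ring_hom \<phi> \<Longrightarrow> heval \<phi> x (pCons c p) = \<phi> c + x * heval \<phi> x p"
  by (simp add: heval_def map_poly_pCons is_ring_homD)

lemma heval_add: "is_ring_hom \<phi> \<Longrightarrow> heval \<phi> x (p + q) = heval \<phi> x p + heval \<phi> x q"
  by (induction p q rule: poly_induct2) (simp_all add: heval_pCons is_ring_homD algebra_simps)

lemma heval_smult: "is_ring_hom \<phi> \<Longrightarrow> heval \<phi> x (smult c p) = \<phi> c * heval \<phi> x p"
  by (induction p) (simp_all add: heval_pCons is_ring_homD algebra_simps)

lemma heval_mult: "is_ring_hom \<phi> \<Longrightarrow> heval \<phi> x (p * q) = heval \<phi> x p * heval \<phi> x q"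
  by (induction p) (simp_all add: heval_pCons heval_add heval_smult is_ring_homD algebra_simps)

lemma is_ring_hom_heval [simp]: "is_ring_hom \<phi> \<Longrightarrow> is_ring_hom (heval \<phi> x)"
  unfolding is_ring_hom_def[of "heval \<phi> x"]
  by (simp add: heval_add heval_mult heval_pCons is_ring_homD one_pCons)

lemma heval_const: "is_ring_hom \<phi> \<Longrightarrow> heval \<phi> x [:c:] = \<phi> c"
  by (simp add: heval_pCons)

lemma heval_sum:
  assumes "is_ring_hom \<phi>"
  shows "heval \<phi> x p = (\<Sum>i\<le>degree p. \<phi> (coeff p i) * x ^ i)"
proof -
  have *: "coeff (map_poly \<phi> p) i = \<phi> (coeff p i)" for i
    by (simp add: coeff_map_poly is_ring_homD[OF assms])
  have "(\<Sum>i\<le>degree (map_poly \<phi> p). \<phi> (coeff p i) * x ^ i) = (\<Sum>i\<le>degree p. \<phi> (coeff p i) * x ^ i)"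
    by (rule sum.mono_neutral_left)
      (auto simp: *[symmetric] not_le coeff_eq_0 intro: order_trans[OF _ map_poly_degree_leq])
  then show ?thesis by (simp add: heval_def poly_altdef *)
qed

lemma ring_hom_heval:
  "is_ring_hom \<psi> \<Longrightarrow> is_ring_hom \<phi> \<Longrightarrow> \<psi> (heval \<phi> x p) = heval (\<lambda>c. \<psi> (\<phi> c)) (\<psi> x) p"
  by (induction p) (simp_all add: heval_pCons is_ring_homD is_ring_hom_def[of "\<lambda>c. \<psi> (\<phi> c)"])

lemma eval3_heval: "eval3 \<iota> v = heval (heval (heval \<iota> (v $ 1)) (v $ 2)) (v $ 3)"
  by (rule ext) (simp add: eval3_def heval_def[abs_def])

lemma is_ring_hom_eval3: "is_ring_hom \<iota> \<Longrightarrow> is_ring_hom (eval3 \<iota> v)"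
  by (simp add: eval3_heval)

lemmas eval3_hom = is_ring_homD[OF is_ring_hom_eval3] is_ring_hom_numeral[OF is_ring_hom_eval3]

lemma eval3_simps [simp]:
  assumes "is_ring_hom \<iota>"
  shows "eval3 \<iota> v (const3 c) = \<iota> c" "eval3 \<iota> v X3 = v $ 1" "eval3 \<iota> v Y3 = v $ 2"
    "eval3 \<iota> v Z3 = v $ 3"
  by (simp_all add: eval3_heval heval_pCons is_ring_homD assms const3_def X3_def Y3_def Z3_def
      heval_const one_pCons[symmetric] is_ring_homD[OF is_ring_hom_heval])

lemma ring_hom_eval3:
  assumes "is_ring_hom \<psi>" "is_ring_hom \<iota>"
  shows "\<psi> (eval3 \<iota> v G) = eval3 (\<lambda>c. \<psi> (\<iota> c)) (\<chi> i. \<psi> (v $ i)) G"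
  by (simp add: eval3_heval ring_hom_heval assms)

lemma fps_to_fls_eval3:
  "fps_to_fls (eval3 fps_const v G) = eval3 fls_const (\<chi> i. fps_to_fls (v $ i)) G"
proof -
  have "(\<lambda>c. fps_to_fls (fps_const c)) = (fls_const :: complex \<Rightarrow> _)" by auto
  then show ?thesis
    using ring_hom_eval3[OF is_ring_hom_fps_to_fls is_ring_hom_fps_const, of v G] by simp
qed

section \<open>Derivations and the chain rule for evaluated polynomials\<close>

definition is_derivation :: "('r::comm_ring_1 \<Rightarrow> 'r) \<Rightarrow> bool" where
  "is_derivation D \<longleftrightarrow> (\<forall>x y. D (x + y) = D x + D y) \<and> (\<forall>x y. D (x * y) = D x * y + x * D y)"

lemma is_derivationD:
  assumes "is_derivation D"
  shows "D (x + y) = D x + D y" "D (x * y) = D x * y + x * D y" "D 0 = 0"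
  using assms unfolding is_derivation_def by (auto dest: spec[of _ 0])

lemma is_derivation_fls_deriv: "is_derivation (fls_deriv :: complex fls \<Rightarrow> _)"
  by (simp add: is_derivation_def algebra_simps)

lemma map_poly_pCons_0: "f 0 = 0 \<Longrightarrow> map_poly f (pCons c p) = pCons (f c) (map_poly f p)"
  by (simp add: map_poly_pCons)

lemma der_heval1:
  assumes "is_derivation D" "is_ring_hom \<iota>" "\<And>c. D (\<iota> c) = 0"
  shows "D (heval \<iota> x r) = heval \<iota> x (pderiv r) * D x"
  by (induction r)
    (simp_all add: heval_pCons heval_add pderiv_pCons is_derivationD is_ring_homD assms algebra_simps)

lemma der_heval2:
  assumes "is_derivation D" "is_ring_hom \<iota>" "\<And>c. D (\<iota> c) = 0"
  shows "D (heval (heval \<iota> x) y q) = heval (heval \<iota> x) y (map_poly pderiv q) * D x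
     + heval (heval \<iota> x) y (pderiv q) * D y"
  by (induction q)
    (simp_all add: heval_pCons heval_add pderiv_pCons is_derivationD is_ring_homD assms
      map_poly_pCons_0 der_heval1[OF assms] algebra_simps)

lemma der_eval3:
  assumes "is_derivation D" "is_ring_hom \<iota>" "\<And>c. D (\<iota> c) = 0"
  shows "D (eval3 \<iota> v G) = eval3 \<iota> v (dX G) * D (v $ 1) + eval3 \<iota> v (dY G) * D (v $ 2)
     + eval3 \<iota> v (dZ G) * D (v $ 3)"
  unfolding eval3_heval dX_def dY_def dZ_def
  by (induction G)
    (simp_all add: heval_pCons heval_add pderiv_pCons is_derivationD is_ring_homD assms
      map_poly_pCons_0 der_heval2[OF assms] algebra_simps)

section \<open>Homogeneous forms\<close>

lemma eval3_sum:
  assumes "is_ring_hom \<iota>"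
  shows "eval3 \<iota> v G = (\<Sum>k\<le>degree G. \<Sum>j\<le>degree (coeff G k). \<Sum>i\<le>degree (coeff (coeff G k) j).
     \<iota> (coeff (coeff (coeff G k) j) i) * v $ 1 ^ i * v $ 2 ^ j * v $ 3 ^ k)"
  by (simp add: eval3_heval heval_sum assms sum_distrib_right)

text \<open>The scalar \<open>u\<close> may be any ring element, in particular a power series or a
  Laurent series; this is what allows a whole arc to be rescaled to affine coordinates.\<close>

lemma eval3_scale:
  assumes "is_ring_hom \<iota>" "homogeneous d G"
  shows "eval3 \<iota> (u *s v) G = u ^ d * eval3 \<iota> v G"
proof -
  have "\<iota> (coeff (coeff (coeff G k) j) i) * (u * v $ 1) ^ i * (u * v $ 2) ^ j * (u * v $ 3) ^ k =
     u ^ d * (\<iota> (coeff (coeff (coeff G k) j) i) * v $ 1 ^ i * v $ 2 ^ j * v $ 3 ^ k)" for i j k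
  proof (cases "coeff (coeff (coeff G k) j) i = 0")
    case True
    then show ?thesis by (simp add: is_ring_homD[OF assms(1)])
  next
    case False
    then have "i + j + k = d" using assms(2) by (auto simp: homogeneous_def)
    then show ?thesis by (auto simp: power_add power_mult_distrib algebra_simps)
  qed
  then show ?thesis
    by (simp add: eval3_sum[OF assms(1)] sum_distrib_left)
qed

lemma homogeneous_add: "homogeneous d G \<Longrightarrow> homogeneous d H \<Longrightarrow> homogeneous d (G + H)"
  unfolding homogeneous_def by (metis add.right_neutral add.left_neutral coeff_add)

lemma homogeneous_diff: "homogeneous d G \<Longrightarrow> homogeneous d H \<Longrightarrow> homogeneous d (G - H)"
  unfolding homogeneous_def by (metis diff_zero diff_0 neg_equal_0_iff_equal coeff_diff)

lemma homogeneous_mult: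
  assumes "homogeneous d G" "homogeneous e H"
  shows "homogeneous (d + e) (G * H)"
  unfolding homogeneous_def
proof (intro allI impI)
  fix i j k
  assume "coeff (coeff (coeff (G * H) k) j) i \<noteq> 0"
  then have "(\<Sum>k'\<le>k. \<Sum>j'\<le>j. \<Sum>i'\<le>i. coeff (coeff (coeff G k') j') i' *
      coeff (coeff (coeff H (k - k')) (j - j')) (i - i')) \<noteq> 0"
    by (simp add: coeff_mult coeff_sum)
  then obtain k' where k': "k' \<le> k" "(\<Sum>j'\<le>j. \<Sum>i'\<le>i. coeff (coeff (coeff G k') j') i' *
      coeff (coeff (coeff H (k - k')) (j - j')) (i - i')) \<noteq> 0"
    by (rule sum.not_neutral_contains_not_neutral) auto
  from k'(2) obtain j' where j': "j' \<le> j" "(\<Sum>i'\<le>i. coeff (coeff (coeff G k') j') i' *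
      coeff (coeff (coeff H (k - k')) (j - j')) (i - i')) \<noteq> 0"
    by (rule sum.not_neutral_contains_not_neutral) auto
  from j'(2) obtain i' where i': "i' \<le> i" "coeff (coeff (coeff G k') j') i' *
      coeff (coeff (coeff H (k - k')) (j - j')) (i - i') \<noteq> 0"
    by (rule sum.not_neutral_contains_not_neutral) auto
  from i'(2) have "i' + j' + k' = d" "(i - i') + (j - j') + (k - k') = e"
    using assms by (auto simp: homogeneous_def)
  then show "i + j + k = d + e"
    using k'(1) j'(1) i'(1) by linarith
qed

lemma homogeneous_const3: "homogeneous 0 (const3 c)"
  by (auto simp: homogeneous_def const3_def coeff_pCons split: nat.splits if_splits)

lemma homogeneous_X3: "homogeneous 1 X3" and homogeneous_Y3: "homogeneous 1 Y3"
  and homogeneous_Z3: "homogeneous 1 Z3"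
  by (auto simp: homogeneous_def X3_def Y3_def Z3_def coeff_pCons one_pCons split: nat.splits if_splits)

lemma homogeneous_power: "homogeneous d G \<Longrightarrow> homogeneous (n * d) (G ^ n)"
proof (induction n)
  case 0
  then show ?case using homogeneous_const3[of 1] by (simp add: const3_def one_pCons)
next
  case (Suc n)
  then show ?case using homogeneous_mult[of d G "n * d" "G ^ n"] by simp
qed

lemma coeff_of_nat_mult: "coeff (of_nat n * p) k = of_nat n * coeff p k"
  by (simp add: of_nat_poly)

lemma homogeneous_derivs:
  assumes "homogeneous d G"
  shows "homogeneous (d - 1) (dX G)" "homogeneous (d - 1) (dY G)" "homogeneous (d - 1) (dZ G)"
proof -
  have *: "i + j + k = d" if "coeff (coeff (coeff G k) j) i \<noteq> 0" for i j k
    using assms that by (auto simp: homogeneous_def)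
  show "homogeneous (d - 1) (dX G)" "homogeneous (d - 1) (dY G)" "homogeneous (d - 1) (dZ G)"
    unfolding homogeneous_def dX_def dY_def dZ_def
    by (auto simp: coeff_map_poly coeff_pderiv coeff_of_nat_mult simp del: of_nat_Suc dest!: *)
qed

unbundle no vec_syntax
notation vec_nth (infixl "$v" 90)

section \<open>Hensel's lemma for power series\<close>

text \<open>The remainder stays unspecified: one Newton step only needs that it carries the factor
  \<open>h ^ 2\<close>.\<close>

lemma poly_taylor:
  fixes f :: "'a::idom poly"
  shows "\<exists>q. poly f (x + h) = poly f x + h * poly (pderiv f) x + h ^ 2 * q"
proof (induction f)
  case 0
  show ?case by (intro exI[of _ 0]) simp
next
  case (pCons c f)
  then obtain q where "poly f (x + h) = poly f x + h * poly (pderiv f) x + h ^ 2 * q" by auto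
  then have "poly (pCons c f) (x + h) = poly (pCons c f) x + h * poly (pderiv (pCons c f)) x
     + h ^ 2 * (poly (pderiv f) x + (x + h) * q)"
    by (simp add: pderiv_pCons power2_eq_square algebra_simps)
  then show ?case by blast
qed

lemma poly_fps_nth_0:
  fixes f :: "complex fps poly"
  shows "poly f y $ 0 = poly f (fps_const (y $ 0)) $ 0"
  by (induction f) simp_all

lemma poly_fps_cong:
  fixes f :: "complex fps poly"
  assumes "\<And>i. i < n \<Longrightarrow> x $ i = y $ i" "i < n"
  shows "poly f x $ i = poly f y $ i"
  using assms(2)
proof (induction f arbitrary: i)
  case (pCons c f)
  then show ?case
    by (auto simp: fps_mult_nth assms(1) intro!: sum.cong)
qed simp

text \<open>Newton iteration, one coefficient at a time: a correction by \<open>k\<close> times the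
  power \<open>n + 1\<close> of the variable changes the coefficient of index \<open>n + 1\<close>
  of the value by \<open>k\<close> times the constant term of the derivative, and that constant term
  is nonzero.\<close>

lemma fps_hensel:
  fixes f :: "complex fps poly"
  assumes "poly f (fps_const c) $ 0 = 0" "poly (pderiv f) (fps_const c) $ 0 \<noteq> 0"
  shows "\<exists>y. y $ 0 = c \<and> poly f y = 0"
proof -
  define P where "P = (\<lambda>n y. y $ 0 = c \<and> (\<forall>i\<le>n. poly f y $ i = 0))"
  define Q where "Q = (\<lambda>n (y::complex fps) y'. \<forall>i\<le>n. y' $ i = y $ i)"
  have "\<exists>Y. \<forall>n. P n (Y n) \<and> Q n (Y n) (Y (Suc n))"
  proof (rule dependent_nat_choice)
    show "\<exists>y. P 0 y"
      using assms(1) by (auto simp: P_def intro: exI[of _ "fps_const c"])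
  next
    fix y n assume y: "P n y"
    have d: "poly (pderiv f) y $ 0 \<noteq> 0"
      using y assms(2) poly_fps_nth_0[of "pderiv f" y] by (simp add: P_def)
    define k where "k = - (poly f y $ Suc n) / (poly (pderiv f) y $ 0)"
    define h where "h = fps_const k * fps_X ^ Suc n"
    obtain q where q: "poly f (y + h) = poly f y + h * poly (pderiv f) y + h ^ 2 * q"
      using poly_taylor by blast
    have hn: "(h * g) $ i = (if i < Suc n then 0 else k * g $ (i - Suc n))" for g i
      unfolding h_def mult.assoc by (simp only: fps_mult_left_const_nth fps_X_power_mult_nth) simp
    have h2: "h ^ 2 * q = h * (h * q)" by (simp add: power2_eq_square)
    have hi: "h $ i = 0" if "i < Suc n" for i using hn[of 1 i] that by simp
    have "poly f (y + h) $ i = 0" if "i \<le> Suc n" for i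
    proof (cases "i = Suc n")
      case True
      have "poly f (y + h) $ i = poly f y $ Suc n + k * poly (pderiv f) y $ 0"
        unfolding q h2 fps_add_nth hn using True by (simp add: hn)
      also have "\<dots> = 0" using d by (simp add: k_def)
      finally show ?thesis .
    next
      case False
      then show ?thesis
        unfolding q h2 fps_add_nth hn using y that by (simp add: P_def)
    qed
    then show "\<exists>y'. P (Suc n) y' \<and> Q n y y'"
      using y hi by (intro exI[of _ "y + h"]) (auto simp: P_def Q_def)
  qed
  then obtain Y where Y: "\<And>n. P n (Y n)" "\<And>n. Q n (Y n) (Y (Suc n))" by blast
  have YY: "Y m $ i = Y i $ i" if "i \<le> m" for m i
    using that
  proof (induction m rule: dec_induct)
    case (step m)
    then show ?case using Y(2)[of m] by (auto simp: Q_def)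
  qed simp
  \<comment> \<open>Later approximations keep the coefficients already found, so the diagonal is
    their limit.\<close>
  define y where "y = Abs_fps (\<lambda>n. Y n $ n)"
  have "poly f y $ i = 0" for i
  proof -
    have "y $ j = Y i $ j" if "j < Suc i" for j
      using YY[of j i] that by (simp add: y_def)
    then have "poly f y $ i = poly f (Y i) $ i"
      by (intro poly_fps_cong[of "Suc i"]) auto
    then show ?thesis using Y(1)[of i] by (auto simp: P_def)
  qed
  moreover have "y $ 0 = c" using Y(1)[of 0] by (auto simp: y_def P_def)
  ultimately show ?thesis by (intro exI[of _ y]) (auto intro: fps_ext)
qed

text \<open>The equation of the curve is biquadratic in \<open>y\<close> both in the affine chart
  and in the chart at infinity, so this one instance produces all arcs.\<close>

lemma fps_hensel_biquadratic:
  fixes p q :: "complex fps"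
  assumes "c ^ 4 + p $ 0 * c ^ 2 + q $ 0 = 0" "4 * c ^ 3 + 2 * p $ 0 * c \<noteq> 0"
  shows "\<exists>y. y $ 0 = c \<and> y ^ 4 + p * y ^ 2 + q = 0"
proof -
  have "\<exists>y. y $ 0 = c \<and> poly [:q, 0, p, 0, 1:] y = 0"
    by (rule fps_hensel) (use assms in \<open>simp_all add: pderiv_pCons expand_powers algebra_simps\<close>)
  then show ?thesis by (auto simp: expand_powers algebra_simps)
qed

section \<open>The quartic and its partial derivatives\<close>

lemma quartic_explicit: "quartic a b =
  [:[:[:0, 0, 0, 0, 1:], 0, [:0, 0, a:], 0, [:1:]:], 0, [:[:0, 0, b:], 0, [:b:]:], 0, [:[:1:]:]:]"
  by (simp add: quartic_def X3_def Y3_def Z3_def const3_def expand_powers one_pCons)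

lemma eval_quartic:
  assumes "is_ring_hom \<iota>"
  shows "eval3 \<iota> v (quartic a b) = v $v 1 ^ 4 + v $v 2 ^ 4 + v $v 3 ^ 4 + \<iota> a * v $v 1 ^ 2 * v $v 2 ^ 2
     + \<iota> b * (v $v 1 ^ 2 + v $v 2 ^ 2) * v $v 3 ^ 2"
  by (simp add: quartic_def eval3_hom[OF assms] assms)

lemma eval_quartic_derivs:
  assumes "is_ring_hom \<iota>"
  shows "eval3 \<iota> v (dX (quartic a b)) =
       4 * v $v 1 ^ 3 + 2 * \<iota> a * v $v 1 * v $v 2 ^ 2 + 2 * \<iota> b * v $v 1 * v $v 3 ^ 2"
    "eval3 \<iota> v (dY (quartic a b)) =
       4 * v $v 2 ^ 3 + 2 * \<iota> a * v $v 1 ^ 2 * v $v 2 + 2 * \<iota> b * v $v 2 * v $v 3 ^ 2"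
    "eval3 \<iota> v (dZ (quartic a b)) =
       4 * v $v 3 ^ 3 + 2 * \<iota> b * (v $v 1 ^ 2 + v $v 2 ^ 2) * v $v 3"
  unfolding quartic_explicit dX_def dY_def dZ_def
  by (simp_all add: map_poly_pCons_0 pderiv_pCons eval3_heval heval_pCons is_ring_homD[OF assms] is_ring_hom_numeral[OF assms] assms
       expand_powers algebra_simps)

lemma homogeneous_quartic: "homogeneous 4 (quartic a b)"
proof -
  have 4: "homogeneous 4 (X3 ^ 4)" "homogeneous 4 (Y3 ^ 4)" "homogeneous 4 (Z3 ^ 4)"
    using homogeneous_power[OF homogeneous_X3, of 4] homogeneous_power[OF homogeneous_Y3, of 4]
      homogeneous_power[OF homogeneous_Z3, of 4] by simp_all
  have 2: "homogeneous 2 (X3 ^ 2)" "homogeneous 2 (Y3 ^ 2)" "homogeneous 2 (Z3 ^ 2)"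
    using homogeneous_power[OF homogeneous_X3, of 2] homogeneous_power[OF homogeneous_Y3, of 2]
      homogeneous_power[OF homogeneous_Z3, of 2] by simp_all
  have "homogeneous (0 + 2 + 2) (const3 a * X3 ^ 2 * Y3 ^ 2)"
    by (rule homogeneous_mult[OF homogeneous_mult[OF homogeneous_const3 2(1)] 2(2)])
  moreover have "homogeneous (0 + 2 + 2) (const3 b * (X3 ^ 2 + Y3 ^ 2) * Z3 ^ 2)"
    by (rule homogeneous_mult[OF homogeneous_mult[OF homogeneous_const3 homogeneous_add[OF 2(1,2)]] 2(3)])
  moreover have "0 + 2 + 2 = (4::nat)" by simp
  ultimately show ?thesis
    unfolding quartic_def using 4 by (simp only: homogeneous_add)
qed

section \<open>Arcs on the quartic\<close>

lemma mem_proj_point: "v \<in> proj_point v"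
  unfolding proj_point_def by (auto intro: exI[of _ 1] simp: vec_eq_iff)

lemma proj_point_scale: "c \<noteq> 0 \<Longrightarrow> proj_point (c *s v) = proj_point v"
proof -
  assume c: "c \<noteq> 0"
  have "\<exists>e. k *s v = e *s (c *s v) \<and> e \<noteq> 0" if "k \<noteq> 0" for k
    using c that by (intro exI[of _ "k / c"]) (simp add: vec_eq_iff)
  moreover have "\<exists>e. k *s (c *s v) = e *s v \<and> e \<noteq> 0" if "k \<noteq> 0" for k
    using c that by (intro exI[of _ "k * c"]) (simp add: vec_eq_iff)
  ultimately show ?thesis
    unfolding proj_point_def by blast
qed

lemma vector3_eta: "vector [v $v 1, v $v 2, v $v 3] = (v :: 'a::zero ^ 3)"
  by (simp add: vec_eq_iff forall_3 vector_3)

lemma vector3_eq_iff: "v = w \<longleftrightarrow> v $v 1 = w $v 1 \<and> v $v 2 = w $v 2 \<and> v $v 3 = (w $v 3 :: 'a)"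
  for v w :: "'a ^ 3"
  by (auto simp: vec_eq_iff forall_3)

lemma curve_iff:
  assumes "v \<noteq> 0"
  shows "proj_point v \<in> curve (quartic a b) \<longleftrightarrow> eval3 id v (quartic a b) = 0"
proof -
  have "eval3 id (c *s v) (quartic a b) = c ^ 4 * eval3 id v (quartic a b)" for c
    by (rule eval3_scale[OF is_ring_hom_id homogeneous_quartic])
  then show ?thesis
    using assms mem_proj_point[of v] by (auto simp: curve_def P2_def proj_point_def)
qed

text \<open>Points off the line at infinity are normalized by \<open>z = 1\<close>. On that line
  \<open>x = 0\<close> would force \<open>y ^ 4 = 0\<close>, so \<open>x = 1\<close> is a
  normalization there.\<close>

lemma curveE:
  assumes "p \<in> curve (quartic a b)"
  obtains x y where "p = proj_point (vector [x, y, 1])"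
      "x ^ 4 + y ^ 4 + 1 + a * x ^ 2 * y ^ 2 + b * (x ^ 2 + y ^ 2) = 0"
  | y where "p = proj_point (vector [1, y, 0])" "1 + y ^ 4 + a * y ^ 2 = 0"
proof -
  obtain v where v: "v \<noteq> 0" "p = proj_point v"
    using assms by (auto simp: curve_def P2_def)
  show ?thesis
  proof (cases "v $v 3 = 0")
    case False
    define w where "w = inverse (v $v 3) *s v"
    have p: "p = proj_point w"
      unfolding w_def using False v(2) by (simp add: proj_point_scale)
    have w: "w = vector [w $v 1, w $v 2, 1]"
      using False by (simp add: vector3_eq_iff vector_3 w_def)
    have "eval3 id w (quartic a b) = 0"
      using assms p mem_proj_point[of w] by (auto simp: curve_def)
    then show ?thesis
      using that(1)[of "w $v 1" "w $v 2"] p w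
      using False by (simp add: eval_quartic w_def)
  next
    case True
    have 0: "eval3 id v (quartic a b) = 0"
      using assms v(2) mem_proj_point[of v] by (auto simp: curve_def)
    have x: "v $v 1 \<noteq> 0"
    proof
      assume "v $v 1 = 0"
      then have "v = 0" using 0 True by (simp add: eval_quartic vector3_eq_iff)
      then show False using v by simp
    qed
    define w where "w = inverse (v $v 1) *s v"
    have p: "p = proj_point w"
      unfolding w_def using x v(2) by (simp add: proj_point_scale)
    have w: "w = vector [1, w $v 2, 0]"
      using x True by (simp add: vector3_eq_iff vector_3 w_def)
    have "eval3 id w (quartic a b) = 0"
      using assms p mem_proj_point[of w] by (auto simp: curve_def)
    then show ?thesis
      using that(2)[of "w $v 2"] p w
      using x True by (simp add: eval_quartic w_def)
  qed
qed

lemma affine_point_eq_iff: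
  "proj_point (vector [x, y, 1]) = proj_point (vector [x', y', 1]) \<longleftrightarrow> x = x' \<and> y = y'"
proof
  assume "proj_point (vector [x, y, 1]) = proj_point (vector [x', y', 1])"
  then have "vector [x, y, 1] \<in> proj_point (vector [x', y', 1])"
    using mem_proj_point by metis
  then show "x = x' \<and> y = y'"
    by (auto simp: proj_point_def vector3_eq_iff vector_3)
qed simp

text \<open>The conditions exclude singular points: \<open>a ^ 2 \<noteq> 4\<close> those at
  infinity and, through \<open>a \<noteq> 2\<close>, the affine ones off the axes and the lines
  \<open>x = \<plusminus> y\<close>; \<open>b ^ 2 \<noteq> 4\<close> those on the axes;
  \<open>b ^ 2 \<noteq> a + 2\<close> those on \<open>x = \<plusminus> y\<close>.\<close>

locale smooth_quartic =
  fixes a b :: complex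
  assumes a_ne: "a ^ 2 \<noteq> 4" and b_ne: "b ^ 2 \<noteq> 4" and ab_ne: "b ^ 2 \<noteq> a + 2"
begin

abbreviation "F \<equiv> quartic a b"

abbreviation on_curve :: "complex \<Rightarrow> complex \<Rightarrow> bool" where
  "on_curve x y \<equiv> x ^ 4 + y ^ 4 + 1 + a * x ^ 2 * y ^ 2 + b * (x ^ 2 + y ^ 2) = 0"

definition Fx :: "complex \<Rightarrow> complex \<Rightarrow> complex" where
  "Fx x y = 4 * x ^ 3 + 2 * a * x * y ^ 2 + 2 * b * x"

definition Fy :: "complex \<Rightarrow> complex \<Rightarrow> complex" where
  "Fy x y = 4 * y ^ 3 + 2 * a * x ^ 2 * y + 2 * b * y"

lemma a_ne2: "a \<noteq> 2" "a \<noteq> - 2"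
  using a_ne by auto

lemma smooth_affine:
  assumes F: "on_curve x y"
  shows "Fx x y \<noteq> 0 \<or> Fy x y \<noteq> 0"
proof (rule ccontr)
  assume "\<not> ?thesis"
  then have 1: "x * (2 * x ^ 2 + a * y ^ 2 + b) = 0" and 2: "y * (2 * y ^ 2 + a * x ^ 2 + b) = 0"
    by (simp_all add: Fx_def Fy_def, algebra+)
  consider "x = 0" "y = 0" | "x = 0" "y \<noteq> 0" | "x \<noteq> 0" "y = 0" | "x \<noteq> 0" "y \<noteq> 0" by blast
  then show False
  proof cases
    case 1
    then show ?thesis using F by simp
  next
    case c: 2
    then have "2 * y ^ 2 + b = 0" "y ^ 4 + 1 + b * y ^ 2 = 0" using 2 F by simp_all
    then have "b ^ 2 = 4" by algebra
    then show ?thesis using b_ne by simp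
  next
    case 3
    then have "2 * x ^ 2 + b = 0" "x ^ 4 + 1 + b * x ^ 2 = 0" using 1 F by simp_all
    then have "b ^ 2 = 4" by algebra
    then show ?thesis using b_ne by simp
  next
    case 4
    then have e: "2 * x ^ 2 + a * y ^ 2 + b = 0" "2 * y ^ 2 + a * x ^ 2 + b = 0" using 1 2 by simp_all
    then have "(2 - a) * (x ^ 2 - y ^ 2) = 0" by algebra
    then have "x ^ 2 = y ^ 2" using a_ne2 by simp
    then have "(2 + a) * x ^ 2 = - b" "b * x ^ 2 + 1 = 0" using e F by algebra+
    then have "b ^ 2 = a + 2" by algebra
    then show ?thesis using ab_ne by simp
  qed
qed

lemma smooth_infinite:
  assumes "1 + y ^ 4 + a * y ^ 2 = 0"
  shows "4 * y ^ 3 + 2 * a * y \<noteq> 0"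
proof
  assume "4 * y ^ 3 + 2 * a * y = 0"
  then have "y * (2 * y ^ 2 + a) = 0" by algebra
  moreover have "y \<noteq> 0" using assms by auto
  ultimately have "2 * y ^ 2 + a = 0" by simp
  then have "a ^ 2 = 4" using assms by algebra
  then show False using a_ne by simp
qed

lemma eval_F_fps:
  "eval3 fps_const (vector [x, y, z]) F = x ^ 4 + y ^ 4 + z ^ 4 + fps_const a * x ^ 2 * y ^ 2
     + fps_const b * (x ^ 2 + y ^ 2) * z ^ 2"
  by (simp add: eval_quartic vector_3)

text \<open>Where \<open>Fy\<close> does not vanish, \<open>x - x0\<close> is the parameter and
  Hensel's lemma solves for \<open>y\<close>. Otherwise \<open>Fx\<close> does not vanish, and the
  symmetry of the equation exchanges the coordinates.\<close>

lemma ex_affine_arc: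
  assumes F: "on_curve x0 y0"
  shows "\<exists>x y. x $ 0 = x0 \<and> y $ 0 = y0 \<and> (x $ 1 \<noteq> 0 \<or> y $ 1 \<noteq> 0)
     \<and> eval3 fps_const (vector [x, y, 1]) F = 0"
proof -
  have *: "\<exists>y. y $ 0 = y0 \<and>
      eval3 fps_const (vector [fps_const x0 + fps_X, y, 1]) F = 0"
    if F: "on_curve x0 y0" and "Fy x0 y0 \<noteq> 0" for x0 y0
  proof -
    define x where "x = fps_const x0 + fps_X"
    have x0: "x $ 0 = x0" by (simp add: x_def)
    have "\<exists>y. y $ 0 = y0 \<and> y ^ 4 + (fps_const a * x ^ 2 + fps_const b) * y ^ 2
        + (x ^ 4 + fps_const b * x ^ 2 + 1) = 0"
    proof (rule fps_hensel_biquadratic)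
      show "y0 ^ 4 + (fps_const a * x ^ 2 + fps_const b) $ 0 * y0 ^ 2
          + (x ^ 4 + fps_const b * x ^ 2 + 1) $ 0 = 0"
        using that(1) by (simp add: x0 fps_nth_power_0 algebra_simps)
      show "4 * y0 ^ 3 + 2 * (fps_const a * x ^ 2 + fps_const b) $ 0 * y0 \<noteq> 0"
        using that(2) by (simp add: x0 fps_nth_power_0 Fy_def algebra_simps)
    qed
    then obtain y where "y $ 0 = y0" "y ^ 4 + (fps_const a * x ^ 2 + fps_const b) * y ^ 2
        + (x ^ 4 + fps_const b * x ^ 2 + 1) = 0" by blast
    then show ?thesis
      unfolding x_def[symmetric] by (intro exI[of _ y]) (simp add: eval_F_fps algebra_simps)
  qed
  consider "Fy x0 y0 \<noteq> 0" | "Fx x0 y0 \<noteq> 0" using smooth_affine[OF F] by blast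
  then show ?thesis
  proof cases
    case 1
    from *[OF F 1] obtain y where y: "y $ 0 = y0"
      "eval3 fps_const (vector [fps_const x0 + fps_X, y, 1]) F = 0" by blast
    show ?thesis
      by (rule exI[of _ "fps_const x0 + fps_X"], rule exI[of _ y]) (use y in simp)
  next
    case 2
    have "on_curve y0 x0" using F by algebra
    moreover have "Fy y0 x0 \<noteq> 0" using 2 by (simp add: Fx_def Fy_def algebra_simps)
    ultimately obtain x where x: "x $ 0 = x0"
      "eval3 fps_const (vector [fps_const y0 + fps_X, x, 1]) F = 0" using * by blast
    have "eval3 fps_const (vector [x, fps_const y0 + fps_X, 1]) F = 0"
      using x(2) by (simp add: eval_F_fps algebra_simps)
    then show ?thesis
      by (intro exI[of _ "fps_const y0 + fps_X"] exI[of _ x]) (use x in simp)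
  qed
qed

text \<open>At infinity \<open>z\<close> is the parameter: by \<open>smooth_infinite\<close> the
  value \<open>y0\<close> is a simple root of the equation at \<open>z = 0\<close>.\<close>

lemma ex_infinite_arc:
  assumes F: "1 + y0 ^ 4 + a * y0 ^ 2 = 0"
  shows "\<exists>y. y $ 0 = y0 \<and> eval3 fps_const (vector [1, y, fps_X]) F = 0"
proof -
  have "\<exists>y. y $ 0 = y0 \<and> y ^ 4 + (fps_const a + fps_const b * fps_X ^ 2) * y ^ 2
      + (1 + fps_X ^ 4 + fps_const b * fps_X ^ 2) = 0"
  proof (rule fps_hensel_biquadratic)
    show "y0 ^ 4 + (fps_const a + fps_const b * fps_X ^ 2) $ 0 * y0 ^ 2
        + (1 + fps_X ^ 4 + fps_const b * fps_X ^ 2) $ 0 = 0"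
      using F by (simp add: fps_nth_power_0 algebra_simps)
    show "4 * y0 ^ 3 + 2 * (fps_const a + fps_const b * fps_X ^ 2) $ 0 * y0 \<noteq> 0"
      using smooth_infinite[OF F] by (simp add: fps_nth_power_0 algebra_simps)
  qed
  then show ?thesis
    by (auto simp: eval_F_fps algebra_simps)
qed

lemma ex_local_param:
  assumes "p \<in> curve F"
  shows "\<exists>\<gamma>. is_local_param F p \<gamma>"
  using assms
proof (cases rule: curveE)
  case (1 x y)
  from ex_affine_arc[OF 1(2)] obtain X Y where XY: "X $ 0 = x" "Y $ 0 = y" "X $ 1 \<noteq> 0 \<or> Y $ 1 \<noteq> 0"
    "eval3 fps_const (vector [X, Y, 1]) F = 0" by blast
  have "arc_coeff (vector [X, Y, 1]) 0 = vector [x, y, 1]"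
    using XY by (simp add: arc_coeff_def vector3_eq_iff vector_3)
  moreover have "arc_coeff (vector [X, Y, 1]) 1 \<noteq> c *s arc_coeff (vector [X, Y, 1]) 0" for c
    using XY(3) by (auto simp: arc_coeff_def vector3_eq_iff vector_3)
  ultimately show ?thesis
    using XY(4) mem_proj_point 1(1) unfolding is_local_param_def by metis
next
  case (2 y)
  from ex_infinite_arc[OF 2(2)] obtain Y where Y: "Y $ 0 = y"
    "eval3 fps_const (vector [1, Y, fps_X]) F = 0" by blast
  have "arc_coeff (vector [1, Y, fps_X]) 0 = vector [1, y, 0]"
    using Y by (simp add: arc_coeff_def vector3_eq_iff vector_3)
  moreover have "arc_coeff (vector [1, Y, fps_X]) 1 \<noteq> c *s arc_coeff (vector [1, Y, fps_X]) 0" for c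
    by (auto simp: arc_coeff_def vector3_eq_iff vector_3)
  ultimately show ?thesis
    using Y(2) mem_proj_point 2(1) unfolding is_local_param_def by metis
qed

lemma is_local_param_local_param: "p \<in> curve F \<Longrightarrow> is_local_param F p (local_param F p)"
  unfolding local_param_def using ex_local_param by (rule someI_ex)

section \<open>Normalization of the chosen parametrizations\<close>

abbreviation fps_on_curve :: "complex fps \<Rightarrow> complex fps \<Rightarrow> bool" where
  "fps_on_curve x y \<equiv> x ^ 4 + y ^ 4 + 1 + fps_const a * x ^ 2 * y ^ 2 + fps_const b * (x ^ 2 + y ^ 2) = 0"

definition affine_arc :: "ppoint \<Rightarrow> complex fps \<Rightarrow> complex fps \<Rightarrow> bool" where
  "affine_arc p x y \<longleftrightarrow> p = proj_point (vector [x $ 0, y $ 0, 1]) \<and> on_curve (x $ 0) (y $ 0) \<and>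
     (x $ 1 \<noteq> 0 \<or> y $ 1 \<noteq> 0) \<and>
     fps_on_curve x y"

text \<open>The tangents at the points at infinity pass through \<open>[0:0:1]\<close>, hence \<open>y $ 1 = 0\<close>.\<close>

definition infinite_arc :: "ppoint \<Rightarrow> complex fps \<Rightarrow> complex fps \<Rightarrow> bool" where
  "infinite_arc p y z \<longleftrightarrow> p = proj_point (vector [1, y $ 0, 0]) \<and> 1 + (y $ 0) ^ 4 + a * (y $ 0) ^ 2 = 0 \<and>
     z $ 0 = 0 \<and> y $ 1 = 0 \<and> z $ 1 \<noteq> 0 \<and>
     1 + y ^ 4 + z ^ 4 + fps_const a * y ^ 2 + fps_const b * (1 + y ^ 2) * z ^ 2 = 0"

text \<open>Nothing is known about the chosen arc beyond its defining properties. Dividing by the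
  coordinate that is a unit, \<open>z\<close> at affine points and \<open>x\<close> at infinity,
  normalizes it, and homogeneity keeps the result on the curve.\<close>

lemma local_param_cases:
  assumes "p \<in> curve F"
  obtains u x y where "u $ 0 \<noteq> 0" "local_param F p = u *s vector [x, y, 1]" "affine_arc p x y"
  | u y z where "u $ 0 \<noteq> 0" "local_param F p = u *s vector [1, y, z]" "infinite_arc p y z"
proof -
  define \<gamma> where "\<gamma> = local_param F p"
  have \<gamma>: "eval3 fps_const \<gamma> F = 0" "arc_coeff \<gamma> 0 \<in> p"
    "\<And>c. arc_coeff \<gamma> 1 \<noteq> c *s arc_coeff \<gamma> 0"
    using is_local_param_local_param[OF assms] by (auto simp: is_local_param_def \<gamma>_def)
  have scale: "eval3 fps_const (u *s v) F = u ^ 4 * eval3 fps_const v F" for u v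
    by (rule eval3_scale[OF is_ring_hom_fps_const homogeneous_quartic])
  have nth1: "(u * v) $ Suc 0 = u $ 0 * v $ 1 + u $ 1 * v $ 0" for u v :: "complex fps"
    by (simp add: fps_mult_nth)
  show ?thesis
    using assms
  proof (cases rule: curveE)
    case (1 x0 y0)
    obtain c where c: "c \<noteq> 0" "arc_coeff \<gamma> 0 = c *s vector [x0, y0, 1]"
      using \<gamma>(2) 1(1) by (auto simp: proj_point_def)
    define u where "u = \<gamma> $v 3"
    have u: "u $ 0 = c" using c(2) by (simp add: u_def arc_coeff_def vector3_eq_iff vector_3)
    define x y where "x = \<gamma> $v 1 * inverse u" and "y = \<gamma> $v 2 * inverse u"
    have uu: "u * inverse u = 1" using u c by (simp add: inverse_mult_eq_1')
    have g: "\<gamma> = u *s vector [x, y, 1]"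
      using uu by (simp add: vector3_eq_iff vector_3 x_def y_def u_def[symmetric] mult.left_commute)
    have xy0: "x $ 0 = x0" "y $ 0 = y0"
      using c u by (simp_all add: x_def y_def arc_coeff_def vector3_eq_iff vector_3)
    \<comment> \<open>If both coefficients vanished, the derivative of \<open>\<gamma>\<close> would
      be that of the unit \<open>u\<close> alone, hence proportional to \<open>\<gamma>\<close> at
      the point, against the immersion condition.\<close>
    have "x $ 1 \<noteq> 0 \<or> y $ 1 \<noteq> 0"
    proof (rule ccontr)
      assume "\<not> ?thesis"
      then have "arc_coeff \<gamma> 1 = (u $ 1 / u $ 0) *s arc_coeff \<gamma> 0"
        using u c(1) by (simp add: g arc_coeff_def vector3_eq_iff vector_3 nth1)
      then show False using \<gamma>(3) by blast
    qed
    moreover have "u ^ 4 * eval3 fps_const (vector [x, y, 1]) F = 0"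
      using \<gamma>(1) scale[of u "vector [x, y, 1]"] g by simp
    then have "eval3 fps_const (vector [x, y, 1]) F = 0"
      using u c by auto
    ultimately have "affine_arc p x y"
      using 1 xy0 by (simp add: affine_arc_def eval_F_fps)
    then show ?thesis using that(1)[of u x y] u c g by (simp add: \<gamma>_def)
  next
    case (2 y0)
    obtain c where c: "c \<noteq> 0" "arc_coeff \<gamma> 0 = c *s vector [1, y0, 0]"
      using \<gamma>(2) 2(1) by (auto simp: proj_point_def)
    define u where "u = \<gamma> $v 1"
    have u: "u $ 0 = c" using c(2) by (simp add: u_def arc_coeff_def vector3_eq_iff vector_3)
    define y z where "y = \<gamma> $v 2 * inverse u" and "z = \<gamma> $v 3 * inverse u"
    have uu: "u * inverse u = 1" using u c by (simp add: inverse_mult_eq_1')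
    have g: "\<gamma> = u *s vector [1, y, z]"
      using uu by (simp add: vector3_eq_iff vector_3 z_def y_def u_def[symmetric] mult.left_commute)
    have yz0: "y $ 0 = y0" "z $ 0 = 0"
      using c u by (simp_all add: z_def y_def arc_coeff_def vector3_eq_iff vector_3)
    have yz1: "y $ 1 \<noteq> 0 \<or> z $ 1 \<noteq> 0"
    proof (rule ccontr)
      assume "\<not> ?thesis"
      then have "arc_coeff \<gamma> 1 = (u $ 1 / u $ 0) *s arc_coeff \<gamma> 0"
        using u c(1) by (simp add: g arc_coeff_def vector3_eq_iff vector_3 nth1)
      then show False using \<gamma>(3) by blast
    qed
    have "u ^ 4 * eval3 fps_const (vector [1, y, z]) F = 0"
      using \<gamma>(1) scale[of u "vector [1, y, z]"] g by simp
    then have F0: "eval3 fps_const (vector [1, y, z]) F = 0"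
      using u c by auto
    \<comment> \<open>As \<open>z $ 0 = 0\<close>, every term with \<open>z\<close> starts at order
      two, so the linear coefficient of the equation only involves \<open>y $ 1\<close>.\<close>
    then have "(1 + y ^ 4 + z ^ 4 + fps_const a * y ^ 2 + fps_const b * (1 + y ^ 2) * z ^ 2) $ 1 = 0"
      by (simp add: eval_F_fps)
    then have "y $ 1 * (4 * y0 ^ 3 + 2 * a * y0) = 0"
      by (simp add: nth1 expand_powers yz0 algebra_simps)
    then have "y $ 1 = 0" using smooth_infinite[OF 2(2)] by simp
    then have "infinite_arc p y z"
      using 2 yz0 yz1 F0 by (simp add: infinite_arc_def eval_F_fps)
    then show ?thesis using that(2)[of u y z] u c g by (simp add: \<gamma>_def)
  qed
qed

end

hide_const (open) Coset.order

section \<open>Max Noether's theorem for the quartic\<close>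

text \<open>Counted with multiplicity, \<open>f\<close> would have more roots than \<open>g\<close>.
  With \<open>f\<close> of degree four this shows that a cubic vanishing on the whole intersection
  of the curve with a vertical line, or with the line at infinity, is zero.\<close>

lemma complex_poly_eq_0_if_orders_le:
  fixes f g :: "complex poly"
  assumes "degree g < degree f"
    and "\<And>y. poly f y = 0 \<Longrightarrow> g \<noteq> 0 \<Longrightarrow> order y f \<le> order y g"
  shows "g = 0"
proof (rule ccontr)
  assume g: "g \<noteq> 0"
  have f: "f \<noteq> 0" using assms(1) by auto
  have "proots f \<subseteq># proots g"
  proof (rule mset_subset_eqI)
    fix y
    show "count (proots f) y \<le> count (proots g) y"
      using assms(2)[of y] f g by (cases "poly f y = 0") (auto simp: order_root)
  qed
  then have "size (proots f) \<le> size (proots g)" by (rule size_mset_mono)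
  then show False using assms(1) by (simp add: size_proots_complex)
qed

lemma order_eq_1I:
  fixes p :: "'a::field_char_0 poly"
  assumes "poly p x = 0" "poly (pderiv p) x \<noteq> 0"
  shows "order x p = 1"
proof -
  have "p \<noteq> 0" using assms(2) by auto
  moreover have "order x p \<noteq> 0" using assms(1) calculation by (simp add: order_root)
  moreover have "order x (pderiv p) = 0" using assms(2) by (intro order_0I)
  ultimately show ?thesis using order_pderiv[of p x] assms(1) by simp
qed

text \<open>Parity: at a simple root of \<open>D\<close> the left side has even order and the right
  side odd order.\<close>

lemma square_eq_mult_square_imp_0:
  fixes U V D :: "complex poly"
  assumes "U ^ 2 = D * V ^ 2" "order r D = 1" "D \<noteq> 0"
  shows "V = 0"
proof (rule ccontr)
  assume V: "V \<noteq> 0"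
  have "U \<noteq> 0" using assms V by auto
  have "order r (U ^ 2) = 2 * order r U" "order r (V ^ 2) = 2 * order r V"
    using \<open>U \<noteq> 0\<close> V by (simp_all add: power2_eq_square order_mult)
  moreover have "order r (D * V ^ 2) = order r D + order r (V ^ 2)"
    using V assms(3) by (intro order_mult) auto
  ultimately have "2 * order r U = 1 + 2 * order r V" using assms(1,2) by simp
  then show False by presburger
qed

lemma dvd_heval_diff:
  "is_ring_hom \<phi> \<Longrightarrow> (x - \<phi> c) dvd heval \<phi> x p - \<phi> (poly p c)"
proof (induction p)
  case (pCons d p)
  then obtain q where "heval \<phi> x p - \<phi> (poly p c) = (x - \<phi> c) * q" by (auto simp: dvd_def)
  then have q: "heval \<phi> x p = (x - \<phi> c) * q + \<phi> (poly p c)" by (simp add: algebra_simps)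
  have "heval \<phi> x (pCons d p) - \<phi> (poly (pCons d p) c) = (x - \<phi> c) * (heval \<phi> x p + \<phi> c * q)"
    using pCons.prems by (simp add: heval_pCons is_ring_homD q algebra_simps)
  then show ?case by simp
qed (simp add: is_ring_homD)

lemma heval_fps_nth_0: fixes y :: "complex fps" shows "heval fps_const y p $ 0 = poly p (y $ 0)"
  by (induction p) (simp_all add: heval_pCons)

text \<open>Splitting off the root \<open>y $ 0\<close> with its full multiplicity leaves a cofactor
  with nonzero constant term along \<open>y\<close>.\<close>

lemma subdegree_heval:
  fixes p :: "complex poly"
  assumes "p \<noteq> 0" "y - fps_const (y $ 0) \<noteq> 0"
  shows "heval fps_const y p \<noteq> 0 \<and>
    subdegree (heval fps_const y p) = order (y $ 0) p * subdegree (y - fps_const (y $ 0))"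
proof -
  define c where "c = y $ 0"
  obtain q where q: "p = [:- c, 1:] ^ order c p * q" "\<not> [:- c, 1:] dvd q"
    using order_decomp[OF assms(1)] by blast
  have h: "is_ring_hom (heval (fps_const :: complex \<Rightarrow> _) y)"
    by (rule is_ring_hom_heval[OF is_ring_hom_fps_const])
  have l: "heval fps_const y [:- c, 1:] = y - fps_const c"
    by (simp add: heval_pCons)
  have e: "heval fps_const y p = (y - fps_const c) ^ order c p * heval fps_const y q"
    by (subst q(1)) (simp add: is_ring_homD(3,7)[OF h] l)
  have q0: "heval fps_const y q $ 0 \<noteq> 0"
    using q(2) by (simp add: heval_fps_nth_0 c_def poly_eq_0_iff_dvd)
  then have q1: "heval fps_const y q \<noteq> 0" by auto
  have "subdegree (heval fps_const y q) = 0"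
    using q0 by (rule subdegree_eq_0)
  then show ?thesis
    using assms(2) q1 unfolding e c_def[symmetric] by simp
qed

lemma heval_fls_const: fixes y :: "complex fps" shows "heval fls_const (fps_to_fls y) p = fps_to_fls (heval fps_const y p)"
  by (induction p) (simp_all add: heval_pCons fls_times_fps_to_fls)

text \<open>A nonconstant Laurent series is transcendental over the complex numbers:
  \<open>N\<close> splits into linear factors, none of which vanishes at \<open>x\<close>.\<close>

lemma heval_fls_nonzero:
  fixes N :: "complex poly"
  assumes "\<And>c. x \<noteq> fls_const c" "N \<noteq> 0"
  shows "heval fls_const x N \<noteq> 0"
  using assms(2)
proof (induction "degree N" arbitrary: N)
  case 0
  then obtain c where "N = [:c:]" by (metis degree_eq_zeroE)
  then show ?case using 0 by (simp add: heval_const)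
next
  case (Suc n)
  then obtain r where "poly N r = 0"
    using fundamental_theorem_of_algebra_alt[of N] by (metis degree_pCons_0 nat.distinct(1))
  then obtain M where M: "N = [:- r, 1:] * M" by (metis poly_eq_0_iff_dvd dvd_def)
  then have "M \<noteq> 0" using Suc.prems by auto
  then have "degree N = Suc (degree M)" unfolding M by (subst degree_mult_eq) auto
  then have "heval fls_const x M \<noteq> 0" using Suc.hyps \<open>M \<noteq> 0\<close> by auto
  moreover have "heval fls_const x [:- r, 1:] = x - fls_const r"
    by (simp add: heval_pCons)
  ultimately show ?case
    using assms(1)[of r] unfolding M heval_mult[OF is_ring_hom_fls_const] by simp
qed

lemma fls_int_iff: "fls_subdegree f \<ge> 0 \<longleftrightarrow> (\<exists>g. f = fps_to_fls g)" for f :: "complex fls"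
  by (metis fls_subdegree_fls_to_fps_gt0 fls_regpart_to_fls_trivial)

lemma fls_int_mult:
  fixes f g :: "complex fls"
  shows "fls_subdegree f \<ge> 0 \<Longrightarrow> fls_subdegree g \<ge> 0 \<Longrightarrow> fls_subdegree (f * g) \<ge> 0"
  by (metis fls_int_iff fls_times_fps_to_fls)

text \<open>The product is the reflected polynomial evaluated at \<open>z\<close>. At a point at
  infinity, where \<open>x = 1 / z\<close>, its constant term reads off the coefficient of degree
  \<open>n\<close>.\<close>

lemma reflected_heval:
  fixes z :: "complex fps" and g :: "complex poly"
  assumes "z \<noteq> 0" "z $ 0 = 0" "degree g \<le> n"
  shows "\<exists>w. fps_to_fls z ^ n * heval fls_const (1 / fps_to_fls z) g = fps_to_fls w \<and> w $ 0 = coeff g n"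
  using assms(3)
proof (induction g arbitrary: n)
  case 0
  then show ?case by (intro exI[of _ 0]) simp
next
  case (pCons c g)
  show ?case
  proof (cases n)
    case 0
    then have "g = 0" using pCons by (auto split: if_splits)
    then show ?thesis using 0
      by (intro exI[of _ "fps_const c"]) (simp add: heval_const)
  next
    case (Suc m)
    then have "degree g \<le> m" using pCons.prems by (auto split: if_splits)
    then obtain w where w: "fps_to_fls z ^ m * heval fls_const (1 / fps_to_fls z) g = fps_to_fls w" "w $ 0 = coeff g m"
      using pCons.IH by blast
    have "fps_to_fls z ^ n * heval fls_const (1 / fps_to_fls z) (pCons c g) =
        fps_to_fls z ^ n * fls_const c + fps_to_fls z ^ m * heval fls_const (1 / fps_to_fls z) g"
      using assms(1) by (simp add: heval_pCons Suc field_simps)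
    also have "\<dots> = fps_to_fls (z ^ n * fps_const c + w)"
      by (simp add: w fls_times_fps_to_fls fps_to_fls_power)
    finally show ?thesis
      using Suc w(2) assms(2) by (intro exI[of _ "z ^ n * fps_const c + w"]) (simp add: fps_nth_power_0)
  qed
qed

context smooth_quartic
begin

section \<open>Normal forms modulo the equation of the curve\<close>

abbreviation polyx :: "complex poly \<Rightarrow> complex fls \<Rightarrow> complex fls" where
  "polyx g x \<equiv> heval fls_const x g"

lemmas polyx_hom = is_ring_homD[OF is_ring_hom_heval[OF is_ring_hom_fls_const]]

lemma polyx_pCons: "polyx (pCons c g) x = fls_const c + x * polyx g x"
  by (rule heval_pCons[OF is_ring_hom_fls_const])

text \<open>Modulo the equation of the curve, which is monic of degree \<open>4\<close> in \<open>y\<close>, every polynomial has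
  this shape.\<close>

definition cubic :: "complex poly \<Rightarrow> complex poly \<Rightarrow> complex poly \<Rightarrow> complex poly \<Rightarrow> complex fls \<Rightarrow> complex fls \<Rightarrow> complex fls" where
  "cubic g0 g1 g2 g3 x y = polyx g0 x + polyx g1 x * y + polyx g2 x * y ^ 2 + polyx g3 x * y ^ 3"

definition germ_curve :: "complex fls \<Rightarrow> complex fls \<Rightarrow> bool" where
  "germ_curve x y \<longleftrightarrow> x ^ 4 + y ^ 4 + 1 + fls_const a * x ^ 2 * y ^ 2 + fls_const b * (x ^ 2 + y ^ 2) = 0"

definition coeff_y2 :: "complex poly" where "coeff_y2 = [:b, 0, a:]"
definition coeff_y0 :: "complex poly" where "coeff_y0 = [:1, 0, b, 0, 1:]"

lemma germ_curve_reduce: "germ_curve x y \<Longrightarrow> y ^ 4 = - polyx coeff_y2 x * y ^ 2 - polyx coeff_y0 x"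
proof -
  assume "germ_curve x y"
  then have "x ^ 4 + y ^ 4 + 1 + fls_const a * x ^ 2 * y ^ 2 + fls_const b * (x ^ 2 + y ^ 2) = 0"
    by (simp add: germ_curve_def)
  moreover have "polyx coeff_y2 x = fls_const a * x ^ 2 + fls_const b" "polyx coeff_y0 x = x ^ 4 + fls_const b * x ^ 2 + 1"
    by (simp_all add: coeff_y2_def coeff_y0_def polyx_pCons expand_powers algebra_simps)
  ultimately show ?thesis by algebra
qed

text \<open>An element of the coordinate ring is encoded as a function of two germs; the
  coefficients of its normal form must not depend on the germs, so one normal form serves at all
  points of the curve.\<close>

definition reduces :: "(complex fls \<Rightarrow> complex fls \<Rightarrow> complex fls) \<Rightarrow> bool" where
  "reduces \<Phi> \<longleftrightarrow> (\<exists>g0 g1 g2 g3. \<forall>x y. germ_curve x y \<longrightarrow> \<Phi> x y = cubic g0 g1 g2 g3 x y)"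

lemma reducesI: "(\<And>x y. germ_curve x y \<Longrightarrow> \<Phi> x y = cubic g0 g1 g2 g3 x y) \<Longrightarrow> reduces \<Phi>"
  unfolding reduces_def by blast

lemma reducesE:
  assumes "reduces \<Phi>"
  obtains g0 g1 g2 g3 where "\<And>x y. germ_curve x y \<Longrightarrow> \<Phi> x y = cubic g0 g1 g2 g3 x y"
  using assms unfolding reduces_def by blast

lemma reduces_polyx: "reduces (\<lambda>x y. polyx c x)"
  by (rule reducesI[of _ c 0 0 0]) (simp add: cubic_def)

lemma reduces_add:
  assumes "reduces \<Phi>" "reduces \<Psi>"
  shows "reduces (\<lambda>x y. \<Phi> x y + \<Psi> x y)"
proof -
  obtain g0 g1 g2 g3 where g: "\<And>x y. germ_curve x y \<Longrightarrow> \<Phi> x y = cubic g0 g1 g2 g3 x y" using assms(1) by (rule reducesE) (rule that)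
  obtain h0 h1 h2 h3 where h: "\<And>x y. germ_curve x y \<Longrightarrow> \<Psi> x y = cubic h0 h1 h2 h3 x y" using assms(2) by (rule reducesE) (rule that)
  show ?thesis
    by (rule reducesI[of _ "g0 + h0" "g1 + h1" "g2 + h2" "g3 + h3"]) (simp add: g h cubic_def polyx_hom algebra_simps)
qed

lemma reduces_polyx_mult:
  assumes "reduces \<Phi>"
  shows "reduces (\<lambda>x y. polyx c x * \<Phi> x y)"
proof -
  obtain g0 g1 g2 g3 where g: "\<And>x y. germ_curve x y \<Longrightarrow> \<Phi> x y = cubic g0 g1 g2 g3 x y" using assms(1) by (rule reducesE) (rule that)
  show ?thesis
    by (rule reducesI[of _ "c * g0" "c * g1" "c * g2" "c * g3"]) (simp add: g cubic_def polyx_hom algebra_simps)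
qed

lemma reduces_y_mult:
  assumes "reduces \<Phi>"
  shows "reduces (\<lambda>x y. y * \<Phi> x y)"
proof -
  obtain g0 g1 g2 g3 where g: "\<And>x y. germ_curve x y \<Longrightarrow> \<Phi> x y = cubic g0 g1 g2 g3 x y" using assms(1) by (rule reducesE) (rule that)
  show ?thesis
  \<comment> \<open>Multiplication by \<open>y\<close> shifts the coefficients, and
    \<open>y ^ 4\<close> feeds \<open>g3\<close> back into the degrees \<open>2\<close> and
    \<open>0\<close>.\<close>
  proof (rule reducesI[of _ "- (coeff_y0 * g3)" "g0" "g1 - coeff_y2 * g3" "g2"])
    fix x y assume c: "germ_curve x y"
    have "y * \<Phi> x y = polyx g0 x * y + polyx g1 x * y ^ 2 + polyx g2 x * y ^ 3 + polyx g3 x * y ^ 4"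
      unfolding g[OF c] cubic_def by algebra
    also have "\<dots> = cubic (- (coeff_y0 * g3)) g0 (g1 - coeff_y2 * g3) g2 x y"
      unfolding germ_curve_reduce[OF c] cubic_def by (simp add: polyx_hom algebra_simps)
    finally show "y * \<Phi> x y = cubic (- (coeff_y0 * g3)) g0 (g1 - coeff_y2 * g3) g2 x y" .
  qed
qed

lemma reduces_mult:
  assumes "reduces \<Phi>" "reduces \<Psi>"
  shows "reduces (\<lambda>x y. \<Phi> x y * \<Psi> x y)"
proof -
  obtain g0 g1 g2 g3 where g: "\<And>x y. germ_curve x y \<Longrightarrow> \<Phi> x y = cubic g0 g1 g2 g3 x y" using assms(1) by (rule reducesE) (rule that)
  \<comment> \<open>Horner's scheme in \<open>y\<close> leaves only sums and multiplications by
    \<open>y\<close> and by polynomials in \<open>x\<close>.\<close>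
  have "reduces (\<lambda>x y. polyx g0 x * \<Psi> x y + y * (polyx g1 x * \<Psi> x y + y * (polyx g2 x * \<Psi> x y + y * (polyx g3 x * \<Psi> x y))))"
    by (intro reduces_add reduces_y_mult reduces_polyx_mult assms)
  then obtain h0 h1 h2 h3 where h: "\<And>x y. germ_curve x y \<Longrightarrow>
    polyx g0 x * \<Psi> x y + y * (polyx g1 x * \<Psi> x y + y * (polyx g2 x * \<Psi> x y + y * (polyx g3 x * \<Psi> x y)))
      = cubic h0 h1 h2 h3 x y" by (rule reducesE) (rule that)
  show ?thesis
  proof (rule reducesI[of _ h0 h1 h2 h3])
    fix x y assume c: "germ_curve x y"
    have "\<Phi> x y * \<Psi> x y = polyx g0 x * \<Psi> x y + y * (polyx g1 x * \<Psi> x y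
        + y * (polyx g2 x * \<Psi> x y + y * (polyx g3 x * \<Psi> x y)))"
      unfolding g[OF c] cubic_def by algebra
    then show "\<Phi> x y * \<Psi> x y = cubic h0 h1 h2 h3 x y" unfolding h[OF c] .
  qed
qed

lemma reduces_eval3: "reduces (\<lambda>x y. eval3 fls_const (vector [x, y, 1]) G)"
proof -
  have 2: "reduces (\<lambda>x y. heval (heval fls_const x) y q)" for q :: "complex poly poly"
  proof (induction q)
    case 0
    then show ?case using reduces_polyx[of 0] by simp
  next
    case (pCons c q)
    then show ?case
      by (simp add: heval_pCons reduces_add reduces_polyx reduces_y_mult)
  qed
  have "reduces (\<lambda>x y. heval (heval (heval fls_const x) y) 1 G)"
  proof (induction G)
    case 0
    then show ?case using reduces_polyx[of 0] by simp
  next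
    case (pCons c q)
    then show ?case
      by (simp add: heval_pCons reduces_add 2)
  qed
  then show ?thesis by (simp add: eval3_heval vector_3)
qed

section \<open>The norm down to polynomials in \<open>x\<close>\<close>

lemma discriminant_simple_root: "\<exists>r. order r (coeff_y2 ^ 2 - 4 * coeff_y0) = 1" "coeff_y2 ^ 2 - 4 * coeff_y0 \<noteq> 0"
proof -
  \<comment> \<open>The discriminant of the quadratic equation for \<open>y ^ 2\<close>; a simple
    root prevents it from being a square, so that \<open>y ^ 2\<close> is not rational in
    \<open>x\<close>.\<close>
  have D: "coeff_y2 ^ 2 - 4 * coeff_y0 = [:b ^ 2 - 4, 0, 2 * a * b - 4 * b, 0, a ^ 2 - 4:]"
    by (simp add: coeff_y2_def coeff_y0_def power2_eq_square numeral_poly algebra_simps)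
  then show "coeff_y2 ^ 2 - 4 * coeff_y0 \<noteq> 0" using b_ne by simp
  obtain r where r: "poly (coeff_y2 ^ 2 - 4 * coeff_y0) r = 0"
    using fundamental_theorem_of_algebra_alt[of "coeff_y2 ^ 2 - 4 * coeff_y0"] a_ne unfolding D by auto
  have r0: "r \<noteq> 0" using r b_ne unfolding D by auto
  have e: "(b ^ 2 - 4) + (2 * a * b - 4 * b) * r ^ 2 + (a ^ 2 - 4) * r ^ 4 = 0"
    using r unfolding D by (simp add: expand_powers algebra_simps)
  have "poly (pderiv (coeff_y2 ^ 2 - 4 * coeff_y0)) r \<noteq> 0"
  proof
    assume "poly (pderiv (coeff_y2 ^ 2 - 4 * coeff_y0)) r = 0"
    then have "2 * r * ((2 * a * b - 4 * b) + 2 * (a ^ 2 - 4) * r ^ 2) = 0"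
      unfolding D by (simp add: pderiv_pCons power2_eq_square algebra_simps)
    then have "(2 * a * b - 4 * b) + 2 * (a ^ 2 - 4) * r ^ 2 = 0" using r0 by simp
    \<comment> \<open>A double root \<open>r \<noteq> 0\<close> makes the polynomial, read as a
      quadratic in \<open>r ^ 2\<close>, have discriminant zero; that discriminant is
      \<open>- 16 * (a - 2) * (b ^ 2 - a - 2)\<close>.\<close>
    then have "(2 * a * b - 4 * b) ^ 2 = 4 * (a ^ 2 - 4) * (b ^ 2 - 4)" using e by algebra
    then have "(a - 2) * (b ^ 2 - a - 2) = 0" by algebra
    moreover have "a - 2 \<noteq> 0" "b ^ 2 - a - 2 \<noteq> 0" using a_ne2 ab_ne by (auto simp: diff_diff_eq)
    ultimately show False by (metis mult_eq_0_iff)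
  qed
  then show "\<exists>r. order r (coeff_y2 ^ 2 - 4 * coeff_y0) = 1" using r order_eq_1I by blast
qed

text \<open>\<open>coeff_y0\<close> is the norm of \<open>y ^ 2\<close>. If \<open>y ^ 2\<close>
  were a square in the quadratic extension that it generates, its norm would be a square, which a
  simple root forbids.\<close>

lemma coeff_y0_simple_root: "\<exists>r. order r coeff_y0 = 1" "coeff_y0 \<noteq> 0"
proof -
  show "coeff_y0 \<noteq> 0" by (simp add: coeff_y0_def)
  obtain r where r: "poly coeff_y0 r = 0"
    using fundamental_theorem_of_algebra_alt[of coeff_y0] unfolding coeff_y0_def by auto
  have r0: "r \<noteq> 0" using r by (auto simp: coeff_y0_def)
  have e: "1 + b * r ^ 2 + r ^ 4 = 0"
    using r by (simp add: coeff_y0_def expand_powers algebra_simps)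
  have "poly (pderiv coeff_y0) r \<noteq> 0"
  proof
    assume "poly (pderiv coeff_y0) r = 0"
    then have "2 * r * (b + 2 * r ^ 2) = 0"
      by (simp add: coeff_y0_def pderiv_pCons power2_eq_square algebra_simps)
    then have "b + 2 * r ^ 2 = 0" using r0 by simp
    then have "b ^ 2 = 4" using e by algebra
    then show False using b_ne by simp
  qed
  then show "\<exists>r. order r coeff_y0 = 1" using r order_eq_1I by blast
qed

text \<open>The left side is the norm of \<open>A + B * y ^ 2\<close>; completing the square in four
  times it brings in the discriminant.\<close>

lemma norm_eq_0:
  assumes "A ^ 2 - coeff_y2 * A * B + coeff_y0 * B ^ 2 = 0"
  shows "A = 0 \<and> B = 0"
proof -
  have "(2 * A - coeff_y2 * B) ^ 2 = (coeff_y2 ^ 2 - 4 * coeff_y0) * B ^ 2" using assms by algebra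
  then have "B = 0" using discriminant_simple_root square_eq_mult_square_imp_0 by blast
  then show ?thesis using assms by simp
qed

text \<open>The conjugates arise from \<open>y \<mapsto> - y\<close> and from exchanging the two roots of the quadratic equation
  for \<open>y\<^sup>2\<close>.\<close>

lemma norm_exists:
  obtains \<Phi> N where "reduces \<Phi>" "\<And>x y. germ_curve x y \<Longrightarrow> cubic g0 g1 g2 g3 x y * \<Phi> x y = polyx N x"
    "N = 0 \<Longrightarrow> g0 = 0 \<and> g1 = 0 \<and> g2 = 0 \<and> g3 = 0"
proof -
  \<comment> \<open>\<open>A + B * y ^ 2\<close> is the product of the cubic with its image under
    \<open>y \<mapsto> - y\<close>, reduced modulo the curve.\<close>
  define A where "A = g0 ^ 2 - coeff_y0 * g2 ^ 2 + 2 * coeff_y0 * g1 * g3 - coeff_y2 * coeff_y0 * g3 ^ 2"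
  define B where "B = 2 * g0 * g2 - coeff_y2 * g2 ^ 2 - g1 ^ 2 + 2 * coeff_y2 * g1 * g3 - (coeff_y2 ^ 2 - coeff_y0) * g3 ^ 2"
  define N where "N = A ^ 2 - coeff_y2 * A * B + coeff_y0 * B ^ 2"
  \<comment> \<open>The other root of the quadratic equation is \<open>- coeff_y2 - y ^ 2\<close>,
    so the second factor is the conjugate of \<open>A + B * y ^ 2\<close>.\<close>
  define \<Phi> where "\<Phi> = (\<lambda>x y. cubic g0 (- g1) g2 (- g3) x y * cubic (A - coeff_y2 * B) 0 (- B) 0 x y)"
  have "reduces (cubic h0 h1 h2 h3)" for h0 h1 h2 h3 by (rule reducesI) simp
  then have "reduces \<Phi>" unfolding \<Phi>_def by (intro reduces_mult)
  moreover have "cubic g0 g1 g2 g3 x y * \<Phi> x y = polyx N x" if "germ_curve x y" for x y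
  proof -
    note r = germ_curve_reduce[OF that]
    define P where "P = polyx coeff_y2 x" define Q where "Q = polyx coeff_y0 x"
    define G0 G1 G2 G3 where "G0 = polyx g0 x" and "G1 = polyx g1 x" and "G2 = polyx g2 x" and "G3 = polyx g3 x"
    define A' where "A' = polyx A x" define B' where "B' = polyx B x"
    have 2: "polyx 2 x = 2" by (rule is_ring_hom_numeral[OF is_ring_hom_heval[OF is_ring_hom_fls_const]])
    have A': "A' = G0 ^ 2 - Q * G2 ^ 2 + 2 * Q * G1 * G3 - P * Q * G3 ^ 2"
      unfolding A'_def A_def by (simp add: polyx_hom 2 G0_def G1_def G2_def G3_def P_def Q_def)
    have B': "B' = 2 * G0 * G2 - P * G2 ^ 2 - G1 ^ 2 + 2 * P * G1 * G3 - (P ^ 2 - Q) * G3 ^ 2"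
      unfolding B'_def B_def by (simp add: polyx_hom 2 G0_def G1_def G2_def G3_def P_def Q_def)
    have u: "y ^ 4 = - P * y ^ 2 - Q" using r by (simp add: P_def Q_def)
    have "(G0 + G1 * y + G2 * y ^ 2 + G3 * y ^ 3) * (G0 - G1 * y + G2 * y ^ 2 - G3 * y ^ 3) = A' + B' * y ^ 2"
      unfolding A' B' using u by algebra
    then have "cubic g0 g1 g2 g3 x y * cubic g0 (- g1) g2 (- g3) x y = A' + B' * y ^ 2"
      by (simp add: cubic_def polyx_hom G0_def G1_def G2_def G3_def)
    moreover have "cubic (A - coeff_y2 * B) 0 (- B) 0 x y = A' - P * B' - B' * y ^ 2"
      by (simp add: cubic_def polyx_hom A'_def B'_def P_def)
    ultimately have "cubic g0 g1 g2 g3 x y * \<Phi> x y = (A' + B' * y ^ 2) * (A' - P * B' - B' * y ^ 2)"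
      unfolding \<Phi>_def by (metis mult.assoc)
    also have "\<dots> = A' ^ 2 - P * A' * B' + Q * B' ^ 2" using u by algebra
    also have "\<dots> = polyx N x" by (simp add: N_def polyx_hom A'_def B'_def P_def Q_def)
    finally show ?thesis .
  qed
  moreover have "g0 = 0 \<and> g1 = 0 \<and> g2 = 0 \<and> g3 = 0" if "N = 0"
  proof -
    have AB: "A = 0" "B = 0" using norm_eq_0[of A B] that by (auto simp: N_def)
    \<comment> \<open>With \<open>u = y ^ 2\<close>, \<open>E0 + E1 * u\<close> is the square of
      \<open>g0 + g2 * u\<close>, and \<open>A = B = 0\<close> says that it equals
      \<open>u * (g1 + g3 * u) ^ 2\<close>. Taking norms, a square equals \<open>coeff_y0\<close>
      times a square.\<close>
    define E0 where "E0 = g0 ^ 2 - coeff_y0 * g2 ^ 2"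
    define E1 where "E1 = 2 * g0 * g2 - coeff_y2 * g2 ^ 2"
    have "E0 = - 2 * coeff_y0 * g1 * g3 + coeff_y2 * coeff_y0 * g3 ^ 2" using AB(1) unfolding A_def E0_def by algebra
    moreover have "E1 = g1 ^ 2 - 2 * coeff_y2 * g1 * g3 + (coeff_y2 ^ 2 - coeff_y0) * g3 ^ 2" using AB(2) unfolding B_def E1_def by algebra
    ultimately have "E0 ^ 2 - coeff_y2 * E0 * E1 + coeff_y0 * E1 ^ 2 = coeff_y0 * (g1 ^ 2 - coeff_y2 * g1 * g3 + coeff_y0 * g3 ^ 2) ^ 2" by algebra
    moreover have "E0 ^ 2 - coeff_y2 * E0 * E1 + coeff_y0 * E1 ^ 2 = (g0 ^ 2 - coeff_y2 * g0 * g2 + coeff_y0 * g2 ^ 2) ^ 2"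
      unfolding E0_def E1_def by algebra
    ultimately have e: "(g0 ^ 2 - coeff_y2 * g0 * g2 + coeff_y0 * g2 ^ 2) ^ 2 = coeff_y0 * (g1 ^ 2 - coeff_y2 * g1 * g3 + coeff_y0 * g3 ^ 2) ^ 2" by simp
    then have "g1 ^ 2 - coeff_y2 * g1 * g3 + coeff_y0 * g3 ^ 2 = 0"
      using coeff_y0_simple_root square_eq_mult_square_imp_0 by blast
    moreover from this have "g0 ^ 2 - coeff_y2 * g0 * g2 + coeff_y0 * g2 ^ 2 = 0" using e by simp
    ultimately show ?thesis using norm_eq_0 by blast
  qed
  ultimately show ?thesis using that by blast
qed


section \<open>Expansions at the points of the curve\<close>

definition xgerm :: "ppoint \<Rightarrow> complex fls" where
  "xgerm p = fps_to_fls (local_param F p $v 1) / fps_to_fls (local_param F p $v 3)"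

definition ygerm :: "ppoint \<Rightarrow> complex fls" where
  "ygerm p = fps_to_fls (local_param F p $v 2) / fps_to_fls (local_param F p $v 3)"

definition zgerm :: "ppoint \<Rightarrow> complex fls" where
  "zgerm p = fps_to_fls (local_param F p $v 3)"

definition affgerm :: "poly3 \<Rightarrow> ppoint \<Rightarrow> complex fls" where
  "affgerm G p = eval3 fls_const (vector [xgerm p, ygerm p, 1]) G"

lemma germ_cases:
  assumes "p \<in> curve F"
  obtains x y where "affine_arc p x y" "xgerm p = fps_to_fls x" "ygerm p = fps_to_fls y"
      "zgerm p \<noteq> 0" "fls_subdegree (zgerm p) = 0"
  | u y z where "infinite_arc p y z" "z \<noteq> 0" "xgerm p = 1 / fps_to_fls z" "ygerm p = fps_to_fls y / fps_to_fls z"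
      "u $ 0 \<noteq> 0" "zgerm p = fps_to_fls u * fps_to_fls z"
  using assms
proof (cases rule: local_param_cases)
  case (1 u x y)
  have "u \<noteq> 0" "subdegree u = 0" using 1(1) by auto
  then show ?thesis
    using 1 by (intro that(1)[of x y])
      (simp_all add: xgerm_def ygerm_def zgerm_def vector_3 fls_times_fps_to_fls fls_subdegree_fls_to_fps)
next
  case (2 u y z)
  have "u \<noteq> 0" using 2(1) by auto
  moreover have "z \<noteq> 0" using 2(3) by (auto simp: infinite_arc_def)
  ultimately show ?thesis
    using 2 by (intro that(2)[of y z u])
      (simp_all add: xgerm_def ygerm_def zgerm_def vector_3 fls_times_fps_to_fls)
qed

lemma zgerm_nonzero: "p \<in> curve F \<Longrightarrow> zgerm p \<noteq> 0"
  by (cases rule: germ_cases) auto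

lemma germ_scaled:
  assumes "p \<in> curve F" "homogeneous d G"
  shows "fps_to_fls (restrict_form F p G) = zgerm p ^ d * affgerm G p"
proof -
  have "vec_lambda (\<lambda>i. fps_to_fls (local_param F p $v i)) = zgerm p *s vector [xgerm p, ygerm p, 1]"
    using zgerm_nonzero[OF assms(1)] by (simp add: vector3_eq_iff vector_3 xgerm_def ygerm_def zgerm_def)
  then show ?thesis
    unfolding restrict_form_def fps_to_fls_eval3 affgerm_def
    by (simp add: eval3_scale[OF is_ring_hom_fls_const assms(2)])
qed

lemma germ_curve_point:
  assumes "p \<in> curve F"
  shows "germ_curve (xgerm p) (ygerm p)"
proof -
  have "eval3 fps_const (local_param F p) F = 0"
    using is_local_param_local_param[OF assms] by (simp add: is_local_param_def)
  then have "zgerm p ^ 4 * affgerm F p = 0"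
    using germ_scaled[OF assms homogeneous_quartic[of a b]] by (simp add: restrict_form_def)
  then have "affgerm F p = 0" using zgerm_nonzero[OF assms] by simp
  then show ?thesis
    by (simp add: germ_curve_def affgerm_def eval_quartic vector_3)
qed

lemma fps_nth_1_mult: "(u * v) $ Suc 0 = u $ 0 * v $ 1 + u $ 1 * v $ 0" for u v :: "complex fps"
  by (simp add: fps_mult_nth)

lemma affine_arc_tangent:
  assumes "affine_arc p x y"
  shows "Fx (x $ 0) (y $ 0) * x $ 1 + Fy (x $ 0) (y $ 0) * y $ 1 = 0"
proof -
  have "(x ^ 4 + y ^ 4 + 1 + fps_const a * x ^ 2 * y ^ 2 + fps_const b * (x ^ 2 + y ^ 2)) $ 1 = 0"
    using assms by (simp add: affine_arc_def)
  then show ?thesis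
    by (simp add: fps_nth_1_mult expand_powers Fx_def Fy_def algebra_simps)
qed

section \<open>Dividing out vertical lines\<close>

definition fibre_poly :: "complex \<Rightarrow> complex poly" where
  "fibre_poly \<alpha> = [:\<alpha> ^ 4 + b * \<alpha> ^ 2 + 1, 0, a * \<alpha> ^ 2 + b, 0, 1:]"

lemma poly_fibre_poly: "poly (fibre_poly \<alpha>) y = 0 \<longleftrightarrow> on_curve \<alpha> y"
  by (simp add: fibre_poly_def expand_powers algebra_simps)

text \<open>The multiplicity with which the vertical line through a point meets the curve is at most the order
  of \<open>x - x\<^sub>0\<close> along the arc: where the line is tangent, \<open>y - y\<^sub>0\<close> is a uniformizer.\<close>

lemma affine_arc_nonconst:
  assumes "affine_arc p x y"
  shows "x - fps_const (x $ 0) \<noteq> 0"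
    and "order (y $ 0) (fibre_poly (x $ 0)) \<le> subdegree (x - fps_const (x $ 0))"
proof -
  define \<alpha> where "\<alpha> = x $ 0"
  define h where "h = x - fps_const \<alpha>"
  have oc: "on_curve \<alpha> (y $ 0)" using assms by (simp add: affine_arc_def \<alpha>_def)
  have tan: "Fx \<alpha> (y $ 0) * x $ 1 + Fy \<alpha> (y $ 0) * y $ 1 = 0"
    using affine_arc_tangent[OF assms] by (simp add: \<alpha>_def)
  have h0: "h $ 0 = 0" and h1: "h $ 1 = x $ 1" by (simp_all add: h_def \<alpha>_def)
  have "h \<noteq> 0 \<and> order (y $ 0) (fibre_poly \<alpha>) \<le> subdegree h"
  proof (cases "x $ 1 = 0")
    case False
    then have h: "h \<noteq> 0" using h1 by auto
    then have "subdegree h \<ge> 1" using h0 nth_subdegree_nonzero[of h] by (cases "subdegree h") auto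
    moreover have "Fy \<alpha> (y $ 0) \<noteq> 0"
      using smooth_affine[OF oc] tan False by auto
    then have "poly (pderiv (fibre_poly \<alpha>)) (y $ 0) \<noteq> 0"
      by (simp add: fibre_poly_def Fy_def pderiv_pCons expand_powers algebra_simps)
    then have "order (y $ 0) (fibre_poly \<alpha>) = 1"
      using oc by (intro order_eq_1I) (simp_all add: poly_fibre_poly)
    ultimately show ?thesis using h by simp
  next
    case True
    then have y1: "y $ 1 \<noteq> 0" using assms by (simp add: affine_arc_def)
    define k where "k = y - fps_const (y $ 0)"
    have k: "k $ 0 = 0" "k $ 1 \<noteq> 0" using y1 by (simp_all add: k_def)
    have k': "k \<noteq> 0" "subdegree k = 1" using k by (auto intro!: subdegreeI)
    have "Fy \<alpha> (y $ 0) = 0" using tan True y1 by simp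
    then have Fx: "Fx \<alpha> (y $ 0) \<noteq> 0" using smooth_affine[OF oc] by blast
    define c where "c = fps_const \<alpha>"
    \<comment> \<open>The quotient of \<open>F(x, y) - F(c, y)\<close> by \<open>x - c\<close>. Its
      constant term is the value of \<open>Fx\<close>, nonzero because \<open>Fy\<close> vanishes
      here.\<close>
    define B where "B = (x + c) * (x ^ 2 + c ^ 2) + fps_const a * (x + c) * y ^ 2 + fps_const b * (x + c)"
    have F0: "fps_on_curve x y"
      using assms by (simp add: affine_arc_def)
    have "heval fps_const y (fibre_poly \<alpha>) = c ^ 4 + y ^ 4 + 1 + fps_const a * c ^ 2 * y ^ 2 + fps_const b * (c ^ 2 + y ^ 2)"
      by (simp add: fibre_poly_def c_def heval_pCons is_ring_homD[OF is_ring_hom_fps_const]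
          expand_powers algebra_simps
          del: fps_const_add fps_const_mult fps_const_power)
    also have "\<dots> = - (h * B)"
      using F0 unfolding B_def h_def c_def[symmetric] by algebra
    finally have fb: "heval fps_const y (fibre_poly \<alpha>) = - (h * B)" .
    have "B $ 0 = Fx \<alpha> (y $ 0)"
      by (simp add: B_def c_def Fx_def fps_nth_power_0 \<alpha>_def[symmetric] power2_eq_square power3_eq_cube algebra_simps)
    then have B: "B \<noteq> 0" "subdegree B = 0" using Fx by auto
    have f0: "fibre_poly \<alpha> \<noteq> 0" by (simp add: fibre_poly_def)
    have "heval fps_const y (fibre_poly \<alpha>) \<noteq> 0 \<and>
        subdegree (heval fps_const y (fibre_poly \<alpha>)) = order (y $ 0) (fibre_poly \<alpha>)"
      using subdegree_heval[OF f0, of y] k' unfolding k_def by simp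
    then show ?thesis using B unfolding fb by auto
  qed
  then show "x - fps_const (x $ 0) \<noteq> 0"
    "order (y $ 0) (fibre_poly (x $ 0)) \<le> subdegree (x - fps_const (x $ 0))"
    by (simp_all add: h_def \<alpha>_def)
qed

lemma xgerm_nonconst:
  assumes "p \<in> curve F"
  shows "xgerm p \<noteq> fls_const c"
  using assms
proof (cases rule: germ_cases)
  case (1 x y)
  have "x \<noteq> fps_const c" using affine_arc_nonconst(1)[OF 1(1)] by auto
  then show ?thesis
    unfolding 1(2) by (metis fps_to_fls_eq_iff fls_const_transfer fps_const_to_fls)
next
  case (2 u y z)
  have "subdegree z \<noteq> 0" using 2 by (auto simp: infinite_arc_def subdegree_eq_0_iff)
  show ?thesis
  proof
    assume "xgerm p = fls_const c"
    then have "fls_const c * fps_to_fls z = 1" using 2 by (simp add: field_simps)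
    then have "fps_to_fls (fps_const c * z) = fps_to_fls 1"
      by (simp add: fls_times_fps_to_fls)
    then have "fps_const c * z = 1" by (simp only: fps_to_fls_eq_iff)
    then have "(fps_const c * z) $ 0 = 1" by simp
    then show False using 2 by (simp add: infinite_arc_def)
  qed
qed

text \<open>Modulo \<open>x - x\<^sub>0\<close> (here \<open>x $ 0\<close>) the coefficients may be
  replaced by their values, so \<open>x - x $ 0\<close> also divides \<open>\<tau>\<close> along the
  arc. If the vertical line is tangent, \<open>y - y $ 0\<close> has order one and the orders can be
  compared directly; otherwise the root of \<open>fibre_poly\<close> is simple and vanishing of
  \<open>\<tau>\<close> suffices.\<close>

lemma cubic_at_root:
  assumes arc: "affine_arc p x y"
    and int: "fls_subdegree (cubic t0 t1 t2 t3 (fps_to_fls x) (fps_to_fls y) / (fps_to_fls x - fls_const (x $ 0))) \<ge> 0"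
    and \<tau>: "\<tau> = [:poly t0 (x $ 0), poly t1 (x $ 0), poly t2 (x $ 0), poly t3 (x $ 0):]" "\<tau> \<noteq> 0"
  shows "order (y $ 0) (fibre_poly (x $ 0)) \<le> order (y $ 0) \<tau>"
proof -
  define \<alpha> where "\<alpha> = x $ 0"
  define h where "h = x - fps_const \<alpha>"
  have h0: "h \<noteq> 0" and le: "order (y $ 0) (fibre_poly \<alpha>) \<le> subdegree h"
    using affine_arc_nonconst[OF arc] by (simp_all add: h_def \<alpha>_def)
  define t where "t = (\<lambda>g. heval fps_const x g :: complex fps)"
  define T where "T = t t0 + t t1 * y + t t2 * y ^ 2 + t t3 * y ^ 3"
  have T: "cubic t0 t1 t2 t3 (fps_to_fls x) (fps_to_fls y) = fps_to_fls T"
    by (simp add: cubic_def T_def t_def heval_fls_const fls_times_fps_to_fls fps_to_fls_power)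
  have hf: "fps_to_fls x - fls_const \<alpha> = fps_to_fls h"
    by (simp add: h_def)
  obtain g where "fps_to_fls T / fps_to_fls h = fps_to_fls g"
    using int unfolding T \<alpha>_def[symmetric] hf fls_int_iff by blast
  then have "fps_to_fls T = fps_to_fls (h * g)"
    using h0 by (simp add: fls_times_fps_to_fls field_simps)
  then have hT: "h dvd T" by (simp only: fps_to_fls_eq_iff) simp
  have d: "h dvd t g - fps_const (poly g \<alpha>)" for g
    unfolding h_def t_def by (rule dvd_heval_diff[OF is_ring_hom_fps_const])
  have "heval fps_const y \<tau> = fps_const (poly t0 \<alpha>) + fps_const (poly t1 \<alpha>) * y
      + fps_const (poly t2 \<alpha>) * y ^ 2 + fps_const (poly t3 \<alpha>) * y ^ 3"
    by (simp add: \<tau>(1) heval_pCons \<alpha>_def expand_powers algebra_simps)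
  also have "\<dots> = T - ((t t0 - fps_const (poly t0 \<alpha>)) + (t t1 - fps_const (poly t1 \<alpha>)) * y
      + (t t2 - fps_const (poly t2 \<alpha>)) * y ^ 2 + (t t3 - fps_const (poly t3 \<alpha>)) * y ^ 3)"
    by (simp add: T_def algebra_simps)
  finally have e: "h dvd heval fps_const y \<tau>"
    using hT d by (simp add: dvd_diff dvd_add dvd_mult2)
  show ?thesis
  proof (cases "x $ 1 = 0")
    case True
    then have y1: "y $ 1 \<noteq> 0" using arc by (simp add: affine_arc_def)
    define k where "k = y - fps_const (y $ 0)"
    have k: "k $ 0 = 0" "k $ 1 \<noteq> 0" using y1 by (simp_all add: k_def)
    have k': "k \<noteq> 0" "subdegree k = 1" using k by (auto intro!: subdegreeI)
    have "heval fps_const y \<tau> \<noteq> 0 \<and> subdegree (heval fps_const y \<tau>) = order (y $ 0) \<tau>"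
      using subdegree_heval[OF \<tau>(2), of y] k' unfolding k_def by simp
    then show ?thesis using le e dvd_imp_subdegree_le[of h "heval fps_const y \<tau>"] by (auto simp: \<alpha>_def)
  next
    case False
    have "subdegree h = 1"
      using False by (intro subdegreeI) (simp_all add: h_def \<alpha>_def)
    then have "order (y $ 0) (fibre_poly \<alpha>) \<le> 1" using le by simp
    moreover have "heval fps_const y \<tau> $ 0 = 0"
      using e by (auto simp: dvd_def h_def \<alpha>_def)
    then have "order (y $ 0) \<tau> \<noteq> 0"
      using \<tau>(2) by (simp add: heval_fps_nth_0 order_root)
    ultimately show ?thesis by (simp add: \<alpha>_def)
  qed
qed

definition affine_curve :: "ppoint set" where
  "affine_curve = {p \<in> curve F. \<exists>x y. p = proj_point (vector [x, y, 1])}"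

lemma affine_point_in_curve: "on_curve x y \<Longrightarrow> proj_point (vector [x, y, 1]) \<in> curve F"
  by (subst curve_iff) (auto simp: vector3_eq_iff vector_3 eval_quartic)

lemma germ_affine:
  assumes "on_curve \<alpha> \<beta>"
  obtains x y where "affine_arc (proj_point (vector [\<alpha>, \<beta>, 1])) x y" "x $ 0 = \<alpha>" "y $ 0 = \<beta>"
      "xgerm (proj_point (vector [\<alpha>, \<beta>, 1])) = fps_to_fls x"
      "ygerm (proj_point (vector [\<alpha>, \<beta>, 1])) = fps_to_fls y"
      "fls_subdegree (zgerm (proj_point (vector [\<alpha>, \<beta>, 1]))) = 0"
proof -
  define p where "p = proj_point (vector [\<alpha>, \<beta>, 1])"
  have "p \<in> curve F" using affine_point_in_curve[OF assms] by (simp add: p_def)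
  then show ?thesis
  proof (cases rule: germ_cases)
    case (1 x y)
    then have "x $ 0 = \<alpha>" "y $ 0 = \<beta>"
      by (auto simp: affine_arc_def p_def affine_point_eq_iff)
    then show ?thesis using that 1 by (simp add: p_def)
  next
    case (2 u y z)
    then have "vector [\<alpha>, \<beta>, 1] \<in> proj_point (vector [1, y $ 0, 0])"
      using mem_proj_point[of "vector [\<alpha>, \<beta>, 1]"] by (simp add: infinite_arc_def p_def)
    then show ?thesis by (auto simp: proj_point_def vector3_eq_iff vector_3)
  qed
qed

lemma cubic_smult_root:
  "cubic ([:- \<alpha>, 1:] * l0) ([:- \<alpha>, 1:] * l1) ([:- \<alpha>, 1:] * l2) ([:- \<alpha>, 1:] * l3) x y
     = (x - fls_const \<alpha>) * cubic l0 l1 l2 l3 x y"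
  unfolding cubic_def polyx_hom(3) by (simp add: polyx_pCons algebra_simps)

text \<open>Induction on the degree of \<open>N\<close>, removing one factor
  \<open>x - \<alpha>\<close> at a time: the values of the four coefficients at
  \<open>\<alpha>\<close> form a polynomial of degree at most three in \<open>y\<close> whose roots
  would include all four points over \<open>\<alpha>\<close>, with multiplicity, so they all
  vanish.\<close>

lemma affine_divisibility:
  assumes "N \<noteq> 0"
    and "\<And>p. p \<in> affine_curve \<Longrightarrow> fls_subdegree (cubic t0 t1 t2 t3 (xgerm p) (ygerm p) / polyx N (xgerm p)) \<ge> 0"
  shows "\<exists>l0 l1 l2 l3. t0 = N * l0 \<and> t1 = N * l1 \<and> t2 = N * l2 \<and> t3 = N * l3"
  using assms
proof (induction "degree N" arbitrary: N t0 t1 t2 t3)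
  case 0
  then obtain c where c: "N = [:c:]" by (metis degree_eq_zeroE)
  then have "c \<noteq> 0" using 0 by auto
  then have "t = N * smult (inverse c) t" for t using c by simp
  then show ?case by blast
next
  case (Suc n)
  then obtain \<alpha> where "poly N \<alpha> = 0"
    using fundamental_theorem_of_algebra_alt[of N] by (metis degree_pCons_0 nat.distinct(1))
  then obtain M where M: "N = [:- \<alpha>, 1:] * M" by (metis poly_eq_0_iff_dvd dvd_def)
  then have M0: "M \<noteq> 0" using Suc.prems by auto
  then have dM: "degree N = Suc (degree M)" unfolding M by (subst degree_mult_eq) auto
  have pN: "polyx N x = (x - fls_const \<alpha>) * polyx M x" for x
    unfolding M polyx_hom(3) by (simp add: polyx_pCons)
  define \<tau> where "\<tau> = [:poly t0 \<alpha>, poly t1 \<alpha>, poly t2 \<alpha>, poly t3 \<alpha>:]"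
  have "\<tau> = 0"
  proof (rule complex_poly_eq_0_if_orders_le[of _ "fibre_poly \<alpha>"])
    have "degree \<tau> \<le> 3" by (simp add: \<tau>_def)
    then show "degree \<tau> < degree (fibre_poly \<alpha>)" by (simp add: fibre_poly_def)
  next
    fix y0 assume "poly (fibre_poly \<alpha>) y0 = 0" and \<tau>0: "\<tau> \<noteq> 0"
    then have oc: "on_curve \<alpha> y0" by (simp add: poly_fibre_poly)
    define p where "p = proj_point (vector [\<alpha>, y0, 1])"
    have p: "p \<in> affine_curve"
      using affine_point_in_curve[OF oc] by (auto simp: affine_curve_def p_def)
    from germ_affine[OF oc] obtain x y where xy: "affine_arc p x y" "x $ 0 = \<alpha>" "y $ 0 = y0"
      "xgerm p = fps_to_fls x" "ygerm p = fps_to_fls y" unfolding p_def by metis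
    have M1: "fls_subdegree (polyx M (xgerm p)) \<ge> 0"
      unfolding xy(4) heval_fls_const by (rule fls_subdegree_fls_to_fps_gt0)
    have "polyx M (xgerm p) \<noteq> 0"
      using heval_fls_nonzero[OF _ M0] xgerm_nonconst p by (auto simp: affine_curve_def)
    then have "cubic t0 t1 t2 t3 (xgerm p) (ygerm p) / (xgerm p - fls_const \<alpha>) =
        (cubic t0 t1 t2 t3 (xgerm p) (ygerm p) / polyx N (xgerm p)) * polyx M (xgerm p)"
      by (simp add: pN)
    then have "fls_subdegree (cubic t0 t1 t2 t3 (xgerm p) (ygerm p) / (xgerm p - fls_const \<alpha>)) \<ge> 0"
      using fls_int_mult[OF Suc.prems(2)[OF p] M1] by simp
    then show "order y0 (fibre_poly \<alpha>) \<le> order y0 \<tau>"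
      using cubic_at_root[OF xy(1)] \<tau>0 xy(2,3) unfolding xy(4,5) by (simp add: \<tau>_def)
  qed
  then have "poly t0 \<alpha> = 0" "poly t1 \<alpha> = 0" "poly t2 \<alpha> = 0" "poly t3 \<alpha> = 0"
    by (auto simp: \<tau>_def)
  then obtain s0 s1 s2 s3 where s: "t0 = [:- \<alpha>, 1:] * s0" "t1 = [:- \<alpha>, 1:] * s1"
    "t2 = [:- \<alpha>, 1:] * s2" "t3 = [:- \<alpha>, 1:] * s3"
    unfolding poly_eq_0_iff_dvd dvd_def by blast
  have "\<exists>l0 l1 l2 l3. s0 = M * l0 \<and> s1 = M * l1 \<and> s2 = M * l2 \<and> s3 = M * l3"
  proof (rule Suc.hyps(1))
    show "n = degree M" using Suc.hyps(2) dM by simp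
    show "M \<noteq> 0" by fact
    fix p assume p: "p \<in> affine_curve"
    have "xgerm p - fls_const \<alpha> \<noteq> 0" using xgerm_nonconst p by (auto simp: affine_curve_def)
    then have "cubic s0 s1 s2 s3 (xgerm p) (ygerm p) / polyx M (xgerm p) = cubic t0 t1 t2 t3 (xgerm p) (ygerm p) / polyx N (xgerm p)"
      unfolding s cubic_smult_root pN by simp
    then show "fls_subdegree (cubic s0 s1 s2 s3 (xgerm p) (ygerm p) / polyx M (xgerm p)) \<ge> 0"
      using Suc.prems(2)[OF p] by simp
  qed
  then obtain l0 l1 l2 l3 where l: "s0 = M * l0" "s1 = M * l1" "s2 = M * l2" "s3 = M * l3" by blast
  show ?case
    unfolding s M l by (intro exI conjI) (rule mult.assoc[symmetric])+
qed

end

definition linear_form :: "complex ^ 3 \<Rightarrow> poly3" where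
  "linear_form c = const3 (c $v 1) * X3 + const3 (c $v 2) * Y3 + const3 (c $v 3) * Z3"

lemma homogeneous_linear_form: "homogeneous 1 (linear_form c)"
proof -
  have "homogeneous (0 + 1) (linear_form c)"
    unfolding linear_form_def
    by (rule homogeneous_add homogeneous_mult homogeneous_const3 homogeneous_X3 homogeneous_Y3 homogeneous_Z3)+
  then show ?thesis by simp
qed

lemma eval3_linear_form:
  "is_ring_hom \<iota> \<Longrightarrow> eval3 \<iota> v (linear_form c) = \<iota> (c $v 1) * v $v 1 + \<iota> (c $v 2) * v $v 2 + \<iota> (c $v 3) * v $v 3"
  by (simp add: linear_form_def eval3_hom)

context smooth_quartic
begin

section \<open>Pole orders at infinity\<close>

definition infinite_poly :: "complex poly" where
  "infinite_poly = [:1, 0, a, 0, 1:]"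

lemma poly_infinite_poly: "poly infinite_poly y = 0 \<longleftrightarrow> 1 + y ^ 4 + a * y ^ 2 = 0"
  by (simp add: infinite_poly_def expand_powers algebra_simps)

lemma germ_infinite:
  assumes "1 + \<beta> ^ 4 + a * \<beta> ^ 2 = 0"
  obtains p u y z where "p \<in> curve F" "y $ 0 = \<beta>" "z \<noteq> 0" "z $ 0 = 0" "u $ 0 \<noteq> 0"
    "xgerm p = 1 / fps_to_fls z" "ygerm p = fps_to_fls y / fps_to_fls z" "zgerm p = fps_to_fls u * fps_to_fls z"
proof -
  define p where "p = proj_point (vector [1, \<beta>, 0])"
  have p: "p \<in> curve F"
    unfolding p_def using assms by (subst curve_iff) (auto simp: vector3_eq_iff vector_3 eval_quartic)
  then show ?thesis
  proof (cases rule: germ_cases)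
    case (2 u y z)
    then have "vector [1, \<beta>, 0] \<in> proj_point (vector [1, y $ 0, 0])"
      using mem_proj_point[of "vector [1, \<beta>, 0]"] by (simp add: infinite_arc_def p_def)
    then have "y $ 0 = \<beta>" by (auto simp: proj_point_def vector3_eq_iff vector_3)
    then show ?thesis using that[OF p] 2 by (auto simp: infinite_arc_def)
  next
    case (1 x y)
    then have "vector [1, \<beta>, 0] \<in> proj_point (vector [x $ 0, y $ 0, 1])"
      using mem_proj_point[of "vector [1, \<beta>, 0]"] by (simp add: affine_arc_def p_def)
    then show ?thesis by (auto simp: proj_point_def vector3_eq_iff vector_3)
  qed
qed

text \<open>The total degree of \<open>l(x) y ^ k\<close> is at most \<open>m\<close>; zero is split
  off because its \<open>degree\<close> is \<open>0\<close>.\<close>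

definition total_deg_le :: "nat \<Rightarrow> complex poly \<Rightarrow> nat \<Rightarrow> bool" where
  "total_deg_le m l k \<longleftrightarrow> l = 0 \<or> degree l + k \<le> m"

lemma total_deg_le_pole:
  assumes "total_deg_le d l k" "z \<noteq> 0" "z $ 0 = 0"
  shows "\<exists>w. fps_to_fls z ^ d * (polyx l (1 / fps_to_fls z) * (fps_to_fls y / fps_to_fls z) ^ k) = fps_to_fls (w * y ^ k)
     \<and> w $ 0 = (if k \<le> d then coeff l (d - k) else 0)"
proof (cases "l = 0")
  case True
  then show ?thesis by (intro exI[of _ 0]) simp
next
  case False
  then have k: "k \<le> d" "degree l \<le> d - k" using assms(1) by (auto simp: total_deg_le_def)
  obtain w where w: "fps_to_fls z ^ (d - k) * polyx l (1 / fps_to_fls z) = fps_to_fls w" "w $ 0 = coeff l (d - k)"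
    using reflected_heval[OF assms(2,3) k(2)] by blast
  have "fps_to_fls z ^ d = fps_to_fls z ^ (d - k) * fps_to_fls z ^ k"
    using k(1) by (simp flip: power_add)
  then have "fps_to_fls z ^ d * (polyx l (1 / fps_to_fls z) * (fps_to_fls y / fps_to_fls z) ^ k) =
     (fps_to_fls z ^ (d - k) * polyx l (1 / fps_to_fls z)) * fps_to_fls y ^ k"
    using assms(2) by (simp add: power_divide)
  then show ?thesis
    using w k(1) by (intro exI[of _ w]) (simp add: fls_times_fps_to_fls fps_to_fls_power)
qed

text \<open>\<open>\<tau>\<close> is the homogeneous part of degree \<open>Suc m\<close> at
  \<open>x = 1\<close>. A pole of order at most one makes it vanish at the four distinct points at
  infinity, and its degree is at most three.\<close>

lemma pole_bound_step:
  assumes b: "total_deg_le (Suc m) l0 0" "total_deg_le (Suc m) l1 1" "total_deg_le (Suc m) l2 2" "total_deg_le (Suc m) l3 3" and m: "m \<ge> 1"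
    and int: "\<And>p. p \<in> curve F \<Longrightarrow> fls_subdegree (zgerm p * cubic l0 l1 l2 l3 (xgerm p) (ygerm p)) \<ge> 0"
  shows "total_deg_le m l0 0 \<and> total_deg_le m l1 1 \<and> total_deg_le m l2 2 \<and> total_deg_le m l3 3"
proof -
  define c where "c = (\<lambda>l k. if k \<le> Suc m then coeff l (Suc m - k) else 0 :: complex)"
  define \<tau> where "\<tau> = [:c l0 0, c l1 1, c l2 2, c l3 3:]"
  have "\<tau> = 0"
  proof (rule complex_poly_eq_0_if_orders_le[of _ infinite_poly])
    have "degree \<tau> \<le> 3" by (simp add: \<tau>_def)
    then show "degree \<tau> < degree infinite_poly" by (simp add: infinite_poly_def)
  next
    fix y0 assume r: "poly infinite_poly y0 = 0" and \<tau>0: "\<tau> \<noteq> 0"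
    then have i: "1 + y0 ^ 4 + a * y0 ^ 2 = 0" by (simp add: poly_infinite_poly)
    obtain p u y z where p: "p \<in> curve F" "y $ 0 = y0" "z \<noteq> 0" "z $ 0 = 0" "u $ 0 \<noteq> 0"
      "xgerm p = 1 / fps_to_fls z" "ygerm p = fps_to_fls y / fps_to_fls z" "zgerm p = fps_to_fls u * fps_to_fls z"
      using germ_infinite[OF i] by metis
    obtain w0 where w0: "fps_to_fls z ^ Suc m * (polyx l0 (xgerm p) * ygerm p ^ 0) = fps_to_fls (w0 * y ^ 0)" "w0 $ 0 = c l0 0"
      using total_deg_le_pole[OF b(1) p(3,4), of y] unfolding p c_def by blast
    obtain w1 where w1: "fps_to_fls z ^ Suc m * (polyx l1 (xgerm p) * ygerm p ^ 1) = fps_to_fls (w1 * y ^ 1)" "w1 $ 0 = c l1 1"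
      using total_deg_le_pole[OF b(2) p(3,4), of y] unfolding p c_def by blast
    obtain w2 where w2: "fps_to_fls z ^ Suc m * (polyx l2 (xgerm p) * ygerm p ^ 2) = fps_to_fls (w2 * y ^ 2)" "w2 $ 0 = c l2 2"
      using total_deg_le_pole[OF b(3) p(3,4), of y] unfolding p c_def by blast
    obtain w3 where w3: "fps_to_fls z ^ Suc m * (polyx l3 (xgerm p) * ygerm p ^ 3) = fps_to_fls (w3 * y ^ 3)" "w3 $ 0 = c l3 3"
      using total_deg_le_pole[OF b(4) p(3,4), of y] unfolding p c_def by blast
    define W where "W = w0 + w1 * y + w2 * y ^ 2 + w3 * y ^ 3"
    define T where "T = cubic l0 l1 l2 l3 (xgerm p) (ygerm p)"
    have "fps_to_fls z ^ Suc m * T = fps_to_fls z ^ Suc m * (polyx l0 (xgerm p) * ygerm p ^ 0)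
      + fps_to_fls z ^ Suc m * (polyx l1 (xgerm p) * ygerm p ^ 1) + fps_to_fls z ^ Suc m * (polyx l2 (xgerm p) * ygerm p ^ 2)
      + fps_to_fls z ^ Suc m * (polyx l3 (xgerm p) * ygerm p ^ 3)"
      unfolding T_def cubic_def power_0 power_one_right by algebra
    also have "\<dots> = fps_to_fls W"
      unfolding w0 w1 w2 w3 W_def by simp
    finally have TW: "fps_to_fls z ^ Suc m * T = fps_to_fls W" .
    obtain g where g: "zgerm p * T = fps_to_fls g"
      using int[OF p(1)] unfolding T_def[symmetric] fls_int_iff by blast
    \<comment> \<open>\<open>W\<close> is \<open>z ^ Suc m * T\<close> and \<open>g\<close> is
      \<open>u * z * T\<close>; since \<open>g\<close> is a power series and
      \<open>m \<ge> 1\<close>, \<open>W\<close> must vanish at the point.\<close>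
    have "fps_to_fls (u * W) = fps_to_fls (z ^ m * g)"
      using TW g unfolding p(8)
      by (simp add: fls_times_fps_to_fls fps_to_fls_power flip: TW g)
    then have "u * W = z ^ m * g" by (simp only: fps_to_fls_eq_iff)
    then have "(u * W) $ 0 = (z ^ m * g) $ 0" by simp
    then have "W $ 0 = 0" using p(4,5) m by (cases m) (simp_all add: fps_nth_power_0)
    then have "poly \<tau> y0 = 0"
      using w0(2) w1(2) w2(2) w3(2) p(2)
      by (simp add: W_def \<tau>_def fps_nth_power_0 expand_powers algebra_simps)
    then have "order y0 \<tau> \<noteq> 0" using \<tau>0 by (simp add: order_root)
    moreover have "order y0 infinite_poly = 1"
      using smooth_infinite[OF i] r
      by (intro order_eq_1I)
        (simp_all add: infinite_poly_def pderiv_pCons expand_powers algebra_simps)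
    ultimately show "order y0 infinite_poly \<le> order y0 \<tau>" by simp
  qed
  then have c0: "c l0 0 = 0" "c l1 1 = 0" "c l2 2 = 0" "c l3 3 = 0" by (auto simp: \<tau>_def)
  have "total_deg_le m l k" if "total_deg_le (Suc m) l k" "c l k = 0" for l k
  proof (cases "l = 0 \<or> degree l + k \<le> m")
    case False
    then have "degree l = Suc m - k" "k \<le> Suc m" using that(1) by (auto simp: total_deg_le_def)
    then have "lead_coeff l = 0" using that(2) by (simp add: c_def)
    then show ?thesis by (simp add: total_deg_le_def)
  qed (simp add: total_deg_le_def)
  then show ?thesis using b c0 by blast
qed

lemma pole_bound:
  assumes int: "\<And>p. p \<in> curve F \<Longrightarrow> fls_subdegree (zgerm p * cubic l0 l1 l2 l3 (xgerm p) (ygerm p)) \<ge> 0"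
  shows "total_deg_le 1 l0 0 \<and> total_deg_le 1 l1 1 \<and> total_deg_le 1 l2 2 \<and> total_deg_le 1 l3 3"
proof -
  define Q where "Q = (\<lambda>m. total_deg_le m l0 0 \<and> total_deg_le m l1 1 \<and> total_deg_le m l2 2 \<and> total_deg_le m l3 3)"
  define M where "M = degree l0 + degree l1 + degree l2 + degree l3 + 3"
  have "Q M" by (simp add: Q_def M_def total_deg_le_def)
  moreover have "Q (Suc m) \<Longrightarrow> m \<ge> 1 \<Longrightarrow> Q m" for m
    unfolding Q_def using pole_bound_step[OF _ _ _ _ _ int] by blast
  moreover have "M \<ge> 1" by (simp add: M_def)
  ultimately have "Q 1"
    by (metis (mono_tags, lifting) inc_induct)
  then show ?thesis by (simp add: Q_def)
qed

section \<open>Quotients of forms without poles\<close>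

definition germ :: "poly3 \<Rightarrow> ppoint \<Rightarrow> complex fls" where
  "germ G p = fps_to_fls (restrict_form F p G)"

lemma germ_eq_affgerm: "p \<in> curve F \<Longrightarrow> homogeneous d G \<Longrightarrow> germ G p = zgerm p ^ d * affgerm G p"
  unfolding germ_def by (rule germ_scaled)

lemma germ_hom: "germ (G * H) p = germ G p * germ H p" "germ (G + H) p = germ G p + germ H p"
  "germ (G ^ n) p = germ G p ^ n"
  by (simp_all add: germ_def restrict_form_def eval3_hom fls_times_fps_to_fls fps_to_fls_power)

lemma germ_eq_0_iff: "germ G p = 0 \<longleftrightarrow> restrict_form F p G = 0"
  by (simp add: germ_def)

lemma germ_linear_form:
  assumes "p \<in> curve F"
  shows "germ (linear_form c) p = zgerm p * (fls_const (c $v 1) * xgerm p + fls_const (c $v 2) * ygerm p + fls_const (c $v 3))"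
  using germ_eq_affgerm[OF assms homogeneous_linear_form[of c]]
  by (simp add: affgerm_def eval3_linear_form vector_3)

lemma curve_nonempty: "\<exists>p. p \<in> affine_curve"
proof -
  obtain r where "poly (fibre_poly 0) r = 0"
    using fundamental_theorem_of_algebra_alt[of "fibre_poly 0"] by (auto simp: fibre_poly_def)
  then have "on_curve 0 r" using poly_fibre_poly[of 0 r] by simp
  from affine_point_in_curve[OF this] show ?thesis
    unfolding affine_curve_def by blast
qed

text \<open>In affine coordinates \<open>R / S = R * \<Phi> / N\<close> has no poles at affine
  points, hence is a polynomial; at infinity its poles are at most those of
  \<open>1 / zgerm p\<close>, hence that polynomial has degree at most one.\<close>

lemma max_noether:
  assumes hR: "homogeneous (Suc s) R" and hS: "homogeneous s S"
    and S0: "\<And>p. p \<in> curve F \<Longrightarrow> germ S p \<noteq> 0"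
    and int: "\<And>p. p \<in> curve F \<Longrightarrow> fls_subdegree (germ R p / germ S p) \<ge> 0"
  shows "\<exists>c. \<forall>p\<in>curve F. germ R p = germ (linear_form c) p * germ S p"
proof -
  obtain s0 s1 s2 s3 where s: "\<And>x y. germ_curve x y \<Longrightarrow>
    eval3 fls_const (vector [x, y, 1]) S = cubic s0 s1 s2 s3 x y"
    using reduces_eval3 by (rule reducesE) (rule that)
  obtain \<Phi> N where \<Phi>: "reduces \<Phi>" "\<And>x y. germ_curve x y \<Longrightarrow> cubic s0 s1 s2 s3 x y * \<Phi> x y = polyx N x"
    "N = 0 \<Longrightarrow> s0 = 0 \<and> s1 = 0 \<and> s2 = 0 \<and> s3 = 0"
    using norm_exists by blast
  have S: "affgerm S p = cubic s0 s1 s2 s3 (xgerm p) (ygerm p)" if "p \<in> curve F" for p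
    using s[OF germ_curve_point[OF that]] by (simp add: affgerm_def)
  have evS: "affgerm S p \<noteq> 0" if "p \<in> curve F" for p
    using S0[OF that] germ_eq_affgerm[OF that hS] by auto
  have N: "N \<noteq> 0"
  proof
    assume "N = 0"
    then have "s0 = 0" "s1 = 0" "s2 = 0" "s3 = 0" using \<Phi>(3) by auto
    obtain p where p: "p \<in> curve F" using curve_nonempty by (auto simp: affine_curve_def)
    show False using S[OF p] evS[OF p] \<open>s0 = 0\<close> \<open>s1 = 0\<close> \<open>s2 = 0\<close> \<open>s3 = 0\<close> by (simp add: cubic_def)
  qed
  have "reduces (\<lambda>x y. eval3 fls_const (vector [x, y, 1]) R * \<Phi> x y)"
    by (intro reduces_mult reduces_eval3 \<Phi>(1))
  then obtain t0 t1 t2 t3 where t: "\<And>x y. germ_curve x y \<Longrightarrow>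
    eval3 fls_const (vector [x, y, 1]) R * \<Phi> x y = cubic t0 t1 t2 t3 x y"
    by (rule reducesE) (rule that)
  have T: "affgerm R p * \<Phi> (xgerm p) (ygerm p) = cubic t0 t1 t2 t3 (xgerm p) (ygerm p)" if "p \<in> curve F" for p
    using t[OF germ_curve_point[OF that]] by (simp add: affgerm_def)
  have SN: "affgerm S p * \<Phi> (xgerm p) (ygerm p) = polyx N (xgerm p)" if "p \<in> curve F" for p
    using \<Phi>(2)[OF germ_curve_point[OF that]] S[OF that] by simp
  have N0: "polyx N (xgerm p) \<noteq> 0" if "p \<in> curve F" for p
    using heval_fls_nonzero[OF _ N] xgerm_nonconst[OF that] by blast
  have \<Phi>0: "\<Phi> (xgerm p) (ygerm p) \<noteq> 0" if "p \<in> curve F" for p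
    using SN[OF that] N0[OF that] by auto
  have quot: "germ R p / germ S p = zgerm p * (affgerm R p / affgerm S p)" if "p \<in> curve F" for p
    using zgerm_nonzero[OF that] germ_eq_affgerm[OF that hS] germ_eq_affgerm[OF that hR] by simp
  have "\<exists>l0 l1 l2 l3. t0 = N * l0 \<and> t1 = N * l1 \<and> t2 = N * l2 \<and> t3 = N * l3"
  proof (rule affine_divisibility[OF N])
    fix p assume p: "p \<in> affine_curve"
    then have pc: "p \<in> curve F" by (simp add: affine_curve_def)
    obtain x y where xy: "p = proj_point (vector [x, y, 1])" using p by (auto simp: affine_curve_def)
    have "on_curve x y"
      using pc unfolding xy by (subst (asm) curve_iff) (auto simp: vector3_eq_iff vector_3 eval_quartic)
    then have z: "fls_subdegree (zgerm p) = 0" unfolding xy by (metis germ_affine)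
    have "cubic t0 t1 t2 t3 (xgerm p) (ygerm p) / polyx N (xgerm p) = affgerm R p / affgerm S p"
      using T[OF pc] SN[OF pc] \<Phi>0[OF pc] by (metis mult_divide_mult_cancel_right)
    also have "\<dots> = inverse (zgerm p) * (germ R p / germ S p)"
      using quot[OF pc] zgerm_nonzero[OF pc] by simp
    finally show "fls_subdegree (cubic t0 t1 t2 t3 (xgerm p) (ygerm p) / polyx N (xgerm p)) \<ge> 0"
      using fls_int_mult[of "inverse (zgerm p)", OF _ int[OF pc]] z by simp
  qed
  then obtain l0 l1 l2 l3 where l: "t0 = N * l0" "t1 = N * l1" "t2 = N * l2" "t3 = N * l3" by blast
  have L: "affgerm R p / affgerm S p = cubic l0 l1 l2 l3 (xgerm p) (ygerm p)" if "p \<in> curve F" for p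
  proof -
    have "affgerm R p * \<Phi> (xgerm p) (ygerm p) = polyx N (xgerm p) * cubic l0 l1 l2 l3 (xgerm p) (ygerm p)"
      unfolding T[OF that] l cubic_def polyx_hom(3) by algebra
    also have "\<dots> = cubic l0 l1 l2 l3 (xgerm p) (ygerm p) * affgerm S p * \<Phi> (xgerm p) (ygerm p)"
      unfolding SN[OF that, symmetric] by simp
    finally show ?thesis using \<Phi>0[OF that] evS[OF that] by (simp add: field_simps)
  qed
  have "total_deg_le 1 l0 0 \<and> total_deg_le 1 l1 1 \<and> total_deg_le 1 l2 2 \<and> total_deg_le 1 l3 3"
  proof (rule pole_bound)
    fix p assume p: "p \<in> curve F"
    show "fls_subdegree (zgerm p * cubic l0 l1 l2 l3 (xgerm p) (ygerm p)) \<ge> 0"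
      using int[OF p] unfolding quot[OF p] L[OF p] .
  qed
  then have "degree l0 \<le> 1" "degree l1 = 0" "l2 = 0" "l3 = 0" by (auto simp: total_deg_le_def)
  moreover obtain c2 l where l0: "l0 = pCons c2 l" by (cases l0)
  ultimately have "degree l = 0" by (auto split: if_splits)
  with \<open>degree l1 = 0\<close> obtain c0 c1 where "l0 = [:c2, c0:]" "l1 = [:c1:]"
    unfolding l0 by (metis degree_eq_zeroE)
  then have tl: "cubic l0 l1 l2 l3 x y = fls_const c0 * x + fls_const c1 * y + fls_const c2" for x y
    using \<open>l2 = 0\<close> \<open>l3 = 0\<close> by (simp add: cubic_def polyx_pCons algebra_simps)
  have "germ R p = germ (linear_form (vector [c0, c1, c2])) p * germ S p" if "p \<in> curve F" for p
  proof -
    have "germ R p / germ S p = germ (linear_form (vector [c0, c1, c2])) p"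
      unfolding quot[OF that] L[OF that] tl germ_linear_form[OF that] by (simp add: vector_3)
    then show ?thesis using S0[OF that] by (simp add: field_simps)
  qed
  then show ?thesis by blast
qed

end

section \<open>Contact with the tangent line\<close>

lemma subdegree_fps_deriv':
  fixes f :: "complex fps"
  assumes "subdegree f = Suc n"
  shows "fps_deriv f \<noteq> 0" "subdegree (fps_deriv f) = n"
proof -
  have "f \<noteq> 0" using assms by auto
  then have n: "fps_deriv f $ n \<noteq> 0"
    using assms nth_subdegree_nonzero[of f] by (simp del: of_nat_Suc)
  then show "fps_deriv f \<noteq> 0" by (metis fps_zero_nth)
  show "subdegree (fps_deriv f) = n"
    using n assms by (intro subdegreeI) (auto intro!: nth_less_subdegree_zero)
qed

lemma intersection_mult_linear_scale:
  assumes "restrict_form G p (linear_form c) = u * \<tau>" "u $ 0 \<noteq> 0"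
  shows "intersection_mult G p (linear_form c) = (if \<tau> = 0 then \<infinity> else enat (subdegree \<tau>))"
proof -
  have "u \<noteq> 0" "subdegree u = 0" using assms(2) by auto
  then show ?thesis unfolding intersection_mult_def assms(1) by simp
qed

lemma restrict_linear_form:
  "restrict_form G p (linear_form c) = fps_const (c $v 1) * local_param G p $v 1
     + fps_const (c $v 2) * local_param G p $v 2 + fps_const (c $v 3) * local_param G p $v 3"
  by (simp add: restrict_form_def eval3_linear_form)

context smooth_quartic
begin

definition grad :: "complex ^ 3 \<Rightarrow> complex ^ 3" where
  "grad v = vector [eval3 id v (dX F), eval3 id v (dY F), eval3 id v (dZ F)]"

lemma grad_scale: "grad (c *s v) = c ^ 3 *s grad v"
  unfolding grad_def vector3_eq_iff
  by (simp add: vector_3 eval_quartic_derivs expand_powers algebra_simps)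

text \<open>The representative chosen in \<open>tangent_form\<close> is unknown; changing it
  multiplies the gradient by a cube.\<close>

lemma tangent_form_eq: "\<exists>k. k \<noteq> 0 \<and> tangent_form F (proj_point v) = linear_form (k *s grad v)"
proof -
  define w where "w = (SOME w. w \<in> proj_point v)"
  have "w \<in> proj_point v" unfolding w_def by (rule someI[of _ v]) (rule mem_proj_point)
  then obtain c where c: "c \<noteq> 0" "w = c *s v" by (auto simp: proj_point_def)
  have "tangent_form F (proj_point v) = linear_form (grad w)"
    by (simp add: tangent_form_def Let_def linear_form_def grad_def vector_3 w_def)
  then show ?thesis unfolding c(2) grad_scale using c(1) by (intro exI[of _ "c ^ 3"]) simp
qed

definition tangent_series :: "complex fps \<Rightarrow> complex fps \<Rightarrow> complex fps" where
  "tangent_series x y = fps_const (Fx (x $ 0) (y $ 0)) * (x - fps_const (x $ 0))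
     + fps_const (Fy (x $ 0) (y $ 0)) * (y - fps_const (y $ 0))"

text \<open>Euler's relation on the curve expresses the partial derivative in \<open>z\<close>
  through the other two.\<close>

lemma grad_affine:
  assumes "on_curve x y"
  shows "grad (vector [x, y, 1]) = vector [Fx x y, Fy x y, - (Fx x y * x + Fy x y * y)]"
proof -
  have "4 + 2 * b * (x ^ 2 + y ^ 2) = - (Fx x y * x + Fy x y * y)"
    using assms unfolding Fx_def Fy_def by algebra
  then show ?thesis
    unfolding grad_def vector3_eq_iff
    by (simp add: vector_3 eval_quartic_derivs Fx_def Fy_def)
qed

lemma intersection_mult_affine:
  assumes "u $ 0 \<noteq> 0" "local_param F p = u *s vector [x, y, 1]" "affine_arc p x y"
  shows "intersection_mult F p (tangent_form F p) = (if tangent_series x y = 0 then \<infinity> else enat (subdegree (tangent_series x y)))"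
proof -
  have p: "p = proj_point (vector [x $ 0, y $ 0, 1])" and oc: "on_curve (x $ 0) (y $ 0)"
    using assms(3) by (auto simp: affine_arc_def)
  obtain k where k: "k \<noteq> 0" "tangent_form F p = linear_form (k *s grad (vector [x $ 0, y $ 0, 1]))"
    using tangent_form_eq unfolding p by blast
  have "restrict_form F p (linear_form (k *s grad (vector [x $ 0, y $ 0, 1]))) = (fps_const k * u) * tangent_series x y"
    unfolding restrict_linear_form assms(2) grad_affine[OF oc]
    by (simp add: vector_3 tangent_series_def algebra_simps flip: fps_const_mult fps_const_add fps_const_neg fps_const_sub)
  then show ?thesis unfolding k(2)
    by (rule intersection_mult_linear_scale) (use k assms in simp)
qed

text \<open>The linear form is a unit times \<open>y - y0\<close>, of order at least two. In the
  second coefficient of the equation, \<open>y $ 2\<close> is balanced against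
  \<open>b * (1 + y0 ^ 2) * (z $ 1) ^ 2\<close>, which is nonzero: \<open>y0 ^ 2 = - 1\<close> would
  give \<open>a = 2\<close>.\<close>

lemma intersection_mult_infinite:
  assumes "u $ 0 \<noteq> 0" "local_param F p = u *s vector [1, y, z]" "infinite_arc p y z" "b \<noteq> 0"
  shows "intersection_mult F p (tangent_form F p) = 2"
proof -
  define y0 where "y0 = y $ 0"
  have p: "p = proj_point (vector [1, y0, 0])" and oc: "1 + y0 ^ 4 + a * y0 ^ 2 = 0"
    and z: "z $ 0 = 0" "y $ 1 = 0" "z $ 1 \<noteq> 0"
    and F0: "1 + y ^ 4 + z ^ 4 + fps_const a * y ^ 2 + fps_const b * (1 + y ^ 2) * z ^ 2 = 0"
    using assms(3) by (auto simp: infinite_arc_def y0_def)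
  obtain k where k: "k \<noteq> 0" "tangent_form F p = linear_form (k *s grad (vector [1, y0, 0]))"
    using tangent_form_eq unfolding p by blast
  define d where "d = 4 * y0 ^ 3 + 2 * a * y0"
  have d: "d \<noteq> 0" using smooth_infinite[OF oc] by (simp add: d_def)
  have "4 + 2 * a * y0 ^ 2 = - (d * y0)"
    using oc unfolding d_def by algebra
  then have g: "grad (vector [1, y0, 0]) = vector [- (d * y0), d, 0]"
    unfolding grad_def vector3_eq_iff
    by (simp add: vector_3 eval_quartic_derivs d_def)
  define \<tau> where "\<tau> = y - fps_const y0"
  have "restrict_form F p (linear_form (k *s grad (vector [1, y0, 0]))) = (fps_const (k * d) * u) * \<tau>"
    unfolding restrict_linear_form assms(2) g
    by (simp add: vector_3 \<tau>_def algebra_simps flip: fps_const_mult fps_const_add fps_const_neg fps_const_sub)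
  then have I: "intersection_mult F p (tangent_form F p) = (if \<tau> = 0 then \<infinity> else enat (subdegree \<tau>))"
    unfolding k(2) by (rule intersection_mult_linear_scale) (use k d assms in simp)
  have nth2: "(f * g) $ 2 = f $ 0 * g $ 2 + f $ 1 * g $ 1 + f $ 2 * g $ 0" for f g :: "complex fps"
    by (simp add: fps_mult_nth numeral_2_eq_2)
  have nth1: "(f * g) $ 1 = f $ 0 * g $ 1 + f $ 1 * g $ 0" for f g :: "complex fps"
    by (simp add: fps_mult_nth)
  have "(1 + y ^ 4 + z ^ 4 + fps_const a * y ^ 2 + fps_const b * (1 + y ^ 2) * z ^ 2) $ 2 = 0"
    unfolding F0 by simp
  then have e: "d * y $ 2 + b * (1 + y0 ^ 2) * (z $ 1) ^ 2 = 0"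
    using z by (simp add: expand_powers nth2 nth1 y0_def[symmetric] d_def algebra_simps
      del: One_nat_def)
  have "1 + y0 ^ 2 \<noteq> 0"
  proof
    assume "1 + y0 ^ 2 = 0"
    then have "a = 2" using oc by algebra
    then show False using a_ne2 by simp
  qed
  then have "y $ 2 \<noteq> 0" using e assms(4) z(3) by auto
  then have t2: "\<tau> $ 2 \<noteq> 0" by (simp add: \<tau>_def)
  then have "\<tau> \<noteq> 0" by (metis fps_zero_nth)
  moreover have "subdegree \<tau> = 2"
    using t2 z(2) by (intro subdegreeI) (auto simp: \<tau>_def y0_def numeral_2_eq_2 less_Suc_eq)
  ultimately show ?thesis unfolding I by (simp add: numeral_eq_enat)
qed

text \<open>The left sides are the coefficients of degrees \<open>4\<close>, \<open>3\<close>,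
  \<open>1\<close> and \<open>0\<close> of \<open>F(x, m x + n)\<close>. The last one gives
  \<open>n \<noteq> 0\<close>, and then the first two give \<open>a ^ 2 = 4\<close>.\<close>

lemma curve_contains_no_line:
  assumes "1 + m ^ 4 + a * m ^ 2 = 0" "4 * m ^ 3 * n + 2 * a * m * n = 0" "4 * m * n ^ 3 + 2 * b * m * n = 0"
    "n ^ 4 + b * n ^ 2 + 1 = 0"
  shows False
proof -
  have "n \<noteq> 0" "m \<noteq> 0" using assms(1,4) by auto
  moreover have "n * m * (2 * m ^ 2 + a) = 0" using assms(2) by algebra
  ultimately have "2 * m ^ 2 + a = 0" by simp
  then have "a ^ 2 = 4" using assms(1) by algebra
  then show False using a_ne by simp
qed

text \<open>Modulo \<open>T\<close>, a constant multiple of \<open>\<tau>\<close>, the series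
  \<open>y\<close> equals \<open>m x + n\<close>, so \<open>T\<close> divides the value at
  \<open>x\<close> of the polynomial \<open>g = F(x, m x + n)\<close>. As \<open>x - x $ 0\<close>
  has order one, the order of that value is a root multiplicity, at most the degree of
  \<open>g\<close>.\<close>

lemma tangent_order_le_4:
  assumes F0: "fps_on_curve x y"
    and x1: "x $ 1 \<noteq> 0" and \<beta>: "\<beta> \<noteq> 0"
    and \<tau>: "\<tau> = fps_const \<alpha> * (x - fps_const (x $ 0)) + fps_const \<beta> * (y - fps_const (y $ 0))"
  shows "\<tau> \<noteq> 0 \<and> subdegree \<tau> \<le> 4"
proof -
  define m n where "m = - \<alpha> / \<beta>" and "n = y $ 0 - m * x $ 0"
  define M N T where "M = fps_const m" and "N = fps_const n" and "T = fps_const (inverse \<beta>) * \<tau>"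
  define U V c \<alpha>' \<beta>' where "U = x - fps_const (x $ 0)" and "V = y - fps_const (y $ 0)"
    and "c = fps_const (inverse \<beta>)" and "\<alpha>' = fps_const \<alpha>" and "\<beta>' = fps_const \<beta>"
  have "c * \<alpha>' = - M" "c * \<beta>' = 1"
    using \<beta> by (simp_all add: M_def m_def c_def \<alpha>'_def \<beta>'_def field_simps)
  moreover have "T = c * (\<alpha>' * U + \<beta>' * V)"
    by (simp add: T_def \<tau> c_def \<alpha>'_def \<beta>'_def U_def V_def)
  ultimately have "T = - M * U + V" by algebra
  moreover have "N = fps_const (y $ 0) - M * fps_const (x $ 0)"
    by (simp add: N_def n_def M_def)
  ultimately have y: "y = M * x + N + T" unfolding U_def V_def by algebra
  define g where "g = [:n ^ 4 + b * n ^ 2 + 1, 4 * m * n ^ 3 + 2 * b * m * n, 6 * m ^ 2 * n ^ 2 + a * n ^ 2 + b * (1 + m ^ 2),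
    4 * m ^ 3 * n + 2 * a * m * n, 1 + m ^ 4 + a * m ^ 2:]"
  have g0: "g \<noteq> 0" using curve_contains_no_line[of m n] by (auto simp: g_def)
  define A B where "A = fps_const a" and "B = fps_const b"
  have "heval fps_const x g = x ^ 4 + (M * x + N) ^ 4 + 1 + A * x ^ 2 * (M * x + N) ^ 2 + B * (x ^ 2 + (M * x + N) ^ 2)"
    by (simp add: g_def A_def B_def M_def N_def heval_pCons is_ring_homD[OF is_ring_hom_fps_const] is_ring_hom_numeral[OF is_ring_hom_fps_const]
        expand_powers algebra_simps
        del: fps_const_add fps_const_mult fps_const_power)
  moreover have "T dvd \<dots> - (x ^ 4 + y ^ 4 + 1 + A * x ^ 2 * y ^ 2 + B * (x ^ 2 + y ^ 2))"
  proof -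
    define L where "L = M * x + N"
    have "x ^ 4 + L ^ 4 + 1 + A * x ^ 2 * L ^ 2 + B * (x ^ 2 + L ^ 2) -
        (x ^ 4 + y ^ 4 + 1 + A * x ^ 2 * y ^ 2 + B * (x ^ 2 + y ^ 2)) =
        T * (- (L + y) * (L ^ 2 + y ^ 2 + A * x ^ 2 + B))"
      using y unfolding L_def by algebra
    then show ?thesis unfolding L_def by simp
  qed
  ultimately have dvd: "T dvd heval fps_const x g"
    using F0 by (simp add: A_def B_def)
  define k where "k = x - fps_const (x $ 0)"
  have k: "k $ 0 = 0" "k $ 1 \<noteq> 0" using x1 by (simp_all add: k_def)
  have k': "k \<noteq> 0" "subdegree k = 1" using k by (auto intro!: subdegreeI)
  have "heval fps_const x g \<noteq> 0 \<and> subdegree (heval fps_const x g) = order (x $ 0) g"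
    using subdegree_heval[OF g0, of x] k' unfolding k_def by simp
  moreover have "order (x $ 0) g \<le> degree g" using g0 by (rule order_degree)
  moreover have "degree g \<le> 4" by (simp add: g_def)
  ultimately have "T \<noteq> 0 \<and> subdegree T \<le> 4"
    using dvd dvd_imp_subdegree_le[OF dvd] by auto
  then show ?thesis using \<beta> by (auto simp: T_def)
qed

text \<open>Obtained by reducing the bordered Hessian
  \<open>F\<^sub>x\<^sub>x F\<^sub>y\<^sup>2 - 2 F\<^sub>x\<^sub>y F\<^sub>x F\<^sub>y + F\<^sub>y\<^sub>y F\<^sub>x\<^sup>2\<close> modulo the curve and dividing by \<open>- 8\<close>.\<close>

definition flex_poly :: "complex poly" where
  "flex_poly = [:2 * (a + 6 - b ^ 2), 3 * b * (a + 6 - b ^ 2), 6 * (a + 2), b * (a + 2):]"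

lemma tangent_order:
  assumes F0: "fps_on_curve x y"
    and tan: "Fx (x $ 0) (y $ 0) * x $ 1 + Fy (x $ 0) (y $ 0) * y $ 1 = 0"
    and x1: "x $ 1 \<noteq> 0" and \<beta>: "Fy (x $ 0) (y $ 0) \<noteq> 0"
  shows "tangent_series x y \<noteq> 0 \<and> subdegree (tangent_series x y) \<le> 4 \<and> heval fps_const (x ^ 2 + y ^ 2) flex_poly \<noteq> 0 \<and>
    subdegree (tangent_series x y) = 2 + subdegree (heval fps_const (x ^ 2 + y ^ 2) flex_poly)"
proof -
  define \<tau> \<alpha> \<beta> where "\<tau> = tangent_series x y" and "\<alpha> = fps_const (Fx (x $ 0) (y $ 0))" and "\<beta> = fps_const (Fy (x $ 0) (y $ 0))"
  define h where "h = heval fps_const (x ^ 2 + y ^ 2) flex_poly"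
  define A B where "A = fps_const a" and "B = fps_const b"
  define FX FY where "FX = 4 * x ^ 3 + 2 * A * x * y ^ 2 + 2 * B * x" and "FY = 4 * y ^ 3 + 2 * A * x ^ 2 * y + 2 * B * y"
  define FXX FXY FYY where "FXX = 12 * x ^ 2 + 2 * A * y ^ 2 + 2 * B" and "FXY = 4 * A * x * y"
    and "FYY = 12 * y ^ 2 + 2 * A * x ^ 2 + 2 * B"
  define x' x'' y' y'' where "x' = fps_deriv x" and "x'' = fps_deriv x'" and "y' = fps_deriv y" and "y'' = fps_deriv y'"
  have F0': "x ^ 4 + y ^ 4 + 1 + A * x ^ 2 * y ^ 2 + B * (x ^ 2 + y ^ 2) = 0"
    using F0 by (simp add: A_def B_def)
  have "fps_deriv (x ^ 4 + y ^ 4 + 1 + A * x ^ 2 * y ^ 2 + B * (x ^ 2 + y ^ 2)) = FX * x' + FY * y'"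
    by (simp add: FX_def FY_def A_def B_def x'_def y'_def expand_powers algebra_simps)
  then have e1: "FX * x' + FY * y' = 0" using F0' by simp
  have dFX: "fps_deriv FX = FXX * x' + FXY * y'" and dFY: "fps_deriv FY = FXY * x' + FYY * y'"
    by (simp_all add: FX_def FY_def FXX_def FXY_def FYY_def A_def B_def x'_def y'_def expand_powers algebra_simps)
  have "fps_deriv (FX * x' + FY * y') = 0" unfolding e1 by simp
  then have e2: "(FXX * x' + FXY * y') * x' + FX * x'' + (FXY * x' + FYY * y') * y' + FY * y'' = 0"
    by (simp add: dFX dFY x''_def y''_def algebra_simps)
  define w where "w = x' * y'' - x'' * y'"
  define \<kappa> where "\<kappa> = FXX * FY ^ 2 - 2 * FXY * FX * FY + FYY * FX ^ 2"
  \<comment> \<open>\<open>e2\<close> eliminates \<open>FY * y''\<close>; substituting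
    \<open>FY * y' = - FX * x'\<close> twice then turns the quadratic form in \<open>x'\<close>,
    \<open>y'\<close> into \<open>x' ^ 2 * \<kappa>\<close>.\<close>
  have "FY * w = - x' * (FXX * x' ^ 2 + 2 * FXY * x' * y' + FYY * y' ^ 2)"
    using e1 e2 unfolding w_def by algebra
  then have wk: "FY ^ 3 * w = - (x' ^ 3 * \<kappa>)"
    using e1 unfolding \<kappa>_def by algebra
  have h: "h = 2 * (A + 6 - B ^ 2) + 3 * B * (A + 6 - B ^ 2) * (x ^ 2 + y ^ 2) + 6 * (A + 2) * (x ^ 2 + y ^ 2) ^ 2
      + B * (A + 2) * (x ^ 2 + y ^ 2) ^ 3"
    by (simp add: h_def flex_poly_def A_def B_def heval_pCons is_ring_homD[OF is_ring_hom_fps_const] is_ring_hom_numeral[OF is_ring_hom_fps_const]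
        expand_powers algebra_simps
        del: fps_const_add fps_const_mult fps_const_power fps_const_sub)
  define s m where "s = x ^ 2 + y ^ 2" and "m = x ^ 2 * y ^ 2"
  \<comment> \<open>In the symmetric functions \<open>s\<close> and \<open>m\<close> the equation of
    the curve is linear in \<open>m\<close>, and the long factor is the quotient of
    \<open>\<kappa> + 8 * h\<close> by it.\<close>
  have "\<kappa> = - 8 * h + (s ^ 2 + B * s + 1 + (A - 2) * m) *
     (- 16 * A ^ 2 * m + 8 * A * B * s + 32 * A * s ^ 2 - 64 * A * m + 16 * A - 16 * B ^ 2 + 48 * B * s + 192 * m + 96)"
    unfolding \<kappa>_def h s_def m_def FXX_def FXY_def FYY_def FX_def FY_def by algebra
  moreover have "s ^ 2 + B * s + 1 + (A - 2) * m = 0" using F0' unfolding s_def m_def by algebra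
  ultimately have \<kappa>: "\<kappa> = - 8 * h" by simp
  have FY0: "FY $ 0 \<noteq> 0"
    using \<beta> by (simp add: FY_def Fy_def A_def B_def fps_nth_power_0)
  have FYn: "FY \<noteq> 0" "subdegree FY = 0" using FY0 by auto
  have x'0: "x' $ 0 \<noteq> 0" using x1 by (simp add: x'_def)
  have \<tau>4: "\<tau> \<noteq> 0 \<and> subdegree \<tau> \<le> 4"
    by (rule tangent_order_le_4[OF F0 x1 \<beta>, where \<alpha> = "Fx (x $ 0) (y $ 0)"]) (simp add: \<tau>_def tangent_series_def)
  have t: "\<tau> $ 0 = 0" "\<tau> $ 1 = 0" using tan by (simp_all add: \<tau>_def tangent_series_def)
  have "subdegree \<tau> \<noteq> 0" "subdegree \<tau> \<noteq> 1"
    using \<tau>4 t nth_subdegree_nonzero[of \<tau>] by metis+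
  then obtain n where n: "subdegree \<tau> = Suc (Suc n)" by (metis One_nat_def not0_implies_Suc)
  define t1 t2 where "t1 = fps_deriv \<tau>" and "t2 = fps_deriv t1"
  note d1 = subdegree_fps_deriv'[OF n, folded t1_def]
  note d2 = subdegree_fps_deriv'[OF d1(2), folded t2_def]
  have "t1 = \<alpha> * x' + \<beta> * y'"
    by (simp add: t1_def \<tau>_def tangent_series_def \<alpha>_def \<beta>_def x'_def y'_def)
  moreover from this have "t2 = \<alpha> * x'' + \<beta> * y''"
    by (simp add: t2_def \<alpha>_def \<beta>_def x''_def y''_def)
  \<comment> \<open>Elimination of \<open>\<alpha>\<close>. Here \<open>t2\<close> has order
    \<open>n\<close> and \<open>t1\<close> order \<open>n + 1\<close>, so \<open>x' * t2\<close>
    dominates and fixes the order of \<open>w\<close>.\<close>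
  ultimately have bw: "\<beta> * w = x' * t2 - x'' * t1"
    unfolding w_def by algebra
  have x'n: "x' \<noteq> 0" "subdegree x' = 0" using x'0 by auto
  have 1: "x' * t2 \<noteq> 0" "subdegree (x' * t2) = n"
    using x'n d2 by simp_all
  have 2: "subdegree (x'' * t1) > n \<or> x'' * t1 = 0"
    using d1 by (cases "x'' = 0") simp_all
  have "(\<beta> * w) \<noteq> 0 \<and> subdegree (\<beta> * w) = n"
  proof -
    have "(\<beta> * w) $ i = (x' * t2) $ i" if "i \<le> n" for i
    proof -
      have "(x'' * t1) $ i = 0" using 2 that nth_less_subdegree_zero[of i "x'' * t1"] by auto
      then show ?thesis unfolding bw by simp
    qed
    then have w: "(\<beta> * w) $ n \<noteq> 0" "\<And>i. i < n \<Longrightarrow> (\<beta> * w) $ i = 0"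
      using 1 nth_subdegree_nonzero[OF 1(1)] nth_less_subdegree_zero[of _ "x' * t2"] by simp_all
    then have "\<beta> * w \<noteq> 0" by (metis fps_zero_nth)
    moreover have "subdegree (\<beta> * w) = n" using w by (rule subdegreeI)
    ultimately show ?thesis by blast
  qed
  then have w: "w \<noteq> 0" "subdegree w = n" using \<beta> by (auto simp: \<beta>_def)
  have "FY ^ 3 * w = x' ^ 3 * (8 * h)" using wk \<kappa> by simp
  moreover have "FY ^ 3 * w \<noteq> 0" "subdegree (FY ^ 3 * w) = n"
    using FYn w by simp_all
  ultimately have "x' ^ 3 * (8 * h) \<noteq> 0" "subdegree (x' ^ 3 * (8 * h)) = n" by simp_all
  then have "h \<noteq> 0" "subdegree h = n" using x'n by auto
  then show ?thesis using \<tau>4 n unfolding \<tau>_def h_def by simp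
qed

text \<open>The curve, the tangent series and \<open>x ^ 2 + y ^ 2\<close> are symmetric in
  \<open>x\<close> and \<open>y\<close>, so a vertical tangent is handled by exchanging the
  coordinates.\<close>

lemma tangent_order_affine_arc:
  assumes "affine_arc p x y"
  shows "tangent_series x y \<noteq> 0 \<and> subdegree (tangent_series x y) \<le> 4 \<and> heval fps_const (x ^ 2 + y ^ 2) flex_poly \<noteq> 0 \<and>
    subdegree (tangent_series x y) = 2 + subdegree (heval fps_const (x ^ 2 + y ^ 2) flex_poly)"
proof -
  have oc: "on_curve (x $ 0) (y $ 0)" and xy1: "x $ 1 \<noteq> 0 \<or> y $ 1 \<noteq> 0"
    and F0: "fps_on_curve x y"
    using assms by (auto simp: affine_arc_def)
  note tan = affine_arc_tangent[OF assms]
  show ?thesis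
  proof (cases "Fy (x $ 0) (y $ 0) = 0")
    case False
    then have "x $ 1 \<noteq> 0" using tan xy1 by auto
    then show ?thesis using tangent_order[OF F0 tan _ False] by blast
  next
    case True
    then have Fx: "Fx (x $ 0) (y $ 0) \<noteq> 0" using smooth_affine[OF oc] by blast
    have sw: "Fx (y $ 0) (x $ 0) = Fy (x $ 0) (y $ 0)" "Fy (y $ 0) (x $ 0) = Fx (x $ 0) (y $ 0)"
      by (simp_all add: Fx_def Fy_def algebra_simps)
    have "y $ 1 \<noteq> 0" using tan True Fx xy1 by auto
    moreover have "fps_on_curve y x"
      using F0 by (simp add: algebra_simps)
    moreover have "Fx (y $ 0) (x $ 0) * y $ 1 + Fy (y $ 0) (x $ 0) * x $ 1 = 0"
      using tan by (simp add: sw algebra_simps)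
    moreover have "tangent_series y x = tangent_series x y" by (simp add: tangent_series_def sw algebra_simps)
    ultimately show ?thesis
      using tangent_order[of y x] Fx by (simp add: sw add.commute)
  qed
qed

definition tangent_mult :: "ppoint \<Rightarrow> enat" where
  "tangent_mult p = intersection_mult F p (tangent_form F p)"

text \<open>The affine points with trivial stabilizer in \<open>G1\<close>.\<close>

definition generic :: "complex \<Rightarrow> complex \<Rightarrow> bool" where
  "generic x y \<longleftrightarrow> x \<noteq> 0 \<and> y \<noteq> 0 \<and> x ^ 2 \<noteq> y ^ 2"

text \<open>Along the arc, the order of \<open>flex_poly\<close> at \<open>s = x ^ 2 + y ^ 2\<close>
  is the root multiplicity times the order of \<open>s\<close> minus its value. The latter is one
  exactly at generic points.\<close>

lemma tangent_mult_affine: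
  assumes oc: "on_curve x0 y0" and p: "p = proj_point (vector [x0, y0, 1])"
  shows "tangent_mult p \<in> {2, 3, 4}"
    and "poly flex_poly (x0 ^ 2 + y0 ^ 2) \<noteq> 0 \<Longrightarrow> tangent_mult p = 2"
    and "poly flex_poly (x0 ^ 2 + y0 ^ 2) = 0 \<Longrightarrow> generic x0 y0 \<Longrightarrow>
      tangent_mult p = 2 + enat (order (x0 ^ 2 + y0 ^ 2) flex_poly)"
    and "poly flex_poly (x0 ^ 2 + y0 ^ 2) = 0 \<Longrightarrow> \<not> generic x0 y0 \<Longrightarrow>
      tangent_mult p = 4 \<and> order (x0 ^ 2 + y0 ^ 2) flex_poly = 1"
proof -
  have pc: "p \<in> curve F" unfolding p using oc by (rule affine_point_in_curve)
  obtain u x y where u: "u $ 0 \<noteq> 0" "local_param F p = u *s vector [x, y, 1]" and arc: "affine_arc p x y"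
    using pc
  proof (cases rule: local_param_cases)
    case (2 u y z)
    then have "vector [x0, y0, 1] \<in> proj_point (vector [1, y $ 0, 0])"
      using mem_proj_point[of "vector [x0, y0, 1]"] by (simp add: infinite_arc_def p)
    then show ?thesis by (auto simp: proj_point_def vector3_eq_iff vector_3)
  qed
  have xy0: "x $ 0 = x0" "y $ 0 = y0"
    using arc by (auto simp: affine_arc_def p affine_point_eq_iff)
  define s where "s = x ^ 2 + y ^ 2"
  define H where "H = heval fps_const s flex_poly"
  have s0: "s $ 0 = x0 ^ 2 + y0 ^ 2" by (simp add: s_def fps_nth_power_0 xy0)
  have t: "tangent_series x y \<noteq> 0" "subdegree (tangent_series x y) \<le> 4" "H \<noteq> 0" "subdegree (tangent_series x y) = 2 + subdegree H"
    using tangent_order_affine_arc[OF arc] by (auto simp: H_def s_def)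
  have I: "tangent_mult p = enat (2 + subdegree H)"
    unfolding tangent_mult_def using intersection_mult_affine[OF u arc] t by simp
  have le: "subdegree H \<le> 2" using t by simp
  then have "subdegree H = 0 \<or> subdegree H = 1 \<or> subdegree H = 2" by linarith
  then show "tangent_mult p \<in> {2, 3, 4}"
    unfolding I by (auto simp: numeral_eq_enat)
  have H0: "H $ 0 = poly flex_poly (x0 ^ 2 + y0 ^ 2)" by (simp add: H_def heval_fps_nth_0 s0)
  show "tangent_mult p = 2" if "poly flex_poly (x0 ^ 2 + y0 ^ 2) \<noteq> 0"
    using that H0 unfolding I by (simp add: numeral_eq_enat)
  have form: "s - fps_const (s $ 0) \<noteq> 0 \<and> flex_poly \<noteq> 0 \<and> order (s $ 0) flex_poly \<ge> 1 \<and>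
     subdegree H = order (s $ 0) flex_poly * subdegree (s - fps_const (s $ 0))"
    if z: "poly flex_poly (x0 ^ 2 + y0 ^ 2) = 0"
  proof -
    have h: "flex_poly \<noteq> 0" using t(3) by (auto simp: H_def)
    have sn: "s - fps_const (s $ 0) \<noteq> 0"
    proof
      assume "s - fps_const (s $ 0) = 0"
      then have "s = fps_const (s $ 0)" by simp
      then have "H = fps_const (poly flex_poly (s $ 0))"
        using ring_hom_heval[OF is_ring_hom_fps_const is_ring_hom_id, of "s $ 0" flex_poly]
        by (simp add: H_def heval_def map_poly_id)
      then show False using z t(3) by (simp add: s0)
    qed
    have "order (s $ 0) flex_poly \<noteq> 0" using z h by (simp add: order_root s0)
    then show ?thesis using subdegree_heval[OF h sn] sn h by (simp add: H_def)
  qed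
  have s1: "(s - fps_const (s $ 0)) $ 0 = 0" "(s - fps_const (s $ 0)) $ 1 = 2 * (x0 * x $ 1 + y0 * y $ 1)"
    by (simp_all add: s_def power2_eq_square fps_nth_1_mult xy0 algebra_simps)
  have tan: "Fx x0 y0 * x $ 1 + Fy x0 y0 * y $ 1 = 0"
    using affine_arc_tangent[OF arc] xy0 by simp
  have xy1: "x $ 1 \<noteq> 0 \<or> y $ 1 \<noteq> 0" using arc by (simp add: affine_arc_def)
  \<comment> \<open>Up to a constant factor, the Jacobian of \<open>F\<close> and
    \<open>x ^ 2 + y ^ 2\<close>: the differential of \<open>s\<close> along the curve vanishes
    exactly where \<open>k\<close> does.\<close>
  define k where "k = 2 * x0 * y0 * (y0 ^ 2 - x0 ^ 2) * (2 - a)"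
  have kk: "Fy x0 y0 * x0 - Fx x0 y0 * y0 = k"
    unfolding k_def Fx_def Fy_def by algebra
  have kx: "Fy x0 y0 * (x0 * x $ 1 + y0 * y $ 1) = k * x $ 1"
    using tan kk by algebra
  have ky: "Fx x0 y0 * (x0 * x $ 1 + y0 * y $ 1) = - k * y $ 1"
    using tan kk by algebra
  have k: "k \<noteq> 0 \<longleftrightarrow> generic x0 y0"
    using a_ne2 by (auto simp: k_def generic_def)
  show "tangent_mult p = 2 + enat (order (x0 ^ 2 + y0 ^ 2) flex_poly)"
    if z: "poly flex_poly (x0 ^ 2 + y0 ^ 2) = 0" and g: "generic x0 y0"
  proof -
    have "x0 * x $ 1 + y0 * y $ 1 \<noteq> 0" using kx ky k g xy1 by auto
    then have "(s - fps_const (s $ 0)) $ 1 \<noteq> 0"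
      unfolding s1 by (metis mult_eq_0_iff zero_neq_numeral)
    then have "subdegree (s - fps_const (s $ 0)) = 1"
      by (rule subdegreeI) (use s1 in simp)
    then show ?thesis unfolding I using form[OF z] by (simp add: numeral_eq_enat s0)
  qed
  show "tangent_mult p = 4 \<and> order (x0 ^ 2 + y0 ^ 2) flex_poly = 1"
    if z: "poly flex_poly (x0 ^ 2 + y0 ^ 2) = 0" and g: "\<not> generic x0 y0"
  proof -
    define S where "S = s - fps_const (s $ 0)"
    have "x0 * x $ 1 + y0 * y $ 1 = 0" using kx ky k g smooth_affine[OF oc] by auto
    then have "S $ 0 = 0" "S $ 1 = 0" using s1 by (simp_all add: S_def)
    moreover have "S \<noteq> 0" using form[OF z] by (simp add: S_def)
    ultimately have S2: "subdegree S \<ge> 2" by (intro subdegree_geI) (auto simp: less_2_cases_iff)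
    \<comment> \<open>The order \<open>o1 * subdegree S\<close> is at most \<open>4 - 2\<close>, and
      \<open>subdegree S\<close> is at least two: only a simple root and ramification of order
      exactly two remain.\<close>
    define o1 where "o1 = order (s $ 0) flex_poly"
    have o1: "o1 \<ge> 1" "o1 * subdegree S \<le> 2" "subdegree H = o1 * subdegree S"
      using form[OF z] le by (simp_all add: o1_def S_def)
    have "o1 * 2 \<le> o1 * subdegree S" using S2 by simp
    then have "o1 = 1" using o1 by linarith
    then have "subdegree H = 2" using o1 S2 by simp
    then show ?thesis unfolding I using \<open>o1 = 1\<close> by (simp add: numeral_eq_enat s0 o1_def)
  qed
qed

end

section \<open>Canonical divisors and gaps\<close>

lemma homogeneous_dX: "homogeneous (Suc d) G \<Longrightarrow> homogeneous d (dX G)"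
  and homogeneous_dY: "homogeneous (Suc d) G \<Longrightarrow> homogeneous d (dY G)"
  using homogeneous_derivs[of "Suc d" G] by simp_all

interpretation germs: vector_space germ_scale
  by (rule vector_space_germs)

interpretation cvec: finite_dimensional_vector_space_pair_1 "(*s) :: complex \<Rightarrow> complex ^ 3 \<Rightarrow> _" cart_basis germ_scale
  by unfold_locales

text \<open>\<open>b \<noteq> 0\<close> makes the contact at infinity exactly two and the leading
  coefficient \<open>b * (a + 2)\<close> of \<open>flex_poly\<close> nonzero.\<close>

locale flex_quartic = smooth_quartic +
  assumes b_ne0: "b \<noteq> 0"
begin

section \<open>Orders of linear forms at a point\<close>

abbreviation lin :: "ppoint \<Rightarrow> complex ^ 3 \<Rightarrow> complex fps" where
  "lin p c \<equiv> restrict_form F p (linear_form c)"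

lemma grad_infinite:
  assumes "1 + y0 ^ 4 + a * y0 ^ 2 = 0"
  shows "grad (vector [1, y0, 0]) = (4 * y0 ^ 3 + 2 * a * y0) *s vector [- y0, 1, 0]"
proof -
  have "4 + 2 * a * y0 ^ 2 = - ((4 * y0 ^ 3 + 2 * a * y0) * y0)"
    using assms by algebra
  then show ?thesis
    unfolding grad_def vector3_eq_iff
    by (simp add: vector_3 eval_quartic_derivs algebra_simps)
qed

lemma tangent_mult_infinite:
  assumes "u $ 0 \<noteq> 0" "local_param F p = u *s vector [1, y, z]" "infinite_arc p y z"
  shows "tangent_mult p = 2"
  unfolding tangent_mult_def using intersection_mult_infinite[OF assms b_ne0] .

lemma tangent_mult_range:
  assumes "p \<in> curve F"
  shows "tangent_mult p \<in> {2, 3, 4}"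
  using assms
proof (cases rule: local_param_cases)
  case (1 u x y)
  then show ?thesis using tangent_mult_affine(1)[of "x $ 0" "y $ 0" p] by (auto simp: affine_arc_def)
next
  case (2 u y z)
  then show ?thesis using tangent_mult_infinite by simp
qed

text \<open>The three forms are a line missing \<open>p\<close>, a line through \<open>p\<close>
  transversal to the curve, and the tangent. The last clause says that contact of order two
  determines the tangent up to a scalar, so no further orders occur.\<close>

lemma linear_orders:
  assumes "p \<in> curve F"
  obtains e0 e1 e2 where "lin p e0 $ 0 \<noteq> 0" "lin p e1 \<noteq> 0" "subdegree (lin p e1) = 1"
    "lin p e2 \<noteq> 0" "tangent_mult p = enat (subdegree (lin p e2))"
    "\<And>c. lin p c $ 0 = 0 \<Longrightarrow> lin p c $ 1 = 0 \<Longrightarrow> \<exists>k. c = k *s e2"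
proof -
  have I: "tangent_mult p \<noteq> \<infinity>" using tangent_mult_range[OF assms] by (auto simp: numeral_eq_enat)
  have e2: "lin p e \<noteq> 0 \<and> tangent_mult p = enat (subdegree (lin p e))" if "tangent_form F p = linear_form e" for e
    using I unfolding tangent_mult_def intersection_mult_def that by (auto split: if_splits)
  show ?thesis
    using assms
  proof (cases rule: local_param_cases)
    case (1 u x y)
    define \<alpha> \<beta> where "\<alpha> = Fx (x $ 0) (y $ 0)" and "\<beta> = Fy (x $ 0) (y $ 0)"
    have oc: "on_curve (x $ 0) (y $ 0)" and p: "p = proj_point (vector [x $ 0, y $ 0, 1])"
      and xy1: "x $ 1 \<noteq> 0 \<or> y $ 1 \<noteq> 0"
      using 1(3) by (auto simp: affine_arc_def)
    have tan: "\<alpha> * x $ 1 + \<beta> * y $ 1 = 0" using affine_arc_tangent[OF 1(3)] by (simp add: \<alpha>_def \<beta>_def)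
    have sm: "\<alpha> \<noteq> 0 \<or> \<beta> \<noteq> 0" using smooth_affine[OF oc] by (simp add: \<alpha>_def \<beta>_def)
    have lin: "lin p c = u * (fps_const (c $v 1) * x + fps_const (c $v 2) * y + fps_const (c $v 3))" for c
      unfolding restrict_linear_form 1(2) by (simp add: vector_3 algebra_simps)
    have lin0: "lin p c $ 0 = u $ 0 * (c $v 1 * x $ 0 + c $v 2 * y $ 0 + c $v 3)" for c
      by (simp add: lin)
    have lin1: "lin p c $ 1 = u $ 0 * (c $v 1 * x $ 1 + c $v 2 * y $ 1) + u $ 1 * (c $v 1 * x $ 0 + c $v 2 * y $ 0 + c $v 3)" for c
      by (simp add: lin fps_nth_1_mult)
    obtain k where k: "k \<noteq> 0" "tangent_form F p = linear_form (k *s grad (vector [x $ 0, y $ 0, 1]))"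
      using tangent_form_eq unfolding p by blast
    define e2 where "e2 = k *s grad (vector [x $ 0, y $ 0, 1])"
    \<comment> \<open>Whichever of \<open>x - x $ 0\<close> and \<open>y - y $ 0\<close> has order
      one along the arc.\<close>
    define e1 :: "complex ^ 3" where "e1 = (if x $ 1 \<noteq> 0 then vector [1, 0, - (x $ 0)] else vector [0, 1, - (y $ 0)])"
    have l1: "lin p e1 $ 1 \<noteq> 0" "lin p e1 $ 0 = 0"
      using 1(1) xy1 unfolding lin1 lin0 e1_def by (auto simp: vector_3)
    then have "lin p e1 \<noteq> 0" by (metis fps_zero_nth)
    moreover have "subdegree (lin p e1) = 1" using l1 by (intro subdegreeI) auto
    moreover have "lin p (vector [0, 0, 1]) $ 0 \<noteq> 0"
      using 1(1) unfolding lin0 by (simp add: vector_3)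
    moreover have "\<exists>j. c = j *s e2" if c: "lin p c $ 0 = 0" "lin p c $ 1 = 0" for c
    proof -
      have c3: "c $v 3 = - (c $v 1 * x $ 0 + c $v 2 * y $ 0)"
        using c(1) 1(1) unfolding lin0 by (simp only: mult_eq_0_iff add_eq_0_iff) simp
      have c12: "c $v 1 * x $ 1 + c $v 2 * y $ 1 = 0" using c 1(1) unfolding lin0 lin1 by auto
      have "\<exists>j. c $v 1 = j * \<alpha> \<and> c $v 2 = j * \<beta>"
      proof (cases "x $ 1 = 0")
        case True
        then have "y $ 1 \<noteq> 0" "\<beta> = 0" "c $v 2 = 0" using xy1 tan c12 by auto
        then show ?thesis using sm by (intro exI[of _ "c $v 1 / \<alpha>"]) auto
      next
        case False
        have "\<beta> \<noteq> 0" using False tan sm by auto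
        moreover have "x $ 1 * (\<beta> * c $v 1) = x $ 1 * (c $v 2 * \<alpha>)" using tan c12 by algebra
        then have "\<beta> * c $v 1 = c $v 2 * \<alpha>" using False by simp
        ultimately show ?thesis by (intro exI[of _ "c $v 2 / \<beta>"]) (simp add: field_simps)
      qed
      then obtain j where j: "c $v 1 = j * \<alpha>" "c $v 2 = j * \<beta>" by blast
      have "c = (j / k) *s e2"
        using k(1) unfolding e2_def grad_affine[OF oc] vector3_eq_iff
        by (simp add: vector_3 j c3 \<alpha>_def[symmetric] \<beta>_def[symmetric] algebra_simps)
      then show ?thesis by blast
    qed
    ultimately show ?thesis using that e2[of e2] k(2) unfolding e2_def by blast
  next
    case (2 u y z)
    have oc: "1 + (y $ 0) ^ 4 + a * (y $ 0) ^ 2 = 0" and p: "p = proj_point (vector [1, y $ 0, 0])"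
      and z: "z $ 0 = 0" "y $ 1 = 0" "z $ 1 \<noteq> 0"
      using 2(3) by (auto simp: infinite_arc_def)
    have lin: "lin p c = u * (fps_const (c $v 1) + fps_const (c $v 2) * y + fps_const (c $v 3) * z)" for c
      unfolding restrict_linear_form 2(2) by (simp add: vector_3 algebra_simps)
    have lin0: "lin p c $ 0 = u $ 0 * (c $v 1 + c $v 2 * y $ 0)" for c
      by (simp add: lin z)
    have lin1: "lin p c $ 1 = u $ 0 * (c $v 3 * z $ 1) + u $ 1 * (c $v 1 + c $v 2 * y $ 0)" for c
      using z by (simp add: lin fps_nth_1_mult)
    obtain k where k: "k \<noteq> 0" "tangent_form F p = linear_form (k *s grad (vector [1, y $ 0, 0]))"
      using tangent_form_eq unfolding p by blast
    define e2 where "e2 = k *s grad (vector [1, y $ 0, 0])"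
    define d where "d = 4 * (y $ 0) ^ 3 + 2 * a * y $ 0"
    have d: "d \<noteq> 0" using smooth_infinite[OF oc] by (simp add: d_def)
    define e1 :: "complex ^ 3" where "e1 = vector [0, 0, 1]"
    have l1: "lin p e1 $ 1 \<noteq> 0" "lin p e1 $ 0 = 0"
      using 2(1) z unfolding lin1 lin0 e1_def by (auto simp: vector_3)
    then have "lin p e1 \<noteq> 0" by (metis fps_zero_nth)
    moreover have "subdegree (lin p e1) = 1" using l1 by (intro subdegreeI) auto
    moreover have "lin p (vector [1, 0, 0]) $ 0 \<noteq> 0"
      using 2(1) unfolding lin0 by (simp add: vector_3)
    moreover have "\<exists>j. c = j *s e2" if c: "lin p c $ 0 = 0" "lin p c $ 1 = 0" for c
    proof -
      have c1: "c $v 1 = - (c $v 2 * y $ 0)"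
        using c(1) 2(1) unfolding lin0 by (simp add: eq_neg_iff_add_eq_0)
      have c3: "c $v 3 = 0" using c 2(1) z unfolding lin0 lin1 by auto
      have "c = (c $v 2 / (k * d)) *s e2"
        using k(1) d unfolding e2_def grad_infinite[OF oc] vector3_eq_iff
        by (simp add: vector_3 c1 c3 d_def[symmetric])
      then show ?thesis by blast
    qed
    ultimately show ?thesis using that e2[of e2] k(2) unfolding e2_def by blast
  qed
qed

text \<open>Under the identification of \<open>L(K)\<close> with the linear forms, this subspace
  corresponds to \<open>L(K - n p)\<close>.\<close>

definition vanishing :: "ppoint \<Rightarrow> nat \<Rightarrow> (complex ^ 3) set" where
  "vanishing p n = {c. \<forall>i<n. lin p c $ i = 0}"

lemma lin_add: "lin p (c + d) = lin p c + lin p d"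
  by (simp add: restrict_linear_form algebra_simps flip: fps_const_add)

lemma lin_scale: "lin p (k *s c) = fps_const k * lin p c"
  by (simp add: restrict_linear_form algebra_simps flip: fps_const_mult)

lemma lin_0: "lin p 0 = 0"
  by (simp add: restrict_linear_form)

lemma subspace_vanishing: "vec.subspace (vanishing p n)"
  by (auto simp: vec.subspace_def vanishing_def lin_add lin_scale lin_0)

lemma vanishing_antimono: "m \<le> n \<Longrightarrow> vanishing p n \<subseteq> vanishing p m"
  by (auto simp: vanishing_def)

lemma lin_eq_0_iff:
  assumes "p \<in> curve F"
  shows "lin p c = 0 \<longleftrightarrow> c = 0"
proof
  assume c: "lin p c = 0"
  from assms obtain e2 where e2: "lin p e2 \<noteq> 0"
    "\<And>c. lin p c $ 0 = 0 \<Longrightarrow> lin p c $ 1 = 0 \<Longrightarrow> \<exists>k. c = k *s e2"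
    by (rule linear_orders) blast
  obtain k where k: "c = k *s e2" using e2(2)[of c] c by auto
  then have "fps_const k * lin p e2 = 0" using c by (simp add: lin_scale)
  then show "c = 0" using e2(1) k by simp
qed (simp add: lin_0)

text \<open>The filtration drops between \<open>m\<close> and \<open>Suc m\<close> exactly when some
  linear form has order \<open>m\<close>.\<close>

lemma vanishing_strict_iff:
  assumes p: "p \<in> curve F"
  shows "vanishing p (Suc m) \<noteq> vanishing p m \<longleftrightarrow> m = 0 \<or> m = 1 \<or> enat m = tangent_mult p"
proof -
  obtain e0 e1 e2 where e: "lin p e0 $ 0 \<noteq> 0" "lin p e1 \<noteq> 0" "subdegree (lin p e1) = 1"
    "lin p e2 \<noteq> 0" "tangent_mult p = enat (subdegree (lin p e2))"
    and k: "\<And>c. lin p c $ 0 = 0 \<Longrightarrow> lin p c $ 1 = 0 \<Longrightarrow> \<exists>k. c = k *s e2"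
    using linear_orders[OF p] by metis
  have *: "vanishing p (Suc (subdegree (lin p c))) \<noteq> vanishing p (subdegree (lin p c))" if "lin p c \<noteq> 0" for c
  proof -
    have "c \<in> vanishing p (subdegree (lin p c))"
      by (auto simp: vanishing_def)
    moreover have "c \<notin> vanishing p (Suc (subdegree (lin p c)))"
      using that nth_subdegree_nonzero[OF that] by (auto simp: vanishing_def)
    ultimately show ?thesis by blast
  qed
  show ?thesis
  proof
    assume ne: "vanishing p (Suc m) \<noteq> vanishing p m"
    then obtain c where c: "c \<in> vanishing p m" "c \<notin> vanishing p (Suc m)"
      using vanishing_antimono[of m "Suc m" p] by auto
    then have m: "\<And>i. i < m \<Longrightarrow> lin p c $ i = 0" "lin p c $ m \<noteq> 0"
      by (auto simp: vanishing_def less_Suc_eq)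
    show "m = 0 \<or> m = 1 \<or> enat m = tangent_mult p"
    proof (cases "m \<le> 1")
      case False
      then obtain j where j: "c = j *s e2" using k[of c] m(1) by auto
      have "subdegree (lin p c) = m" using m by (intro subdegreeI) auto
      moreover have "j \<noteq> 0" using j m(2) by (auto simp: lin_0)
      ultimately have "subdegree (lin p e2) = m" using e(4) unfolding j lin_scale by simp
      then show ?thesis using e(5) by simp
    qed auto
  next
    assume "m = 0 \<or> m = 1 \<or> enat m = tangent_mult p"
    moreover have "lin p e0 \<noteq> 0" "subdegree (lin p e0) = 0" using e(1) by auto
    ultimately show "vanishing p (Suc m) \<noteq> vanishing p m"
      using *[of e0] *[of e1] *[of e2] e by auto
  qed
qed

text \<open>The series \<open>w\<close> expands \<open>dx / F\<^sub>y = - dy / F\<^sub>x\<close>.\<close>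

lemma uniformizing_differential:
  assumes "p \<in> curve F"
  shows "\<exists>w. w \<noteq> 0 \<and> fls_subdegree w = fls_subdegree (zgerm p) \<and>
    fls_deriv (xgerm p) = affgerm (dY F) p * w \<and> fls_deriv (ygerm p) = - affgerm (dX F) p * w"
proof -
  define FX FY where "FX = affgerm (dX F) p" and "FY = affgerm (dY F) p"
  have "affgerm F p = 0"
    using germ_curve_point[OF assms] by (simp add: affgerm_def germ_curve_def eval_quartic vector_3)
  then have "fls_deriv (affgerm F p) = 0" by simp
  then have rel: "FX * fls_deriv (xgerm p) + FY * fls_deriv (ygerm p) = 0"
    unfolding affgerm_def FX_def FY_def
    by (subst (asm) der_eval3[OF is_derivation_fls_deriv is_ring_hom_fls_const]) (simp_all add: vector_3)
  have FX: "FX = 4 * xgerm p ^ 3 + 2 * fls_const a * xgerm p * ygerm p ^ 2 + 2 * fls_const b * xgerm p"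
    and FY: "FY = 4 * ygerm p ^ 3 + 2 * fls_const a * xgerm p ^ 2 * ygerm p + 2 * fls_const b * ygerm p"
    by (simp_all add: FX_def FY_def affgerm_def eval_quartic_derivs vector_3)
  have "\<exists>w. w \<noteq> 0 \<and> fls_subdegree w = fls_subdegree (zgerm p) \<and>
    fls_deriv (xgerm p) = FY * w \<and> fls_deriv (ygerm p) = - FX * w"
    using assms
  proof (cases rule: germ_cases)
    case (1 x y)
    have oc: "on_curve (x $ 0) (y $ 0)" and xy1: "x $ 1 \<noteq> 0 \<or> y $ 1 \<noteq> 0"
      using 1(1) by (auto simp: affine_arc_def)
    note tan = affine_arc_tangent[OF 1(1)]
    define fx fy where "fx = 4 * x ^ 3 + 2 * fps_const a * x * y ^ 2 + 2 * fps_const b * x"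
      and "fy = 4 * y ^ 3 + 2 * fps_const a * x ^ 2 * y + 2 * fps_const b * y"
    have FXf: "FX = fps_to_fls fx" and FYf: "FY = fps_to_fls fy"
      by (simp_all add: FX FY 1 fx_def fy_def fls_times_fps_to_fls fps_to_fls_power)
    have f0: "fx $ 0 = Fx (x $ 0) (y $ 0)" "fy $ 0 = Fy (x $ 0) (y $ 0)"
      by (simp_all add: fx_def fy_def Fx_def Fy_def fps_nth_power_0)
    have dxi: "fls_deriv (xgerm p) = fps_to_fls (fps_deriv x)" and dup: "fls_deriv (ygerm p) = fps_to_fls (fps_deriv y)"
      by (simp_all add: 1 fls_deriv_fps_to_fls)
    have unit: "fps_to_fls f \<noteq> 0 \<and> fls_subdegree (fps_to_fls f) = 0" if "f $ 0 \<noteq> 0" for f :: "complex fps"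
      using that by (auto simp: fls_subdegree_fls_to_fps)
    show ?thesis
    proof (cases "Fy (x $ 0) (y $ 0) = 0")
      case False
      then have "x $ 1 \<noteq> 0" using tan xy1 by auto
      then have u: "fls_deriv (xgerm p) \<noteq> 0 \<and> fls_subdegree (fls_deriv (xgerm p)) = 0" "FY \<noteq> 0 \<and> fls_subdegree FY = 0"
        using unit[of "fps_deriv x"] unit[of fy] False f0 unfolding dxi FYf by simp_all
      define w where "w = fls_deriv (xgerm p) / FY"
      have w1: "fls_deriv (xgerm p) = FY * w" using u by (simp add: w_def)
      have "w \<noteq> 0" using u w1 by auto
      then have "fls_subdegree w = 0" using w1 u by (metis add_0 fls_subdegree_mult)
      moreover have "FY * fls_deriv (ygerm p) = FY * (- FX * w)" using rel w1 by algebra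
      then have "fls_deriv (ygerm p) = - FX * w" using u(2) mult_cancel_left by blast
      ultimately show ?thesis using w1 \<open>w \<noteq> 0\<close> 1 by (intro exI[of _ w]) simp
    next
      case True
      then have "Fx (x $ 0) (y $ 0) \<noteq> 0" using smooth_affine[OF oc] by blast
      then have "y $ 1 \<noteq> 0" "fx $ 0 \<noteq> 0" using tan xy1 True f0 by auto
      then have u: "fls_deriv (ygerm p) \<noteq> 0 \<and> fls_subdegree (fls_deriv (ygerm p)) = 0" "FX \<noteq> 0 \<and> fls_subdegree FX = 0"
        using unit[of "fps_deriv y"] unit[of fx] unfolding dup FXf by simp_all
      define w where "w = - fls_deriv (ygerm p) / FX"
      have w1: "fls_deriv (ygerm p) = - FX * w" using u by (simp add: w_def)
      have "w \<noteq> 0" using u w1 by auto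
      moreover have "fls_subdegree (FX * w) = 0" using w1 u by simp
      ultimately have "fls_subdegree w = 0" using u by (metis add_0 fls_subdegree_mult)
      moreover have "FX * fls_deriv (xgerm p) = FX * (FY * w)" using rel w1 by algebra
      then have "fls_deriv (xgerm p) = FY * w" using u(2) mult_cancel_left by blast
      ultimately show ?thesis using w1 \<open>w \<noteq> 0\<close> 1 by (intro exI[of _ w]) simp
    qed
  next
    case (2 u y z)
    have oc: "1 + (y $ 0) ^ 4 + a * (y $ 0) ^ 2 = 0" and z: "z $ 0 = 0" "z $ 1 \<noteq> 0"
      using 2(1) by (auto simp: infinite_arc_def)
    define Z where "Z = fps_to_fls z"
    define Z' where "Z' = fps_to_fls (fps_deriv z)"
    have Z0: "Z \<noteq> 0" using 2 by (simp add: Z_def)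
    have sz: "subdegree z = 1" using z by (intro subdegreeI) auto
    define g where "g = 4 * y ^ 3 + 2 * fps_const a * y + 2 * fps_const b * y * z ^ 2"
    have "g $ 0 \<noteq> 0" using smooth_infinite[OF oc] by (simp add: g_def fps_nth_power_0 z)
    then have g: "fps_to_fls g \<noteq> 0" "fls_subdegree (fps_to_fls g) = 0"
      by (auto simp: fls_subdegree_fls_to_fps)
    have Z': "Z' \<noteq> 0" "fls_subdegree Z' = 0"
      using z unfolding Z'_def fls_subdegree_fls_to_fps by auto
    have dZ: "fls_deriv Z = Z'" by (simp add: Z_def Z'_def fls_deriv_fps_to_fls)
    have xiZ: "xgerm p * Z = 1" using 2 Z0 by (simp add: Z_def)
    have "fls_deriv (xgerm p * Z) = 0" unfolding xiZ by simp
    then have "fls_deriv (xgerm p) * Z = - xgerm p * Z'" by (simp add: dZ eq_neg_iff_add_eq_0 add.commute)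
    then have dxi: "fls_deriv (xgerm p) * Z ^ 2 = - Z'" using xiZ by algebra
    have FYg: "FY * Z ^ 3 = fps_to_fls g"
    proof -
      have "ygerm p * Z = fps_to_fls y" using 2 Z0 by (simp add: Z_def)
      moreover have "fps_to_fls g = 4 * fps_to_fls y ^ 3 + 2 * fls_const a * fps_to_fls y + 2 * fls_const b * fps_to_fls y * Z ^ 2"
        by (simp add: g_def Z_def fls_times_fps_to_fls fps_to_fls_power)
      moreover have "FY * Z ^ 3 = 4 * (ygerm p * Z) ^ 3 + 2 * fls_const a * (xgerm p * Z) ^ 2 * (ygerm p * Z)
          + 2 * fls_const b * (ygerm p * Z) * Z ^ 2"
        unfolding FY by algebra
      ultimately show ?thesis using xiZ by simp
    qed
    \<comment> \<open>From \<open>x = 1 / Z\<close> comes \<open>x' = - Z' / Z ^ 2\<close>, and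
      \<open>FY = g / Z ^ 3\<close> with a unit \<open>g\<close>; the quotient has the simple zero
      of \<open>Z\<close>.\<close>
    define w where "w = - Z' * Z / fps_to_fls g"
    have wg: "w * fps_to_fls g = - Z' * Z" using g by (simp add: w_def)
    have w0: "w \<noteq> 0" using wg Z' Z0 by auto
    have "FY * w * Z ^ 3 = w * (FY * Z ^ 3)" "fls_deriv (xgerm p) * Z ^ 3 = (fls_deriv (xgerm p) * Z ^ 2) * Z"
      by algebra+
    then have "FY * w * Z ^ 3 = fls_deriv (xgerm p) * Z ^ 3" unfolding FYg wg dxi by simp
    then have w1: "fls_deriv (xgerm p) = FY * w" using Z0 by simp
    have "FY \<noteq> 0" using FYg g by auto
    moreover have "FY * fls_deriv (ygerm p) = FY * (- FX * w)" using rel w1 by algebra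
    ultimately have w2: "fls_deriv (ygerm p) = - FX * w" using mult_cancel_left by blast
    have "fls_subdegree (w * fps_to_fls g) = fls_subdegree (Z' * Z)" unfolding wg by simp
    then have "fls_subdegree w = fls_subdegree Z" using w0 g Z' Z0 by simp
    moreover have "fls_subdegree (zgerm p) = fls_subdegree Z"
    proof -
      have "fps_to_fls u \<noteq> 0" "fls_subdegree (fps_to_fls u) = 0"
        using 2 by (auto simp: fls_subdegree_fls_to_fps)
      then show ?thesis using 2 Z0 by (simp add: Z_def)
    qed
    ultimately show ?thesis using w0 w1 w2 by (intro exI[of _ w]) simp
  qed
  then show ?thesis by (simp add: FX_def FY_def)
qed


section \<open>The divisor of a rational differential\<close>

lemma affgerm_hom: "affgerm (G * H) p = affgerm G p * affgerm H p" "affgerm (G - H) p = affgerm G p - affgerm H p" "affgerm (G ^ n) p = affgerm G p ^ n"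
  by (simp_all add: affgerm_def eval3_hom)

lemma fls_deriv_quotient:
  fixes g h :: "complex fls"
  assumes "h \<noteq> 0"
  shows "fls_deriv (g / h) * h ^ 2 = h * fls_deriv g - g * fls_deriv h"
proof -
  have e: "g = (g / h) * h" using assms by simp
  have "fls_deriv g = fls_deriv (g / h) * h + (g / h) * fls_deriv h"
    by (subst e, subst fls_deriv_mult) (simp add: algebra_simps)
  then have "h * fls_deriv g = fls_deriv (g / h) * h ^ 2 + ((g / h) * h) * fls_deriv h"
    by algebra
  then show ?thesis using assms by simp
qed

text \<open>The numerator of \<open>d(G / H)\<close> after replacing \<open>dx\<close> and
  \<open>dy\<close> by \<open>F\<^sub>y\<close> and \<open>- F\<^sub>x\<close>, that is, after
  dividing by the differential \<open>dx / F\<^sub>y\<close>.\<close>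

definition wronskian_form :: "poly3 \<Rightarrow> poly3 \<Rightarrow> poly3" where
  "wronskian_form G H = dY F * (H * dX G - G * dX H) - dX F * (H * dY G - G * dY H)"

lemma homogeneous_wronskian_form:
  assumes "homogeneous (Suc d) G" "homogeneous (Suc d) H"
  shows "homogeneous (2 * Suc d + 2) (wronskian_form G H)"
proof -
  have F: "homogeneous 3 (dX F)" "homogeneous 3 (dY F)"
    using homogeneous_derivs[OF homogeneous_quartic[of a b]] by simp_all
  have "homogeneous (3 + (Suc d + d)) (wronskian_form G H)"
    unfolding wronskian_form_def
    by (rule homogeneous_diff homogeneous_mult F homogeneous_dX homogeneous_dY assms)+
  moreover have "3 + (Suc d + d) = 2 * Suc d + 2" by simp
  ultimately show ?thesis by (simp only:)
qed

lemma fls_deriv_affgerm: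
  assumes "p \<in> curve F" "fls_deriv (xgerm p) = affgerm (dY F) p * w" "fls_deriv (ygerm p) = - affgerm (dX F) p * w"
  shows "fls_deriv (affgerm G p) = (affgerm (dX G) p * affgerm (dY F) p - affgerm (dY G) p * affgerm (dX F) p) * w"
proof -
  have "fls_deriv (affgerm G p) = affgerm (dX G) p * fls_deriv (xgerm p) + affgerm (dY G) p * fls_deriv (ygerm p)"
    unfolding affgerm_def
    by (subst der_eval3[OF is_derivation_fls_deriv is_ring_hom_fls_const]) (simp_all add: vector_3)
  then show ?thesis unfolding assms(2,3) by algebra
qed

lemma quotient_germs_on_curve: "p \<in> curve F \<Longrightarrow> quotient_germs F G H p = germ G p / germ H p"
  by (simp add: quotient_germs_def germ_def)

text \<open>In affine coordinates the derivative of \<open>G / H\<close> is the Wronskian form over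
  \<open>H ^ 2\<close>, times a series \<open>w\<close> of the same order as \<open>z\<close>.
  Homogenizing leaves a quotient of forms with degrees \<open>2 * Suc d + 2\<close> and
  \<open>2 * Suc d + 1\<close>.\<close>

lemma differential_order:
  assumes p: "p \<in> curve F" and hG: "homogeneous (Suc d) G" and hH: "homogeneous (Suc d) H"
    and H0: "germ H p \<noteq> 0" and D0: "fls_deriv (germ G p / germ H p) \<noteq> 0"
  shows "germ (wronskian_form G H) p \<noteq> 0 \<and> fls_subdegree (fls_deriv (germ G p / germ H p)) =
    fls_subdegree (germ (wronskian_form G H) p) - fls_subdegree (germ (H ^ 2 * Z3) p)"
proof -
  obtain w where w: "w \<noteq> 0" "fls_subdegree w = fls_subdegree (zgerm p)"
    "fls_deriv (xgerm p) = affgerm (dY F) p * w" "fls_deriv (ygerm p) = - affgerm (dX F) p * w"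
    using uniformizing_differential[OF p] by blast
  have z: "zgerm p \<noteq> 0" by (rule zgerm_nonzero[OF p])
  have q: "germ G p / germ H p = affgerm G p / affgerm H p"
    using z by (simp add: germ_eq_affgerm[OF p hG] germ_eq_affgerm[OF p hH])
  have eH: "affgerm H p \<noteq> 0" using H0 by (auto simp: germ_eq_affgerm[OF p hH])
  have z3: "germ Z3 p = zgerm p"
    by (simp add: germ_def restrict_form_def zgerm_def)
  define J where "J = wronskian_form G H"
  have "fls_deriv (affgerm G p / affgerm H p) * affgerm H p ^ 2 = affgerm J p * w"
    unfolding fls_deriv_quotient[OF eH] fls_deriv_affgerm[OF p w(3,4)] J_def wronskian_form_def affgerm_hom
    by algebra
  moreover have rJ: "germ J p = zgerm p ^ (2 * Suc d + 2) * affgerm J p"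
    unfolding J_def by (rule germ_eq_affgerm[OF p homogeneous_wronskian_form[OF hG hH]])
  moreover have rH: "germ (H ^ 2 * Z3) p = zgerm p ^ (2 * Suc d + 1) * affgerm H p ^ 2"
    unfolding germ_hom germ_eq_affgerm[OF p hH] z3 mult_2 power_add power2_eq_square power_one_right
    by (simp only: mult_ac)
  ultimately have e: "fls_deriv (germ G p / germ H p) * germ (H ^ 2 * Z3) p * zgerm p = germ J p * w"
    unfolding q by (simp add: algebra_simps)
  have H2: "germ (H ^ 2 * Z3) p \<noteq> 0" unfolding rH using z eH by simp
  have "germ J p \<noteq> 0" using e D0 H2 z w(1) by auto
  moreover have "fls_subdegree (fls_deriv (germ G p / germ H p) * germ (H ^ 2 * Z3) p * zgerm p) = fls_subdegree (germ J p * w)"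
    unfolding e by simp
  ultimately show ?thesis
    using D0 H2 z w(1,2) unfolding J_def[symmetric] by simp
qed

lemma homogeneous_times_Z3: "homogeneous d G \<Longrightarrow> homogeneous (Suc d) (G * Z3)"
  using homogeneous_mult[OF _ homogeneous_Z3] by fastforce

lemma canonical_divisor_forms:
  assumes "canonical_divisor F K"
  obtains N M m where "homogeneous (Suc m) N" "homogeneous m M"
    "\<And>p. p \<in> curve F \<Longrightarrow> germ N p \<noteq> 0" "\<And>p. p \<in> curve F \<Longrightarrow> germ M p \<noteq> 0"
    "\<And>p. p \<in> curve F \<Longrightarrow> K p = fls_subdegree (germ N p) - fls_subdegree (germ M p)"
proof -
  obtain f g where f: "f \<in> function_field F" and g: "g \<in> function_field F"
    and nz: "\<And>p. p \<in> curve F \<Longrightarrow> f p * fls_deriv (g p) \<noteq> 0"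
    and K: "\<And>p. p \<in> curve F \<Longrightarrow> K p = fls_subdegree (f p * fls_deriv (g p))"
    using assms unfolding canonical_divisor_def by auto
  obtain A B e where A: "f = quotient_germs F A B" "homogeneous e A" "homogeneous e B"
    "\<And>p. p \<in> curve F \<Longrightarrow> germ B p \<noteq> 0"
    using f unfolding function_field_def germ_eq_0_iff by blast
  obtain G0 H0 d where G0: "g = quotient_germs F G0 H0" "homogeneous d G0" "homogeneous d H0"
    "\<And>p. p \<in> curve F \<Longrightarrow> germ H0 p \<noteq> 0"
    using g unfolding function_field_def germ_eq_0_iff by blast
  \<comment> \<open>The common factor \<open>Z3\<close> leaves the quotient unchanged and makes the
    degree positive, so that the partial derivatives have degree \<open>d\<close>.\<close>
  define G H where "G = G0 * Z3" and "H = H0 * Z3"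
  have hG: "homogeneous (Suc d) G" "homogeneous (Suc d) H"
    using homogeneous_times_Z3 G0 by (auto simp: G_def H_def)
  have Z: "germ Z3 p \<noteq> 0" if "p \<in> curve F" for p
    using zgerm_nonzero[OF that] by (simp add: germ_def restrict_form_def zgerm_def)
  have H0: "germ H p \<noteq> 0" if "p \<in> curve F" for p
    using G0(4)[OF that] Z[OF that] by (simp add: H_def germ_hom)
  have gp: "g p = germ G p / germ H p" if "p \<in> curve F" for p
    using Z[OF that] by (simp add: G0(1) quotient_germs_on_curve[OF that] G_def H_def germ_hom)
  have fp: "f p = germ A p / germ B p" if "p \<in> curve F" for p
    by (simp add: A(1) quotient_germs_on_curve[OF that])
  define J where "J = wronskian_form G H"
  show ?thesis
  proof (rule that[of "e + (2 * Suc d + 1)" "A * J" "B * (H ^ 2 * Z3)"])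
    have "homogeneous (e + (2 * Suc d + 2)) (A * J)"
      unfolding J_def by (intro homogeneous_mult A homogeneous_wronskian_form hG)
    then show "homogeneous (Suc (e + (2 * Suc d + 1))) (A * J)" by simp
    show "homogeneous (e + (2 * Suc d + 1)) (B * (H ^ 2 * Z3))"
      by (intro homogeneous_mult A homogeneous_power hG homogeneous_Z3)
    fix p assume p: "p \<in> curve F"
    have "fls_deriv (germ G p / germ H p) \<noteq> 0" using nz[OF p] by (simp add: gp[OF p])
    note d = differential_order[OF p hG H0[OF p] this, folded J_def]
    have A0: "germ A p \<noteq> 0" using nz[OF p] by (auto simp: fp[OF p])
    show "germ (A * J) p \<noteq> 0" using A0 d by (simp add: germ_hom)
    have H2: "germ (H ^ 2 * Z3) p \<noteq> 0" using H0[OF p] Z[OF p] by (simp add: germ_hom)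
    show "germ (B * (H ^ 2 * Z3)) p \<noteq> 0" using H2 A(4)[OF p] by (simp add: germ_hom(1))
    have "fls_subdegree (f p * fls_deriv (g p)) = fls_subdegree (f p) + fls_subdegree (fls_deriv (g p))"
      using nz[OF p] by simp
    also have "fls_subdegree (f p) = fls_subdegree (germ A p) - fls_subdegree (germ B p)"
      unfolding fp[OF p] using A0 A(4)[OF p] by (simp add: fls_divide_subdegree)
    finally show "K p = fls_subdegree (germ (A * J) p) - fls_subdegree (germ (B * (H ^ 2 * Z3)) p)"
      using A0 A(4)[OF p] d H2 unfolding K[OF p] gp[OF p] germ_hom(1)[of A] germ_hom(1)[of B] by simp
  qed
qed


section \<open>The spaces \<open>L(K - n p)\<close> as spaces of linear forms\<close>

definition canonical_map :: "poly3 \<Rightarrow> poly3 \<Rightarrow> complex ^ 3 \<Rightarrow> germs" where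
  "canonical_map N M c = quotient_germs F (linear_form c * M) N"

lemma germ_linear_add: "germ (linear_form (c + d)) p = germ (linear_form c) p + germ (linear_form d) p"
  by (simp add: germ_def lin_add)

lemma germ_linear_scale: "germ (linear_form (k *s c)) p = fls_const k * germ (linear_form c) p"
  by (simp add: germ_def lin_scale fls_times_fps_to_fls)

lemma canonical_map_apply:
  "canonical_map N M c p = (if p \<in> curve F then germ (linear_form c) p * germ M p / germ N p else 0)"
  unfolding canonical_map_def quotient_germs_def by (simp add: germ_hom(1)[unfolded germ_def] germ_def)

lemma linear_canonical_map: "Vector_Spaces.linear (*s) germ_scale (canonical_map N M)"
  unfolding Vector_Spaces.linear_iff
  by (simp add: fun_eq_iff canonical_map_apply germ_linear_add germ_linear_scale germ_scale_def
      vec.vector_space_axioms vector_space_germs add_divide_distrib distrib_right)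

lemma vanishing_iff_subdegree:
  "c \<in> vanishing p n \<longleftrightarrow> germ (linear_form c) p = 0 \<or> fls_subdegree (germ (linear_form c) p) \<ge> int n"
proof (cases "lin p c = 0")
  case False
  have "c \<in> vanishing p n \<longleftrightarrow> n \<le> subdegree (lin p c)"
  proof
    assume "c \<in> vanishing p n"
    then show "n \<le> subdegree (lin p c)"
      using False by (intro subdegree_geI) (auto simp: vanishing_def)
  next
    assume "n \<le> subdegree (lin p c)"
    then show "c \<in> vanishing p n" by (auto simp: vanishing_def intro!: nth_less_subdegree_zero)
  qed
  then show ?thesis using False by (simp add: germ_def fls_subdegree_fls_to_fps)
qed (simp add: germ_def vanishing_def)

text \<open>For \<open>\<phi> = G / H\<close> in the space, \<open>\<phi> * N / M\<close> has no
  poles, and \<open>max_noether\<close> with \<open>R = G * N\<close> and \<open>S = H * M\<close>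
  makes it a linear form. Multiplication by \<open>N / M\<close> adds \<open>K\<close>, so the
  condition at \<open>p\<close> becomes order at least \<open>n\<close> of that form.\<close>

lemma riemann_roch_space_canonical:
  assumes hN: "homogeneous (Suc m) N" and hM: "homogeneous m M"
    and N0: "\<And>p. p \<in> curve F \<Longrightarrow> germ N p \<noteq> 0" and M0: "\<And>p. p \<in> curve F \<Longrightarrow> germ M p \<noteq> 0"
    and K: "\<And>p. p \<in> curve F \<Longrightarrow> K p = fls_subdegree (germ N p) - fls_subdegree (germ M p)"
    and p: "p \<in> curve F"
  shows "riemann_roch_space F (sub_multiple K n p) = canonical_map N M ` vanishing p n"
proof (intro subset_antisym subsetI)
  fix \<phi> assume \<phi>: "\<phi> \<in> riemann_roch_space F (sub_multiple K n p)"
  then have "\<phi> \<in> function_field F"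
    and ord: "\<And>q. q \<in> curve F \<Longrightarrow> \<phi> q = 0 \<or> fls_subdegree (\<phi> q) + sub_multiple K n p q \<ge> 0"
    by (auto simp: riemann_roch_space_def)
  then obtain G H d where G: "\<phi> = quotient_germs F G H" "homogeneous d G" "homogeneous d H"
    "\<And>q. q \<in> curve F \<Longrightarrow> germ H q \<noteq> 0"
    unfolding function_field_def germ_eq_0_iff by blast
  have \<phi>q: "\<phi> q = germ G q / germ H q" if "q \<in> curve F" for q
    by (simp add: G(1) quotient_germs_on_curve[OF that])
  have e: "germ (G * N) q / germ (H * M) q = \<phi> q * (germ N q / germ M q)" if "q \<in> curve F" for q
    by (simp add: \<phi>q[OF that] germ_hom)
  have sub: "fls_subdegree (\<phi> q * (germ N q / germ M q)) = fls_subdegree (\<phi> q) + K q"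
    if "q \<in> curve F" "\<phi> q \<noteq> 0" for q
    using N0[OF that(1)] M0[OF that(1)] that(2) K[OF that(1)] by (simp add: divide_inverse)
  have "\<exists>c. \<forall>q\<in>curve F. germ (G * N) q = germ (linear_form c) q * germ (H * M) q"
  proof (rule max_noether)
    have "homogeneous (d + Suc m) (G * N)" by (intro homogeneous_mult G hN)
    then show "homogeneous (Suc (d + m)) (G * N)" by simp
    show "homogeneous (d + m) (H * M)" by (intro homogeneous_mult G hM)
    fix q assume q: "q \<in> curve F"
    show "germ (H * M) q \<noteq> 0" using G(4)[OF q] M0[OF q] by (simp add: germ_hom)
    show "0 \<le> fls_subdegree (germ (G * N) q / germ (H * M) q)"
      unfolding e[OF q] using ord[OF q] sub[OF q]
      by (cases "\<phi> q = 0") (auto simp: sub_multiple_def split: if_splits)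
  qed
  then obtain c where c: "\<And>q. q \<in> curve F \<Longrightarrow> germ (G * N) q = germ (linear_form c) q * germ (H * M) q"
    by blast
  have lc: "germ (linear_form c) q = \<phi> q * (germ N q / germ M q)" if "q \<in> curve F" for q
    using c[OF that] G(4)[OF that] M0[OF that] unfolding e[OF that, symmetric] by (simp add: germ_hom)
  have "\<phi> = canonical_map N M c"
  proof
    fix q
    show "\<phi> q = canonical_map N M c q"
      using lc[of q] N0[of q] M0[of q]
      by (cases "q \<in> curve F") (simp_all add: canonical_map_apply G(1) quotient_germs_def)
  qed
  moreover have "c \<in> vanishing p n"
    unfolding vanishing_iff_subdegree lc[OF p] using ord[OF p] sub[OF p]
    by (cases "\<phi> p = 0") (auto simp: sub_multiple_def)
  ultimately show "\<phi> \<in> canonical_map N M ` vanishing p n" by blast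
next
  fix \<phi> assume "\<phi> \<in> canonical_map N M ` vanishing p n"
  then obtain c where c: "\<phi> = canonical_map N M c" "c \<in> vanishing p n" by blast
  have "homogeneous (Suc m) (linear_form c * M)"
    using homogeneous_mult[OF homogeneous_linear_form hM] by simp
  then have ff: "\<phi> \<in> function_field F"
    unfolding function_field_def c(1) canonical_map_def
    using hN N0 by (auto simp: germ_eq_0_iff)
  have "\<phi> q = 0 \<or> fls_subdegree (\<phi> q) + sub_multiple K n p q \<ge> 0" if q: "q \<in> curve F" for q
  proof (cases "germ (linear_form c) q = 0")
    case True
    then show ?thesis by (simp add: c(1) canonical_map_apply)
  next
    case False
    have "fls_subdegree (\<phi> q) = fls_subdegree (germ (linear_form c) q) - K q"
      using False N0[OF q] M0[OF q] q K[OF q] by (simp add: c(1) canonical_map_apply divide_inverse)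
    moreover have "fls_subdegree (germ (linear_form c) q) \<ge> 0"
      unfolding germ_def by (rule fls_subdegree_fls_to_fps_gt0)
    moreover have "fls_subdegree (germ (linear_form c) p) \<ge> int n" if "q = p"
      using c(2) False that unfolding vanishing_iff_subdegree by simp
    ultimately show ?thesis by (auto simp: sub_multiple_def)
  qed
  then show "\<phi> \<in> riemann_roch_space F (sub_multiple K n p)"
    using ff by (simp add: riemann_roch_space_def)
qed

text \<open>Injectivity is tested at the single point \<open>p\<close>: a linear form with zero
  expansion there is zero.\<close>

lemma ldim_canonical:
  assumes K: "canonical_divisor F K" and p: "p \<in> curve F"
  shows "ldim F (sub_multiple K n p) = vec.dim (vanishing p n)"
proof -
  obtain N M m where NM: "homogeneous (Suc m) N" "homogeneous m M"
    "\<And>p. p \<in> curve F \<Longrightarrow> germ N p \<noteq> 0" "\<And>p. p \<in> curve F \<Longrightarrow> germ M p \<noteq> 0"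
    "\<And>p. p \<in> curve F \<Longrightarrow> K p = fls_subdegree (germ N p) - fls_subdegree (germ M p)"
    using canonical_divisor_forms[OF K] by metis
  have "inj (canonical_map N M)"
  proof (rule injI)
    fix c d assume e: "canonical_map N M c = canonical_map N M d"
    have "canonical_map N M c p = canonical_map N M d p" unfolding e ..
    then have "germ (linear_form c) p = germ (linear_form d) p"
      using p NM(3,4)[OF p] by (simp add: canonical_map_apply)
    then have "lin p (c + - d) = 0"
      using lin_add[of p d "c + - d"] by (simp add: germ_def)
    then show "c = d" using lin_eq_0_iff[OF p] by simp
  qed
  then have "inj_on (canonical_map N M) (vec.span (vanishing p n))"
    by (rule inj_on_subset) simp
  then have "germs.dim (canonical_map N M ` vanishing p n) = vec.dim (vanishing p n)"
    by (rule cvec.dim_image_eq[OF linear_canonical_map])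
  moreover have "riemann_roch_space F (sub_multiple K n p) = canonical_map N M ` vanishing p n"
    by (rule riemann_roch_space_canonical[OF NM(1,2)]) (use NM p in simp_all)
  ultimately show ?thesis by (simp add: ldim_def)
qed

text \<open>Nested subspaces have different dimensions iff they differ, and a drop from
  \<open>m\<close> to \<open>Suc m\<close> is the gap \<open>Suc m\<close>; hence gaps are the
  attained orders plus one.\<close>

lemma one_gaps_canonical:
  assumes K: "canonical_divisor F K" and p: "p \<in> curve F"
  shows "one_gaps F K p = {1, 2, Suc (the_enat (tangent_mult p))}"
proof -
  have I: "tangent_mult p = enat (the_enat (tangent_mult p))"
    using tangent_mult_range[OF p] by (auto simp: numeral_eq_enat)
  have iff: "ldim F (sub_multiple K (Suc m) p) < ldim F (sub_multiple K m p) \<longleftrightarrow>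
      m = 0 \<or> m = 1 \<or> m = the_enat (tangent_mult p)" for m
  proof -
    have sub: "vanishing p (Suc m) \<subseteq> vanishing p m" by (rule vanishing_antimono) simp
    have "vec.dim (vanishing p (Suc m)) < vec.dim (vanishing p m) \<longleftrightarrow> vanishing p (Suc m) \<noteq> vanishing p m"
    proof
      assume "vanishing p (Suc m) \<noteq> vanishing p m"
      then have "vanishing p (Suc m) \<subset> vanishing p m" using sub by blast
      then show "vec.dim (vanishing p (Suc m)) < vec.dim (vanishing p m)"
        using subspace_vanishing by (intro vec.dim_psubset) (metis vec.span_eq_iff)
    qed auto
    also have "\<dots> \<longleftrightarrow> m = 0 \<or> m = 1 \<or> m = the_enat (tangent_mult p)"
      unfolding vanishing_strict_iff[OF p] using I by (metis enat.inject)
    finally show ?thesis unfolding ldim_canonical[OF K p] .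
  qed
  have "n \<in> one_gaps F K p \<longleftrightarrow> n \<in> {1, 2, Suc (the_enat (tangent_mult p))}" for n
  proof (cases n)
    case (Suc m)
    then show ?thesis using iff[of m] by (auto simp: one_gaps_def)
  qed (auto simp: one_gaps_def)
  then show ?thesis by blast
qed

lemma flexes_iff: "p \<in> flexes F \<longleftrightarrow> p \<in> curve F \<and> tangent_mult p \<ge> 3"
  by (simp add: flexes_def tangent_mult_def)

lemma one_weierstrass_points_canonical:
  assumes K: "canonical_divisor F K"
  shows "one_weierstrass_points F K = flexes F"
proof -
  have "one_weight F K p > 0 \<longleftrightarrow> tangent_mult p \<ge> 3" if p: "p \<in> curve F" for p
  proof -
    obtain I where I: "tangent_mult p = enat I" "I = 2 \<or> I = 3 \<or> I = 4"
      using tangent_mult_range[OF p] by (auto simp: numeral_eq_enat)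
    have "sorted [1, 2, Suc I]" "distinct [1, 2, Suc I]" using I(2) by auto
    then have "sorted_list_of_set (set [1, 2, Suc I]) = [1, 2, Suc I]"
      by (rule sorted_list_of_set.idem_if_sorted_distinct)
    \<comment> \<open>The first two gaps contribute nothing, the third
      \<open>(I + 1) - 3\<close>.\<close>
    then have "one_weight F K p = int I - 2"
      by (simp add: one_weight_def one_gaps_canonical[OF K p] I(1) numeral_3_eq_3)
    moreover have "tangent_mult p \<ge> 3 \<longleftrightarrow> I \<ge> 3" unfolding I(1) numeral_eq_enat by simp
    moreover have "0 < int I - 2 \<longleftrightarrow> I \<ge> 3" by linarith
    ultimately show ?thesis by (simp only:)
  qed
  then show ?thesis unfolding one_weierstrass_points_def by (intro Set.set_eqI) (simp add: flexes_iff cong: conj_cong)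
qed

lemma ordinary_flexes_iff: "p \<in> ordinary_flexes F \<longleftrightarrow> p \<in> curve F \<and> tangent_mult p = 3"
  unfolding ordinary_flexes_def mem_Collect_eq flexes_iff tangent_mult_def[symmetric] by auto

lemma hyperflexes_iff: "p \<in> hyperflexes F \<longleftrightarrow> p \<in> curve F \<and> tangent_mult p = 4"
proof -
  have "(3 :: enat) \<le> 4" by (simp add: numeral_eq_enat)
  then show ?thesis
    unfolding hyperflexes_def mem_Collect_eq flexes_iff tangent_mult_def[symmetric] by auto
qed

lemma flexes_split: "flexes F = ordinary_flexes F \<union> hyperflexes F"
proof (rule Set.set_eqI)
  fix p
  have "(3 :: enat) \<le> 4" "\<not> (3 :: enat) \<le> 2" by (simp_all add: numeral_eq_enat)
  then have "p \<in> curve F \<Longrightarrow> 3 \<le> tangent_mult p \<longleftrightarrow> tangent_mult p = 3 \<or> tangent_mult p = 4"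
    using tangent_mult_range[of p] by auto
  then show "p \<in> flexes F \<longleftrightarrow> p \<in> ordinary_flexes F \<union> hyperflexes F"
    by (auto simp: flexes_iff ordinary_flexes_iff hyperflexes_iff)
qed

end

section \<open>Orbits\<close>

lemma image_proj_point: "(\<lambda>v. A *v v) ` proj_point v = proj_point (A *v v)"
proof -
  have "proj_point w = (\<lambda>c. c *s w) ` {c. c \<noteq> 0}" for w by (auto simp: proj_point_def)
  then show ?thesis by (simp add: image_image vector_scalar_commute)
qed

lemma sigma1_mult: "sigma1 *v v = vector [v $v 2, v $v 1, v $v 3]"
  and tau1_mult: "tau1 *v v = vector [v $v 2, - (v $v 1), v $v 3]"
  by (simp_all add: sigma1_def tau1_def matrix_vector_mult_def vector3_eq_iff sum_3 vector_3)

definition sigma_act :: "ppoint \<Rightarrow> ppoint" where "sigma_act = proj_map sigma1"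
definition tau_act :: "ppoint \<Rightarrow> ppoint" where "tau_act = proj_map tau1"

lemma sigma_act_proj_point: "v \<noteq> 0 \<Longrightarrow> sigma_act (proj_point v) = proj_point (vector [v $v 2, v $v 1, v $v 3])"
  and tau_act_proj_point: "v \<noteq> 0 \<Longrightarrow> tau_act (proj_point v) = proj_point (vector [v $v 2, - (v $v 1), v $v 3])"
  by (simp_all add: sigma_act_def tau_act_def proj_map_def P2_def image_proj_point flip: sigma1_mult tau1_mult)

lemma sigma_act_P2: "p \<in> P2 \<Longrightarrow> sigma_act p \<in> P2" and sigma_act_involution: "p \<in> P2 \<Longrightarrow> sigma_act (sigma_act p) = p"
proof -
  assume "p \<in> P2"
  then obtain v where v: "v \<noteq> 0" "p = proj_point v" by (auto simp: P2_def)
  have w: "vector [v $v 2, v $v 1, v $v 3] \<noteq> (0 :: complex ^ 3)"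
    using v(1) by (auto simp: vector3_eq_iff vector_3)
  show "sigma_act p \<in> P2"
    using w unfolding v(2) sigma_act_proj_point[OF v(1)] by (auto simp: P2_def)
  show "sigma_act (sigma_act p) = p"
    unfolding v(2) sigma_act_proj_point[OF v(1)] sigma_act_proj_point[OF w] by (simp add: vector_3 vector3_eta)
qed

lemma tau_act_P2: "p \<in> P2 \<Longrightarrow> tau_act p \<in> P2" and tau_act_order_4: "p \<in> P2 \<Longrightarrow> tau_act (tau_act (tau_act (tau_act p))) = p"
proof -
  assume "p \<in> P2"
  then obtain v where v: "v \<noteq> 0" "p = proj_point v" by (auto simp: P2_def)
  have ne: "vector [x, y, z] = (0 :: complex ^ 3) \<longleftrightarrow> x = 0 \<and> y = 0 \<and> z = 0" for x y z
    by (auto simp: vector3_eq_iff vector_3)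
  have v0: "v $v 1 = 0 \<Longrightarrow> v $v 2 = 0 \<Longrightarrow> v $v 3 \<noteq> 0"
    using v(1) by (auto simp: vector3_eq_iff)
  then have w: "vector [v $v 2, - (v $v 1), v $v 3] \<noteq> (0 :: complex ^ 3)" by (auto simp: ne)
  show "tau_act p \<in> P2"
    using w unfolding v(2) tau_act_proj_point[OF v(1)] by (auto simp: P2_def)
  have "tau_act (tau_act (tau_act (tau_act p))) = proj_point (vector [v $v 1, v $v 2, v $v 3])"
    unfolding v(2) using v0 by (auto simp: tau_act_proj_point ne v(1) vector_3)
  then show "tau_act (tau_act (tau_act (tau_act p))) = p" by (simp add: v(2) vector3_eta)
qed

lemma sigma_act_Bij: "sigma_act \<in> Bij P2"
proof -
  have "bij_betw sigma_act P2 P2"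
    by (rule bij_betw_byWitness[where f' = sigma_act]) (auto simp: sigma_act_P2 sigma_act_involution)
  then show ?thesis by (simp add: Bij_def sigma_act_def proj_map_def)
qed

lemma tau_act_Bij: "tau_act \<in> Bij P2"
proof -
  have "bij_betw tau_act P2 P2"
    by (rule bij_betw_byWitness[where f' = "\<lambda>p. tau_act (tau_act (tau_act p))"]) (auto simp: tau_act_P2 tau_act_order_4)
  then show ?thesis by (simp add: Bij_def tau_act_def proj_map_def)
qed

lemma carrier_G1: "carrier G1 = generate (BijGroup P2) {sigma_act, tau_act}"
  by (simp add: G1_def sigma_act_def tau_act_def)

lemma BijGroup_mult: "g \<in> Bij S \<Longrightarrow> h \<in> Bij S \<Longrightarrow> g \<otimes>\<^bsub>BijGroup S\<^esub> h = compose S g h"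
  by (simp add: BijGroup_def)

text \<open>Invariance of \<open>S\<close> is an equivalence, not an implication, so that it passes
  to inverses; membership in \<open>Bij P2\<close> is carried along to unfold the products.\<close>

lemma G1_invariant:
  assumes g: "g \<in> carrier G1"
    and S: "\<And>p. p \<in> P2 \<Longrightarrow> sigma_act p \<in> S \<longleftrightarrow> p \<in> S" "\<And>p. p \<in> P2 \<Longrightarrow> tau_act p \<in> S \<longleftrightarrow> p \<in> S"
  shows "g \<in> Bij P2 \<and> (\<forall>p\<in>P2. g p \<in> S \<longleftrightarrow> p \<in> S)"
  using g unfolding carrier_G1
proof (induction rule: generate.induct)
  case one
  have 1: "\<one>\<^bsub>BijGroup P2\<^esub> = (\<lambda>p\<in>P2. p)" by (simp add: BijGroup_def)
  show ?case unfolding 1 by (intro conjI ballI id_Bij) simp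
next
  case (incl h)
  then show ?case using S sigma_act_Bij tau_act_Bij by auto
next
  case (inv h)
  then have h: "h \<in> Bij P2" "\<forall>p\<in>P2. h p \<in> S \<longleftrightarrow> p \<in> S" using S sigma_act_Bij tau_act_Bij by auto
  have e: "inv\<^bsub>BijGroup P2\<^esub> h = (\<lambda>x\<in>P2. inv_into P2 h x)" using h(1) by (rule inv_BijGroup)
  have iff: "inv_into P2 h p \<in> S \<longleftrightarrow> p \<in> S" if p: "p \<in> P2" for p
  proof -
    have "bij_betw h P2 P2" using h(1) by (simp add: Bij_def)
    then have "p \<in> h ` P2" using p by (simp add: bij_betw_def)
    then have "inv_into P2 h p \<in> P2" "h (inv_into P2 h p) = p"
      by (rule inv_into_into, rule f_inv_into_f)
    then show ?thesis using h(2) by metis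
  qed
  show ?case unfolding e by (intro conjI ballI restrict_inv_into_Bij h(1)) (simp add: iff)
next
  case (eng g h)
  then have *: "g \<in> Bij P2" "h \<in> Bij P2" by auto
  then have "h p \<in> P2" if "p \<in> P2" for p
    using Bij_imp_funcset that by blast
  then have "\<forall>p\<in>P2. compose P2 g h p \<in> S \<longleftrightarrow> p \<in> S"
    using eng.IH by (simp add: compose_eq)
  then show ?case
    unfolding BijGroup_mult[OF *] using compose_Bij[OF *] by blast
qed

abbreviation G1_orbit :: "ppoint \<Rightarrow> ppoint set" where
  "G1_orbit \<equiv> orbit G1 (\<lambda>g. g)"

lemma orbit_self: "p \<in> P2 \<Longrightarrow> p \<in> G1_orbit p"
proof -
  assume p: "p \<in> P2"
  have "(\<lambda>q\<in>P2. q) \<in> carrier G1"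
    unfolding carrier_G1 using generate.one[of "BijGroup P2" "{sigma_act, tau_act}"] by (simp add: BijGroup_def)
  then show ?thesis
    unfolding orbit_def using p by (intro CollectI exI[of _ "\<lambda>q\<in>P2. q"]) simp
qed

lemma orbit_sigma_tau:
  assumes "p \<in> P2" "q \<in> G1_orbit p"
  shows "sigma_act q \<in> G1_orbit p" "tau_act q \<in> G1_orbit p"
proof -
  obtain g where g: "g \<in> carrier G1" "q = g p" using assms(2) by (auto simp: orbit_def)
  have "g \<in> Bij P2" using G1_invariant[OF g(1), of UNIV] by simp
  then have "sigma_act \<otimes>\<^bsub>BijGroup P2\<^esub> g = compose P2 sigma_act g" "tau_act \<otimes>\<^bsub>BijGroup P2\<^esub> g = compose P2 tau_act g"
    using sigma_act_Bij tau_act_Bij by (simp_all add: BijGroup_mult)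
  moreover have "sigma_act \<otimes>\<^bsub>BijGroup P2\<^esub> g \<in> carrier G1" "tau_act \<otimes>\<^bsub>BijGroup P2\<^esub> g \<in> carrier G1"
    using g(1) unfolding carrier_G1 by (auto intro: generate.eng generate.incl)
  moreover have "compose P2 sigma_act g p = sigma_act q" "compose P2 tau_act g p = tau_act q"
    using assms(1) g(2) by (simp_all add: compose_def)
  ultimately show "sigma_act q \<in> G1_orbit p" "tau_act q \<in> G1_orbit p"
    unfolding orbit_def by auto
qed

section \<open>The action on affine points\<close>

definition apoint :: "complex \<Rightarrow> complex \<Rightarrow> ppoint" where
  "apoint x y = proj_point (vector [x, y, 1])"

lemma apoint_eq_iff: "apoint x y = apoint x' y' \<longleftrightarrow> x = x' \<and> y = y'"
  unfolding apoint_def by (rule affine_point_eq_iff)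

lemma apoint_P2: "apoint x y \<in> P2"
  unfolding apoint_def P2_def by (intro imageI) (auto simp: vector3_eq_iff vector_3)

lemma sigma_act_apoint: "sigma_act (apoint x y) = apoint y x" and tau_act_apoint: "tau_act (apoint x y) = apoint y (- x)"
proof -
  have "vector [x, y, 1] \<noteq> (0 :: complex ^ 3)" by (auto simp: vector3_eq_iff vector_3)
  then show "sigma_act (apoint x y) = apoint y x" "tau_act (apoint x y) = apoint y (- x)"
    by (simp_all add: apoint_def sigma_act_proj_point tau_act_proj_point vector_3)
qed

text \<open>The two products of the generators are the sign changes of a single coordinate.\<close>

lemma G1_moves:
  assumes "apoint x y \<in> G1_orbit p" "p \<in> P2"
  shows "apoint y x \<in> G1_orbit p" "apoint (- x) y \<in> G1_orbit p" "apoint x (- y) \<in> G1_orbit p"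
proof -
  note s = orbit_sigma_tau(1)[OF assms(2)] and t = orbit_sigma_tau(2)[OF assms(2)]
  show "apoint y x \<in> G1_orbit p" using s[OF assms(1)] by (simp add: sigma_act_apoint)
  show "apoint (- x) y \<in> G1_orbit p" using s[OF t[OF assms(1)]] by (simp add: sigma_act_apoint tau_act_apoint)
  show "apoint x (- y) \<in> G1_orbit p" using t[OF s[OF assms(1)]] by (simp add: sigma_act_apoint tau_act_apoint)
qed

context smooth_quartic
begin

section \<open>Orbits as fibres of \<open>x ^ 2 + y ^ 2\<close>\<close>

definition fibre :: "complex \<Rightarrow> ppoint set" where
  "fibre s = {apoint x y | x y. on_curve x y \<and> x ^ 2 + y ^ 2 = s}"

lemma apoint_fibre_iff: "apoint x y \<in> fibre s \<longleftrightarrow> on_curve x y \<and> x ^ 2 + y ^ 2 = s"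
  by (auto simp: fibre_def apoint_eq_iff)

lemma fibre_P2: "fibre s \<subseteq> P2"
  by (auto simp: fibre_def apoint_P2)

lemma sigma_act_fibre: "p \<in> fibre s \<Longrightarrow> sigma_act p \<in> fibre s"
  by (auto simp: fibre_def sigma_act_apoint apoint_eq_iff algebra_simps)

lemma tau_act_fibre: "p \<in> fibre s \<Longrightarrow> tau_act p \<in> fibre s"
  by (auto simp: fibre_def tau_act_apoint apoint_eq_iff algebra_simps)

text \<open>For fixed \<open>s\<close> the equation is linear in \<open>x ^ 2 * y ^ 2\<close> with
  coefficient \<open>a - 2\<close>, so sum and product of the two squares are determined, hence the
  squares up to order.\<close>

lemma on_curve_same_s:
  assumes "on_curve x y" "on_curve x' y'" "x' ^ 2 + y' ^ 2 = x ^ 2 + y ^ 2"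
  shows "(x' = x \<or> x' = - x) \<and> (y' = y \<or> y' = - y) \<or> (x' = y \<or> x' = - y) \<and> (y' = x \<or> y' = - x)"
proof -
  have "(a - 2) * (x' ^ 2 * y' ^ 2 - x ^ 2 * y ^ 2) = 0" using assms by algebra
  then have "x' ^ 2 * y' ^ 2 = x ^ 2 * y ^ 2" using a_ne2 by simp
  then have "(x' ^ 2 - x ^ 2) * (x' ^ 2 - y ^ 2) = 0" using assms(3) by algebra
  then have "x' ^ 2 = x ^ 2 \<or> x' ^ 2 = y ^ 2" by simp
  then show ?thesis
  proof
    assume x: "x' ^ 2 = x ^ 2"
    then have "y' ^ 2 = y ^ 2" using assms(3) by simp
    then show ?thesis using x by (simp add: power2_eq_iff)
  next
    assume x: "x' ^ 2 = y ^ 2"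
    then have "y' ^ 2 = x ^ 2" using assms(3) by (simp add: algebra_simps)
    then show ?thesis using x by (simp add: power2_eq_iff)
  qed
qed

lemma orbit_fibre:
  assumes "p \<in> fibre s"
  shows "G1_orbit p = fibre s"
proof
  have p: "p \<in> P2" using assms fibre_P2 by blast
  have sigma_act: "sigma_act q \<in> fibre s \<longleftrightarrow> q \<in> fibre s" if "q \<in> P2" for q
    using sigma_act_fibre[of q s] sigma_act_fibre[of "sigma_act q" s] sigma_act_involution[OF that] by auto
  have tau_act: "tau_act q \<in> fibre s \<longleftrightarrow> q \<in> fibre s" if "q \<in> P2" for q
    using tau_act_fibre[of q s] tau_act_fibre[of "tau_act q" s] tau_act_fibre[of "tau_act (tau_act q)" s] tau_act_fibre[of "tau_act (tau_act (tau_act q))" s] tau_act_order_4[OF that] by auto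
  show "G1_orbit p \<subseteq> fibre s"
    using G1_invariant[OF _ sigma_act tau_act] p assms by (auto simp: orbit_def)
  show "fibre s \<subseteq> G1_orbit p"
  proof
    fix q assume "q \<in> fibre s"
    then obtain x' y' where q: "q = apoint x' y'" "on_curve x' y'" "x' ^ 2 + y' ^ 2 = s" by (auto simp: fibre_def)
    obtain x y where xy: "p = apoint x y" "on_curve x y" "x ^ 2 + y ^ 2 = s" using assms by (auto simp: fibre_def)
    have 0: "apoint x y \<in> G1_orbit p" using orbit_self[OF p] xy(1) by simp
    note m = G1_moves[OF _ p]
    have "apoint (- x) y \<in> G1_orbit p" "apoint x (- y) \<in> G1_orbit p" "apoint (- x) (- y) \<in> G1_orbit p"
      using m(2)[OF 0] m(3)[OF 0] m(3)[OF m(2)[OF 0]] by auto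
    then have 4: "apoint u v \<in> G1_orbit p" if "u = x \<or> u = - x" "v = y \<or> v = - y" for u v
      using 0 that by auto
    show "q \<in> G1_orbit p"
      unfolding q(1) using on_curve_same_s[OF xy(2) q(2)] q(3) xy(3) 4[of x' y'] m(1)[OF 4, of y' x'] by auto
  qed
qed

text \<open>The values of \<open>x\<^sup>2 + y\<^sup>2\<close> at the points with \<open>x y = 0\<close> and with \<open>x\<^sup>2 = y\<^sup>2\<close>, respectively.\<close>

definition special :: "complex \<Rightarrow> bool" where
  "special s \<longleftrightarrow> s ^ 2 + b * s + 1 = 0 \<or> (a + 2) * s ^ 2 + 4 * b * s + 4 = 0"

lemma generic_iff:
  assumes "on_curve x y"
  shows "generic x y \<longleftrightarrow> \<not> special (x ^ 2 + y ^ 2)"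
proof -
  define s where "s = x ^ 2 + y ^ 2"
  have "s ^ 2 + b * s + 1 = (2 - a) * (x ^ 2 * y ^ 2)"
    using assms unfolding s_def by algebra
  moreover have "(a + 2) * s ^ 2 + 4 * b * s + 4 = (a - 2) * (x ^ 2 - y ^ 2) ^ 2"
    using assms unfolding s_def by algebra
  ultimately show ?thesis
    using a_ne2 by (auto simp: special_def generic_def s_def[symmetric])
qed

text \<open>The equation of the curve prescribes the product \<open>m\<close> of the squares; the
  squares are then the roots of a quadratic with sum \<open>s\<close>.\<close>

lemma fibre_nonempty: "\<exists>x y. on_curve x y \<and> x ^ 2 + y ^ 2 = s"
proof -
  define m where "m = - (s ^ 2 + b * s + 1) / (a - 2)"
  have m: "(a - 2) * m = - (s ^ 2 + b * s + 1)" using a_ne2 by (simp add: m_def)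
  obtain X where X: "poly [:m, - s, 1:] X = 0"
    using fundamental_theorem_of_algebra_alt[of "[:m, - s, 1:]"] by auto
  define x y where "x = csqrt X" and "y = csqrt (s - X)"
  have xy: "x ^ 2 = X" "y ^ 2 = s - X" by (simp_all add: x_def y_def)
  have "m = X * (s - X)" using X by (simp add: algebra_simps)
  then have "on_curve x y" using xy m by algebra
  moreover have "x ^ 2 + y ^ 2 = s" using xy by simp
  ultimately show ?thesis by blast
qed

text \<open>The fibre consists of the eight images of one point under sign changes and exchange.
  They are distinct for a generic point and coincide in pairs otherwise, the origin not being on the
  curve.\<close>

lemma fibre_card:
  shows "special s \<Longrightarrow> card (fibre s) = 4" and "\<not> special s \<Longrightarrow> card (fibre s) = 8" and "fibre s \<noteq> {}" and "finite (fibre s)"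
proof -
  obtain x y where xy: "on_curve x y" "x ^ 2 + y ^ 2 = s" using fibre_nonempty by blast
  define T where "T = {(x, y), (x, - y), (- x, y), (- x, - y), (y, x), (y, - x), (- y, x), (- y, - x)}"
  have "fibre s = (\<lambda>(x, y). apoint x y) ` T"
  proof
    show "fibre s \<subseteq> (\<lambda>(x, y). apoint x y) ` T"
    proof
      fix q assume "q \<in> fibre s"
      then obtain x' y' where q: "q = apoint x' y'" "on_curve x' y'" "x' ^ 2 + y' ^ 2 = s" by (auto simp: fibre_def)
      have "(x', y') \<in> T"
        using on_curve_same_s[OF xy(1) q(2)] q(3) xy(2) by (auto simp: T_def)
      then show "q \<in> (\<lambda>(x, y). apoint x y) ` T" using q(1) by auto
    qed
    show "(\<lambda>(x, y). apoint x y) ` T \<subseteq> fibre s"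
      using xy by (auto simp: T_def apoint_fibre_iff algebra_simps)
  qed
  moreover have "inj_on (\<lambda>(x, y). apoint x y) T" by (rule inj_onI) (auto simp: apoint_eq_iff)
  ultimately have c: "card (fibre s) = card T" by (simp add: card_image)
  have "finite T" "T \<noteq> {}" by (simp_all add: T_def)
  then show "fibre s \<noteq> {}" "finite (fibre s)" unfolding \<open>fibre s = _\<close> by simp_all
  have neg: "- z = z \<longleftrightarrow> z = 0" "z = - z \<longleftrightarrow> z = 0" for z :: complex
    by (simp_all add: complex_eq_iff)
  have sq: "x \<noteq> y \<and> x \<noteq> - y \<and> y \<noteq> x \<and> - y \<noteq> x \<and> - x \<noteq> y \<and> y \<noteq> - x" if "x ^ 2 \<noteq> y ^ 2"
    using that by auto
  show "card (fibre s) = 8" if "\<not> special s"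
  proof -
    have "generic x y" using generic_iff[OF xy(1)] that xy(2) by simp
    then have "x \<noteq> 0" "y \<noteq> 0" "x ^ 2 \<noteq> y ^ 2" by (auto simp: generic_def)
    then show ?thesis unfolding c T_def using sq by (simp add: neg)
  qed
  show "card (fibre s) = 4" if "special s"
  proof -
    have "\<not> generic x y" using generic_iff[OF xy(1)] that xy(2) by simp
    then consider "x = 0" | "y = 0" | "x ^ 2 = y ^ 2" by (auto simp: generic_def)
    then show ?thesis
    proof cases
      case 1
      then have "y \<noteq> 0" using xy(1) by auto
      moreover have "T = {(0, y), (0, - y), (y, 0), (- y, 0)}" using 1 by (auto simp: T_def)
      ultimately show ?thesis unfolding c by (simp add: neg)
    next
      case 2
      then have "x \<noteq> 0" using xy(1) by auto
      moreover have "T = {(x, 0), (- x, 0), (0, x), (0, - x)}" using 2 by (auto simp: T_def)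
      ultimately show ?thesis unfolding c by (simp add: neg)
    next
      case 3
      then have "y = x \<or> y = - x" by (auto simp: power2_eq_iff)
      moreover have "x \<noteq> 0" using 3 xy(1) by auto
      moreover have "T = {(x, x), (x, - x), (- x, x), (- x, - x)}" using calculation(1) by (auto simp: T_def)
      ultimately show ?thesis unfolding c by (simp add: neg)
    qed
  qed
qed

lemma fibre_disjoint: "s \<noteq> s' \<Longrightarrow> fibre s \<inter> fibre s' = {}"
  by (auto simp: fibre_def apoint_eq_iff)

text \<open>Fibres are orbits, nonempty and pairwise disjoint, so the values of \<open>s\<close> in
  \<open>A\<close> index the orbits without repetition.\<close>

lemma decomposes_fibre:
  assumes "finite A"
  shows "decomposes_into_orbits (\<Union>s\<in>A. fibre s) (image_mset (\<lambda>s. card (fibre s)) (mset_set A))"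
    and "card (\<Union>s\<in>A. fibre s) = (\<Sum>s\<in>A. card (fibre s))"
proof -
  have o: "orbits G1 (\<Union>s\<in>A. fibre s) (\<lambda>g. g) = fibre ` A"
  proof (intro subset_antisym subsetI)
    fix X assume "X \<in> orbits G1 (\<Union>s\<in>A. fibre s) (\<lambda>g. g)"
    then obtain p s where "X = G1_orbit p" "s \<in> A" "p \<in> fibre s" by (auto simp: orbits_def)
    then show "X \<in> fibre ` A" by (simp add: orbit_fibre)
  next
    fix X assume "X \<in> fibre ` A"
    then obtain s where s: "s \<in> A" "X = fibre s" by blast
    then obtain p where "p \<in> fibre s" using fibre_card(3) by blast
    then have "X = G1_orbit p" using s(2) orbit_fibre by simp
    then show "X \<in> orbits G1 (\<Union>s\<in>A. fibre s) (\<lambda>g. g)"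
      using s(1) \<open>p \<in> fibre s\<close> unfolding orbits_def by blast
  qed
  have inj: "inj_on fibre A"
  proof (rule inj_onI)
    fix s s' assume "fibre s = fibre s'"
    then show "s = s'" using fibre_disjoint[of s s'] fibre_card(3)[of s'] by auto
  qed
  show "decomposes_into_orbits (\<Union>s\<in>A. fibre s) (image_mset (\<lambda>s. card (fibre s)) (mset_set A))"
    unfolding decomposes_into_orbits_def o
    using assms fibre_card(4) by (simp add: image_mset_mset_set[OF inj, symmetric] multiset.map_comp comp_def)
  show "card (\<Union>s\<in>A. fibre s) = (\<Sum>s\<in>A. card (fibre s))"
    using assms fibre_card(4) fibre_disjoint by (intro card_UN_disjoint) auto
qed

end

context flex_quartic
begin

section \<open>Counting flexes\<close>

definition flex_roots :: "complex set" where
  "flex_roots = {s. poly flex_poly s = 0}"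

lemma a_plus_2: "a + 2 \<noteq> 0"
  using a_ne2(2) by (simp add: eq_neg_iff_add_eq_0)

lemma flex_poly_degree: "degree flex_poly = 3" "flex_poly \<noteq> 0"
  using b_ne0 a_plus_2 by (simp_all add: flex_poly_def)

lemma finite_flex_roots: "finite flex_roots"
  unfolding flex_roots_def using flex_poly_degree(2) by (rule poly_roots_finite)

lemma sum_order_flex_poly: "(\<Sum>s\<in>flex_roots. order s flex_poly) = 3"
proof -
  have "(\<Sum>s\<in>set_mset (proots flex_poly). count (proots flex_poly) s) = 3"
    using size_proots_complex[of flex_poly] flex_poly_degree by (simp add: size_multiset_overloaded_eq)
  then show ?thesis using flex_poly_degree(2) by (simp add: flex_roots_def)
qed

lemma tangent_mult_apoint:
  assumes "apoint x y \<in> fibre s"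
  shows "s \<notin> flex_roots \<Longrightarrow> tangent_mult (apoint x y) = 2"
    and "s \<in> flex_roots \<Longrightarrow> special s \<Longrightarrow> tangent_mult (apoint x y) = 4 \<and> order s flex_poly = 1"
    and "s \<in> flex_roots \<Longrightarrow> \<not> special s \<Longrightarrow> tangent_mult (apoint x y) = 2 + enat (order s flex_poly) \<and> order s flex_poly \<in> {1, 2}"
proof -
  have oc: "on_curve x y" and s: "x ^ 2 + y ^ 2 = s" using assms by (auto simp: apoint_fibre_iff)
  note I = tangent_mult_affine[OF oc apoint_def, unfolded s] and g = generic_iff[OF oc, unfolded s]
  show "s \<notin> flex_roots \<Longrightarrow> tangent_mult (apoint x y) = 2" using I(2) by (simp add: flex_roots_def)
  show "s \<in> flex_roots \<Longrightarrow> special s \<Longrightarrow> tangent_mult (apoint x y) = 4 \<and> order s flex_poly = 1"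
    using I(4) g by (simp add: flex_roots_def)
  assume h: "s \<in> flex_roots" and sp: "\<not> special s"
  then have e: "tangent_mult (apoint x y) = 2 + enat (order s flex_poly)" using I(3) g by (simp add: flex_roots_def)
  have "order s flex_poly \<noteq> 0" using h flex_poly_degree(2) by (simp add: flex_roots_def order_root)
  moreover have "enat (2 + order s flex_poly) \<in> {2, 3, 4}" using I(1) unfolding e by (simp add: numeral_eq_enat)
  then have "order s flex_poly \<le> 2" by (auto simp: numeral_eq_enat)
  ultimately show "tangent_mult (apoint x y) = 2 + enat (order s flex_poly) \<and> order s flex_poly \<in> {1, 2}"
    using e by auto
qed

text \<open>Each root in \<open>simple_roots\<close> yields an orbit of eight ordinary flexes, in
  \<open>double_roots\<close> one of eight hyperflexes, in \<open>special_roots\<close> one of four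
  hyperflexes.\<close>

definition simple_roots :: "complex set" where
  "simple_roots = {s \<in> flex_roots. \<not> special s \<and> order s flex_poly = 1}"

definition double_roots :: "complex set" where
  "double_roots = {s \<in> flex_roots. \<not> special s \<and> order s flex_poly = 2}"

definition special_roots :: "complex set" where
  "special_roots = {s \<in> flex_roots. special s}"

text \<open>Geometry bounds the multiplicities: the fibre over a root contains a point, and the
  contact there is at most four.\<close>

lemma flex_roots_order:
  assumes "s \<in> flex_roots"
  shows "special s \<Longrightarrow> order s flex_poly = 1" "\<not> special s \<Longrightarrow> order s flex_poly = 1 \<or> order s flex_poly = 2"
proof -
  obtain x y where "apoint x y \<in> fibre s" using fibre_nonempty[of s] by (auto simp: apoint_fibre_iff)
  from tangent_mult_apoint[OF this] assms show "special s \<Longrightarrow> order s flex_poly = 1"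
    "\<not> special s \<Longrightarrow> order s flex_poly = 1 \<or> order s flex_poly = 2" by auto
qed

lemma finite_roots: "finite simple_roots" "finite double_roots" "finite special_roots"
  using finite_flex_roots by (auto simp: simple_roots_def double_roots_def special_roots_def)

lemma card_roots: "card simple_roots + 2 * card double_roots + card special_roots = 3"
proof -
  have "flex_roots = simple_roots \<union> (double_roots \<union> special_roots)"
    using flex_roots_order by (auto simp: simple_roots_def double_roots_def special_roots_def)
  moreover have "simple_roots \<inter> (double_roots \<union> special_roots) = {}" "double_roots \<inter> special_roots = {}"
    by (auto simp: simple_roots_def double_roots_def special_roots_def)
  ultimately have "(\<Sum>s\<in>flex_roots. order s flex_poly) = (\<Sum>s\<in>simple_roots. order s flex_poly) +
      ((\<Sum>s\<in>double_roots. order s flex_poly) + (\<Sum>s\<in>special_roots. order s flex_poly))"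
    using finite_roots by (simp add: sum.union_disjoint)
  moreover have "(\<Sum>s\<in>simple_roots. order s flex_poly) = card simple_roots"
    "(\<Sum>s\<in>double_roots. order s flex_poly) = 2 * card double_roots"
    "(\<Sum>s\<in>special_roots. order s flex_poly) = card special_roots"
    using flex_roots_order(1) by (simp_all add: simple_roots_def double_roots_def special_roots_def)
  ultimately show ?thesis using sum_order_flex_poly by simp
qed

lemma curve_cases:
  assumes "p \<in> curve F"
  obtains x y s where "p = apoint x y" "apoint x y \<in> fibre s" | "tangent_mult p = 2"
  using assms
proof (cases rule: local_param_cases)
  case (1 u x y)
  then have "p = apoint (x $ 0) (y $ 0)" "on_curve (x $ 0) (y $ 0)" by (auto simp: affine_arc_def apoint_def)
  then show ?thesis using that(1)[of "x $ 0" "y $ 0" "(x $ 0) ^ 2 + (y $ 0) ^ 2"] by (simp add: apoint_fibre_iff)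
next
  case (2 u y z)
  then show ?thesis using that(2) tangent_mult_infinite by blast
qed

lemma fibre_curve: "p \<in> fibre s \<Longrightarrow> p \<in> curve F"
  using affine_point_in_curve by (auto simp: fibre_def apoint_def)

lemma enat_numeral_facts: "(2 :: enat) \<noteq> 3" "(2 :: enat) \<noteq> 4" "(4 :: enat) \<noteq> 3" "(3 :: enat) \<noteq> 4" "2 + enat 1 = 3" "2 + enat 2 = 4"
  by (simp_all add: numeral_eq_enat)

lemma ordinary_flexes_eq: "ordinary_flexes F = (\<Union>s\<in>simple_roots. fibre s)"
proof (intro subset_antisym subsetI)
  fix p assume "p \<in> ordinary_flexes F"
  then have p: "p \<in> curve F" "tangent_mult p = 3" by (simp_all add: ordinary_flexes_iff)
  from p(1) show "p \<in> (\<Union>s\<in>simple_roots. fibre s)"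
  proof (cases rule: curve_cases)
    case (1 x y s)
    note I = tangent_mult_apoint[OF 1(2), folded 1(1)]
    have h: "s \<in> flex_roots" "\<not> special s" using I p(2) enat_numeral_facts by auto
    then have "order s flex_poly = 1" using I(3) p(2) enat_numeral_facts by auto
    then show ?thesis using h 1 by (auto simp: simple_roots_def)
  qed (use p(2) enat_numeral_facts in simp)
next
  fix p assume "p \<in> (\<Union>s\<in>simple_roots. fibre s)"
  then obtain s where s: "s \<in> simple_roots" "p \<in> fibre s" by blast
  then obtain x y where xy: "p = apoint x y" by (auto simp: fibre_def)
  show "p \<in> ordinary_flexes F"
    using tangent_mult_apoint(3)[of x y s] s fibre_curve enat_numeral_facts(5) by (simp add: ordinary_flexes_iff simple_roots_def xy)
qed

lemma hyperflexes_eq: "hyperflexes F = (\<Union>s\<in>double_roots \<union> special_roots. fibre s)"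
proof (intro subset_antisym subsetI)
  fix p assume "p \<in> hyperflexes F"
  then have p: "p \<in> curve F" "tangent_mult p = 4" by (simp_all add: hyperflexes_iff)
  from p(1) show "p \<in> (\<Union>s\<in>double_roots \<union> special_roots. fibre s)"
  proof (cases rule: curve_cases)
    case (1 x y s)
    note I = tangent_mult_apoint[OF 1(2), folded 1(1)]
    have h: "s \<in> flex_roots" using I p(2) enat_numeral_facts by auto
    moreover have "special s \<or> order s flex_poly = 2"
    proof (rule ccontr)
      assume n: "\<not> ?thesis"
      then have "tangent_mult p = 2 + enat 1" using I(3)[OF h] by auto
      then show False using p(2) enat_numeral_facts(4,5) by simp
    qed
    ultimately have "s \<in> double_roots \<union> special_roots" by (auto simp: double_roots_def special_roots_def)
    then show ?thesis using 1 by auto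
  qed (use p(2) enat_numeral_facts in simp)
next
  fix p assume "p \<in> (\<Union>s\<in>double_roots \<union> special_roots. fibre s)"
  then obtain s where s: "s \<in> double_roots \<union> special_roots" "p \<in> fibre s" by blast
  then obtain x y where xy: "p = apoint x y" by (auto simp: fibre_def)
  have "tangent_mult p = 4"
    using tangent_mult_apoint(2,3)[of x y s] s enat_numeral_facts(6) by (auto simp: double_roots_def special_roots_def xy)
  then show "p \<in> hyperflexes F"
    using s(2) fibre_curve by (simp add: hyperflexes_iff)
qed

section \<open>Special roots in terms of \<open>P_ab\<close> and \<open>Q_ab\<close>\<close>

lemma flex_poly_eval: "poly flex_poly s = b * (a + 2) * s ^ 3 + 6 * (a + 2) * s ^ 2 + 3 * b * (a + 6 - b ^ 2) * s + 2 * (a + 6 - b ^ 2)"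
  by (simp add: flex_poly_def expand_powers algebra_simps)

text \<open>Modulo the quadratic the cubic factors; \<open>s\<close> and \<open>b ^ 2 - 4\<close>
  are nonzero, which leaves a linear condition on \<open>s\<close>.\<close>

lemma special_root_axis:
  assumes "s ^ 2 + b * s + 1 = 0"
  shows "poly flex_poly s = 0 \<longleftrightarrow> a * s + b = 0"
proof -
  have "poly flex_poly s = - (s * (b ^ 2 - 4) * (a * s + b))"
    unfolding flex_poly_eval using assms by algebra
  moreover have "s \<noteq> 0" using assms by auto
  ultimately show ?thesis using b_ne by simp
qed

lemma special_root_diagonal:
  assumes "(a + 2) * s ^ 2 + 4 * b * s + 4 = 0"
  shows "poly flex_poly s = 0 \<longleftrightarrow> (6 - a) * s + 2 * b = 0"
proof -
  have "2 * poly flex_poly s = - (s * (b ^ 2 - a - 2) * ((6 - a) * s + 2 * b))"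
    unfolding flex_poly_eval using assms by algebra
  moreover have "s \<noteq> 0" using assms by auto
  moreover have "b ^ 2 - a - 2 \<noteq> 0" using ab_ne by (auto simp: diff_diff_eq)
  ultimately show ?thesis by auto
qed

text \<open>\<open>P_ab\<close> and \<open>Q_ab\<close> arise by elimination of \<open>s\<close>:
  inserting the root of the linear condition into the quadratic gives
  \<open>P_ab a b / a ^ 2\<close> and \<open>4 * Q_ab a b / (6 - a) ^ 2\<close>,
  respectively.\<close>

lemma special_roots_eq:
  "special_roots = (if P_ab a b = 0 then {- b / a} else {}) \<union> (if Q_ab a b = 0 then {- 2 * b / (6 - a)} else {})"
proof (intro Set.set_eqI)
  fix s
  have P: "s ^ 2 + b * s + 1 = 0 \<and> a * s + b = 0 \<longleftrightarrow> P_ab a b = 0 \<and> s = - b / a"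
  proof (cases "a = 0")
    \<comment> \<open>Here \<open>- b / a\<close> is the default value \<open>0\<close>, but both
      sides are false: the linear condition reads \<open>b = 0\<close>, and \<open>P_ab\<close>
      equals \<open>b ^ 2\<close>.\<close>
    case True
    then show ?thesis using b_ne0 by (simp add: P_ab_def)
  next
    case False
    have "a * s + b = 0 \<longleftrightarrow> s = - b / a"
      using False by (auto simp: field_simps add_eq_0_iff)
    moreover have "a ^ 2 * (s ^ 2 + b * s + 1) = P_ab a b" if "a * s + b = 0"
      using that unfolding P_ab_def by algebra
    ultimately show ?thesis using False by (metis mult_eq_0_iff power_not_zero)
  qed
  have Q: "(a + 2) * s ^ 2 + 4 * b * s + 4 = 0 \<and> (6 - a) * s + 2 * b = 0 \<longleftrightarrow> Q_ab a b = 0 \<and> s = - 2 * b / (6 - a)"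
  proof (cases "a = 6")
    \<comment> \<open>Again a division by zero with both sides false, as
      \<open>b \<noteq> 0\<close>.\<close>
    case True
    have "Q_ab a b = 8 * b ^ 2" unfolding Q_ab_def True by algebra
    then show ?thesis using b_ne0 True by simp
  next
    case False
    then have a6: "6 - a \<noteq> 0" by simp
    have "(6 - a) * s + 2 * b = 0 \<longleftrightarrow> s = - 2 * b / (6 - a)"
      using a6 by (auto simp: field_simps add_eq_0_iff)
    moreover have "(6 - a) ^ 2 * ((a + 2) * s ^ 2 + 4 * b * s + 4) = 4 * Q_ab a b" if "(6 - a) * s + 2 * b = 0"
      using that unfolding Q_ab_def by algebra
    ultimately show ?thesis using a6 by (metis mult_eq_0_iff power_not_zero zero_neq_numeral)
  qed
  have "s \<in> special_roots \<longleftrightarrow> (s ^ 2 + b * s + 1 = 0 \<and> a * s + b = 0) \<or>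
      ((a + 2) * s ^ 2 + 4 * b * s + 4 = 0 \<and> (6 - a) * s + 2 * b = 0)"
    unfolding special_roots_def flex_roots_def special_def
    using special_root_axis[of s] special_root_diagonal[of s] by blast
  then show "s \<in> special_roots \<longleftrightarrow>
      s \<in> (if P_ab a b = 0 then {- b / a} else {}) \<union> (if Q_ab a b = 0 then {- 2 * b / (6 - a)} else {})"
    unfolding P Q by auto
qed

text \<open>When both values occur they are different: equality would force \<open>b = 0\<close> or
  \<open>a = 2\<close>.\<close>

lemma card_special_roots:
  "card special_roots = (if P_ab a b = 0 then 1 else 0) + (if Q_ab a b = 0 then 1 else 0)"
proof -
  have "- b / a \<noteq> - 2 * b / (6 - a)" if PQ: "P_ab a b = 0" "Q_ab a b = 0"
  proof
    assume e: "- b / a = - 2 * b / (6 - a)"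
    have a0: "a \<noteq> 0" using PQ(1) b_ne0 by (auto simp: P_ab_def)
    have "a \<noteq> 6"
    proof
      assume a6: "a = 6"
      have "Q_ab a b = 8 * b ^ 2" unfolding Q_ab_def a6 by algebra
      then show False using PQ(2) b_ne0 by simp
    qed
    then have "b * (6 - a) = 2 * b * a" using e a0 by (simp add: field_simps)
    then have "3 * b * (a - 2) = 0" by algebra
    then show False using b_ne0 a_ne2 by simp
  qed
  then show ?thesis unfolding special_roots_eq by auto
qed

lemma orbit_structure:
  "card (ordinary_flexes F) = 8 * card simple_roots"
  "decomposes_into_orbits (ordinary_flexes F) (replicate_mset (card simple_roots) 8)"
  "card (hyperflexes F) = 8 * card double_roots + 4 * card special_roots"
  "decomposes_into_orbits (hyperflexes F)
     (replicate_mset (card double_roots) 8 + replicate_mset (card special_roots) 4)"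
proof -
  have c: "card (fibre s) = (if special s then 4 else 8)" for s using fibre_card by simp
  have "image_mset (\<lambda>s. card (fibre s)) (mset_set simple_roots) = image_mset (\<lambda>s. 8) (mset_set simple_roots)"
    using finite_roots by (intro image_mset_cong) (auto simp: c simple_roots_def)
  then have 1: "image_mset (\<lambda>s. card (fibre s)) (mset_set simple_roots) = replicate_mset (card simple_roots) 8"
    by (simp add: image_mset_const_eq)
  have "image_mset (\<lambda>s. card (fibre s)) (mset_set double_roots) = image_mset (\<lambda>s. 8) (mset_set double_roots)"
    using finite_roots by (intro image_mset_cong) (auto simp: c double_roots_def)
  then have 2: "image_mset (\<lambda>s. card (fibre s)) (mset_set double_roots) = replicate_mset (card double_roots) 8"
    by (simp add: image_mset_const_eq)
  have "image_mset (\<lambda>s. card (fibre s)) (mset_set special_roots) = image_mset (\<lambda>s. 4) (mset_set special_roots)"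
    using finite_roots by (intro image_mset_cong) (auto simp: c special_roots_def)
  then have 3: "image_mset (\<lambda>s. card (fibre s)) (mset_set special_roots) = replicate_mset (card special_roots) 4"
    by (simp add: image_mset_const_eq)
  have disj: "double_roots \<inter> special_roots = {}" by (auto simp: double_roots_def special_roots_def)
  have 4: "image_mset (\<lambda>s. card (fibre s)) (mset_set (double_roots \<union> special_roots)) =
      replicate_mset (card double_roots) 8 + replicate_mset (card special_roots) 4"
    using mset_set_Union[OF finite_roots(2,3) disj] 2 3 by simp
  show "decomposes_into_orbits (ordinary_flexes F) (replicate_mset (card simple_roots) 8)"
    using decomposes_fibre(1)[OF finite_roots(1)] unfolding 1 ordinary_flexes_eq .
  show "decomposes_into_orbits (hyperflexes F)
     (replicate_mset (card double_roots) 8 + replicate_mset (card special_roots) 4)"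
    using decomposes_fibre(1)[of "double_roots \<union> special_roots"] finite_roots unfolding 4 hyperflexes_eq by simp
  have "(\<Sum>s\<in>simple_roots. card (fibre s)) = (\<Sum>s\<in>simple_roots. 8)"
    by (intro sum.cong) (auto simp: c simple_roots_def)
  then show "card (ordinary_flexes F) = 8 * card simple_roots"
    unfolding ordinary_flexes_eq decomposes_fibre(2)[OF finite_roots(1)] by simp
  have "(\<Sum>s\<in>double_roots. card (fibre s)) = (\<Sum>s\<in>double_roots. 8)"
    "(\<Sum>s\<in>special_roots. card (fibre s)) = (\<Sum>s\<in>special_roots. 4)"
    by (intro sum.cong; auto simp: c double_roots_def special_roots_def)+
  then show "card (hyperflexes F) = 8 * card double_roots + 4 * card special_roots"
    unfolding hyperflexes_eq using decomposes_fibre(2)[of "double_roots \<union> special_roots"] finite_roots disj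
    by (simp add: sum.union_disjoint)
qed

end

theorem theorem3p14:
  fixes a b :: complex
  assumes "b \<noteq> 0"
    and "(a ^ 2 - 4) * (b ^ 2 - 4) * (a ^ 2 - 1) * (b ^ 2 - a - 2) \<noteq> 0"
  shows
    "(\<forall>K. canonical_divisor (quartic a b) K \<longrightarrow>
        one_weierstrass_points (quartic a b) K
          = ordinary_flexes (quartic a b) \<union> hyperflexes (quartic a b)) \<and>
     (P_ab a b = 0 \<and> Q_ab a b = 0 \<longrightarrow>
        card (ordinary_flexes (quartic a b)) = 8 \<and>
        decomposes_into_orbits (ordinary_flexes (quartic a b)) {#8#} \<and>
        card (hyperflexes (quartic a b)) = 8 \<and>
        decomposes_into_orbits (hyperflexes (quartic a b)) {#4, 4#}) \<and>
     (P_ab a b = 0 \<and> Q_ab a b \<noteq> 0 \<longrightarrow>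
        (ordinary_flexes (quartic a b) = {} \<and>
         card (hyperflexes (quartic a b)) = 12 \<and>
         decomposes_into_orbits (hyperflexes (quartic a b)) {#4, 8#}) \<or>
        (card (ordinary_flexes (quartic a b)) = 16 \<and>
         decomposes_into_orbits (ordinary_flexes (quartic a b)) {#8, 8#} \<and>
         card (hyperflexes (quartic a b)) = 4 \<and>
         decomposes_into_orbits (hyperflexes (quartic a b)) {#4#})) \<and>
     (P_ab a b \<noteq> 0 \<and> Q_ab a b = 0 \<longrightarrow>
        (ordinary_flexes (quartic a b) = {} \<and>
         card (hyperflexes (quartic a b)) = 12 \<and>
         decomposes_into_orbits (hyperflexes (quartic a b)) {#4, 8#}) \<or>
        (card (ordinary_flexes (quartic a b)) = 16 \<and>
         decomposes_into_orbits (ordinary_flexes (quartic a b)) {#8, 8#} \<and>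
         card (hyperflexes (quartic a b)) = 4 \<and>
         decomposes_into_orbits (hyperflexes (quartic a b)) {#4#})) \<and>
     (P_ab a b \<noteq> 0 \<and> Q_ab a b \<noteq> 0 \<longrightarrow>
        (card (ordinary_flexes (quartic a b)) = 24 \<and>
         decomposes_into_orbits (ordinary_flexes (quartic a b)) {#8, 8, 8#} \<and>
         hyperflexes (quartic a b) = {}) \<or>
        (card (ordinary_flexes (quartic a b)) = 8 \<and>
         decomposes_into_orbits (ordinary_flexes (quartic a b)) {#8#} \<and>
         card (hyperflexes (quartic a b)) = 8 \<and>
         decomposes_into_orbits (hyperflexes (quartic a b)) {#8#}))"
proof -
  have "a ^ 2 \<noteq> 4" "b ^ 2 \<noteq> 4" "b ^ 2 \<noteq> a + 2"
    using assms(2) by (auto simp: diff_diff_eq)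
  then interpret flex_quartic a b
    using assms(1) by unfold_locales
  define n1 n2 n3 where "n1 = card simple_roots" and "n2 = card double_roots" and "n3 = card special_roots"
  \<comment> \<open>With \<open>n3\<close> fixed by \<open>P_ab\<close> and \<open>Q_ab\<close>, the
    equation has a single solution in natural numbers for \<open>n3 = 2\<close> and two for
    \<open>n3 = 1\<close> and for \<open>n3 = 0\<close>; these are the alternatives in the
    statement.\<close>
  have n: "n1 + 2 * n2 + n3 = 3" using card_roots by (simp add: n1_def n2_def n3_def)
  have n3: "n3 = (if P_ab a b = 0 then 1 else 0) + (if Q_ab a b = 0 then 1 else 0)"
    unfolding n3_def by (rule card_special_roots)
  note o = orbit_structure[folded n1_def n2_def n3_def]
  have e1: "ordinary_flexes F = {}" if "n1 = 0"
    using that finite_roots unfolding ordinary_flexes_eq n1_def by simp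
  have e2: "hyperflexes F = {}" if "n2 = 0" "n3 = 0"
    using that finite_roots unfolding hyperflexes_eq n2_def n3_def by simp
  have r: "replicate_mset 1 k = {#k#}" "replicate_mset 2 k = {#k, k#}" "replicate_mset 3 k = {#k, k, k#}"
    for k :: nat by (simp_all add: numeral_2_eq_2 numeral_3_eq_3)
  have w: "\<forall>K. canonical_divisor F K \<longrightarrow> one_weierstrass_points F K = ordinary_flexes F \<union> hyperflexes F"
    using one_weierstrass_points_canonical flexes_split by simp
  have c1: "n1 = 1 \<and> n2 = 0 \<and> n3 = 2" if "P_ab a b = 0 \<and> Q_ab a b = 0"
  proof -
    have "n3 = 2" using n3 that by simp
    then show ?thesis using n by arith
  qed
  have c2: "n1 = 0 \<and> n2 = 1 \<and> n3 = 1 \<or> n1 = 2 \<and> n2 = 0 \<and> n3 = 1"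
    if "(P_ab a b = 0 \<and> Q_ab a b \<noteq> 0) \<or> (P_ab a b \<noteq> 0 \<and> Q_ab a b = 0)"
  proof -
    have "n3 = 1" using n3 that by auto
    then show ?thesis using n by arith
  qed
  have c4: "n1 = 3 \<and> n2 = 0 \<and> n3 = 0 \<or> n1 = 1 \<and> n2 = 1 \<and> n3 = 0" if "P_ab a b \<noteq> 0 \<and> Q_ab a b \<noteq> 0"
  proof -
    have "n3 = 0" using n3 that by auto
    then show ?thesis using n by arith
  qed
  let ?O = "ordinary_flexes F" and ?H = "hyperflexes F" and ?D = decomposes_into_orbits
  have s1: "card ?O = 8 \<and> ?D ?O {#8#} \<and>
      card ?H = 8 \<and> ?D ?H {#4, 4#}"
    if "P_ab a b = 0 \<and> Q_ab a b = 0"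
    using o c1[OF that] by (simp add: r)
  have s2: "(?O = {} \<and> card ?H = 12 \<and>
      ?D ?H {#4, 8#}) \<or>
      (card ?O = 16 \<and> ?D ?O {#8, 8#} \<and>
      card ?H = 4 \<and> ?D ?H {#4#})"
    if "(P_ab a b = 0 \<and> Q_ab a b \<noteq> 0) \<or> (P_ab a b \<noteq> 0 \<and> Q_ab a b = 0)"
    using c2[OF that]
  proof
    assume k: "n1 = 0 \<and> n2 = 1 \<and> n3 = 1"
    have "replicate_mset 1 8 + replicate_mset 1 4 = {#4, 8 :: nat#}" by simp
    then show ?thesis using o e1 k by simp
  next
    assume k: "n1 = 2 \<and> n2 = 0 \<and> n3 = 1"
    then show ?thesis using o by (simp add: r)
  qed
  have s4: "(card ?O = 24 \<and> ?D ?O {#8, 8, 8#} \<and>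
      ?H = {}) \<or>
      (card ?O = 8 \<and> ?D ?O {#8#} \<and>
      card ?H = 8 \<and> ?D ?H {#8#})"
    if "P_ab a b \<noteq> 0 \<and> Q_ab a b \<noteq> 0"
    using c4[OF that]
  proof
    assume k: "n1 = 3 \<and> n2 = 0 \<and> n3 = 0"
    then show ?thesis using o e2 by (simp add: r)
  next
    assume k: "n1 = 1 \<and> n2 = 1 \<and> n3 = 0"
    then show ?thesis using o by simp
  qed
  show ?thesis using w s1 s2 s4 by blast
qed

end
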